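(* Let $G$ and $H$ be étale (localic) groupoids with quantales $Q:=\mathcal O(G)$ and $R:=\mathcal O(H)$, and let $X$ be a $G$-$H$-bisheaf (equivalently, a $Q$-$R$-bisheaf). Then $X$ is a principal $G$-$H$-bisheaf if and only if the following conditions hold: 1. $\langle s,s\rangle\le e_Q$ for all $s\in\Gamma^{\mathrm{bi}}_X$; 2. $[1_X,1_X]\ge e_R$; 3. $1_X\tau(s)\le 1_Q s$ for all $s\in\Gamma^{\mathrm{bi}}_X$. Moreover, the left projection $p:X\to G_0$ is a surjection if and only if 4. $\langle 1_X,1_X\rangle\ge e_Q$, and in this case $\langle-,-\rangle:X\times X\to Q$ is surjective.
   Context: Locales: a map of locales $f:X\to Y$ is given by its inverse image frame homomorphism $f^*:Y\to X$; if $f^*$ has a left adjoint it is denoted $f_!$. $f$ is open if $f_!$ exists and $f_!(x\wedge f^*(y))=f_!(x)\wedge y$; it is a surjection if $f^*$ is injective; a local homeomorphism is an open map for which there is $S\subset X$ with $\bigvee S=1_X$ such that $f_!$ restricts to isomorphisms ${\downarrow}s\cong{\downarrow}f_!(s)$ for $s\in S$. $X\otimes_BY$ denotes the pullback of locale maps $X\to B\leftarrow Y$, with projections $\pi_1,\pi_2$, and $x\otimes y=\pi_1^*(x)\wedge\pi_2^*(y)$. Top elements are denoted $1$. Groupoids: a localic groupoid $G$ has locales $G_0,G_1$ and structure maps $d,r,u,i,m$ (domain, range, units, inversion, multiplication), with $m$ defined on the pullback of $r$ (first factor) and $d$ (second factor). $G$ is étale if $d$ is a local homeomorphism. A left $G$-locale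 is a locale $X$ with a map $p:X\to G_0$ and an associative unital action $\mathfrak a:G_1\otimes_{G_0}X\to X$ (pullback of $r$ and $p$) with $p\circ\mathfrak a=d\circ\pi_1$; right $H$-locales (projection $q:X\to H_0$, action $\mathfrak b$ on the pullback $X\otimes_{H_0}H_1$ of $q$ and $d$) are defined symmetrically. A $G$-$H$-bilocale has both structures, with $p$ invariant under the $H$-action, $q$ invariant under the $G$-action, and commuting actions. It is a $G$-$H$-bisheaf if $p$ and $q$ are local homeomorphisms. A principal $G$-$H$-bisheaf is a $G$-$H$-bisheaf such that $q:X\to H_0$ is an (open) surjection and $\langle\mathfrak a,\pi_2\rangle:G_1\otimes_{G_0}X\to X\otimes_{H_0}X$ is an isomorphism of locales. Quantales: $\mathcal O(G)$ is the locale $G_1$ with $ab=m_!(a\otimes b)$, $a^*=i_!(a)$, unit $e=u_!(1_{G_0})$. For $Q=\mathcal O(G)$ put $Q_0={\downarrow}e_Q\cong G_0$, $Q_{\mathcal I}=\{s\in Q:ss^*\vee s^*s\le e\}$, $\varsigma_Q(a)=aa^*\wedge e$. Let $R=\mathcal O(H)$, similarly. A $G$-$H$-bisheaf $X$ is a $Q$-$R$-bimodule by $ax=\mathfrak a_!(a\otimes x)$ and $xr=\mathfrak b_!(x\otimes r)$. Let $\varsigma_X=u_!\circ p_!:X\to Q_0$ and $\tau=u_!\circ q_!:X\to R_0$. Let $\Gamma_X$ be the set of $s\in X$ with $\varsigma_X(x)s=x$ for all $x\le s$, let $\Gamma^\tau_X$ be the set of $s\in X$ with $s\tau(x)=x$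 for all $x\le s$, and let $\Gamma_X^{\mathrm{bi}}=\Gamma_X\cap\Gamma_X^\tau$ (local bisections). Inner products: $\langle-,-\rangle:X\times X\to Q$ is the unique map preserving joins in each variable with, for $s,t\in\Gamma_X$, $\langle s,t\rangle=\bigvee\{v\in Q_{\mathcal I}:\varsigma_Q(v)\le\varsigma_X(s),\ \varsigma_Q(v^* )\le\varsigma_X(t),\ vt\le s\}$; it is left $Q$-linear in the first variable and $\langle x,y\rangle=\langle y,x\rangle^*$. The inner product $[-,-]:X\times X\to R$ is obtained in the same way by regarding $X$ as a left $R$-sheaf via $r\cdot x=xr^*$; it satisfies $[x,yr]=[x,y]r$ and $[x,y]^*=[y,x]$. One has $\varsigma_X(x)=\langle x,x\rangle\wedge e_Q$ and $\tau(x)=[x,x]\wedge e_R$.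
   Formalization: The last clause is false literally (pair groupoid on {1,2} acting on X={1,2}: values are only S×T); it is proved as: if X is principal and p is a surjection, every element of Q is a join of values ⟨x,y⟩. *)

theory Defs
  imports Main
begin

section \<open>Frames and locales\<close>

class frame = complete_lattice +
  assumes inf_Sup_distrib: "inf a (Sup S) = Sup (inf a ` S)"

text \<open>
  A locale is either a type of class \<^class>\<open>frame\<close> (carrier \<^term>\<open>UNIV\<close>), or a subset \<open>A\<close> of a
  complete lattice type such that \<open>A\<close> has a greatest element, is closed under nonempty infima, and
  is a frame in the inherited order. The second form is needed for pullbacks, whose elements are
  certain sets of pairs; there finite meets are those of the ambient type, whereas joins and the top
  element are computed relative to \<open>A\<close>.

  A map of locales \<open>f : A \<rightarrow> B\<close> is represented by its inverse image homomorphism, a function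
  \<open>'b \<Rightarrow> 'a\<close>; hence \<open>id\<close> is the identity map, and composition is reversed.
\<close>

definition join_in :: "'a::complete_lattice set \<Rightarrow> 'a set \<Rightarrow> 'a" where
  "join_in A S = Inf {c \<in> A. \<forall>s\<in>S. s \<le> c}"

definition frame_on :: "'a::complete_lattice set \<Rightarrow> bool" where
  "frame_on A \<longleftrightarrow>
     Sup A \<in> A \<and>
     (\<forall>S\<subseteq>A. S \<noteq> {} \<longrightarrow> Inf S \<in> A) \<and>
     (\<forall>a\<in>A. \<forall>S\<subseteq>A. inf a (join_in A S) = join_in A (inf a ` S))"

definition locale_map ::
  "'a::complete_lattice set \<Rightarrow> 'b::complete_lattice set \<Rightarrow> ('b \<Rightarrow> 'a) \<Rightarrow> bool" where
  "locale_map A B f \<longleftrightarrow>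
     f ` B \<subseteq> A \<and>
     f (Sup B) = Sup A \<and>
     (\<forall>x\<in>B. \<forall>y\<in>B. f (inf x y) = inf (f x) (f y)) \<and>
     (\<forall>S\<subseteq>B. f (join_in B S) = join_in A (f ` S))"

definition loc_comp :: "('c \<Rightarrow> 'b) \<Rightarrow> ('b \<Rightarrow> 'a) \<Rightarrow> 'c \<Rightarrow> 'a" (infixl "\<odot>" 55) where
  "f \<odot> g = (\<lambda>z. g (f z))"

definition locale_iso ::
  "'a::complete_lattice set \<Rightarrow> 'b::complete_lattice set \<Rightarrow> ('b \<Rightarrow> 'a) \<Rightarrow> bool" where
  "locale_iso A B f \<longleftrightarrow>
     locale_map A B f \<and>
     (\<exists>g. locale_map B A g \<and> (\<forall>y\<in>B. g (f y) = y) \<and> (\<forall>x\<in>A. f (g x) = x))"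

text \<open>The value at \<open>a\<close> of the left adjoint \<open>f\<^sub>!\<close> of \<open>f\<^sup>*\<close>, whenever that adjoint exists.\<close>

definition direct_image :: "('b::order \<Rightarrow> 'a::order) \<Rightarrow> 'a \<Rightarrow> 'b" where
  "direct_image f a = (THE b. \<forall>c. b \<le> c \<longleftrightarrow> a \<le> f c)"

definition open_map :: "('b::frame \<Rightarrow> 'a::frame) \<Rightarrow> bool" where
  "open_map f \<longleftrightarrow>
     locale_map UNIV UNIV f \<and>
     (\<forall>a c. direct_image f a \<le> c \<longleftrightarrow> a \<le> f c) \<and>
     (\<forall>x y. direct_image f (inf x (f y)) = inf (direct_image f x) y)"

definition surjection :: "('b::frame \<Rightarrow> 'a::frame) \<Rightarrow> bool" where
  "surjection f \<longleftrightarrow> locale_map UNIV UNIV f \<and> inj f"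

definition local_homeomorphism :: "('b::frame \<Rightarrow> 'a::frame) \<Rightarrow> bool" where
  "local_homeomorphism f \<longleftrightarrow>
     open_map f \<and>
     (\<exists>S. Sup S = top \<and>
       (\<forall>s\<in>S. bij_betw (direct_image f) {..s} {..direct_image f s} \<and>
          (\<forall>x\<in>{..s}. \<forall>y\<in>{..s}. direct_image f x \<le> direct_image f y \<longleftrightarrow> x \<le> y)))"


section \<open>Pullbacks\<close>

text \<open>
  The pullback of \<open>f : A \<rightarrow> C\<close> and \<open>g : B \<rightarrow> C\<close>. As a sup-lattice, the pushout of the frames \<open>A\<close> and
  \<open>B\<close> over \<open>C\<close> is the tensor product of \<open>C\<close>-modules, that is, the quotient of the free sup-lattice on
  \<open>A \<times> B\<close> by bilinearity and by \<open>(x \<and> f\<^sup>*c) \<otimes> y = x \<otimes> (g\<^sup>*c \<and> y)\<close>. Its elements are the down-sets of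
  \<open>A \<times> B\<close> saturated under these relations, ordered by inclusion; \<open>U\<close> stands for the join of all
  \<open>x \<otimes> y\<close> with \<open>(x, y) \<in> U\<close>. (Empty families \<open>S\<close> are included.)
\<close>

definition pullback ::
  "'a::complete_lattice set \<Rightarrow> 'b::complete_lattice set \<Rightarrow> ('c \<Rightarrow> 'a) \<Rightarrow> ('c \<Rightarrow> 'b) \<Rightarrow> ('a \<times> 'b) set set"
where
  "pullback A B f g = {U. U \<subseteq> A \<times> B \<and>
     (\<forall>x y x' y'. (x, y) \<in> U \<longrightarrow> x' \<in> A \<longrightarrow> y' \<in> B \<longrightarrow> x' \<le> x \<longrightarrow> y' \<le> y \<longrightarrow> (x', y') \<in> U) \<and>
     (\<forall>S\<subseteq>A. \<forall>y\<in>B. S \<times> {y} \<subseteq> U \<longrightarrow> (join_in A S, y) \<in> U) \<and>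
     (\<forall>x\<in>A. \<forall>S\<subseteq>B. {x} \<times> S \<subseteq> U \<longrightarrow> (x, join_in B S) \<in> U) \<and>
     (\<forall>x\<in>A. \<forall>y\<in>B. \<forall>c. (inf x (f c), y) \<in> U \<longleftrightarrow> (x, inf (g c) y) \<in> U)}"

definition proj1 ::
  "'a::complete_lattice set \<Rightarrow> 'b::complete_lattice set \<Rightarrow> ('c \<Rightarrow> 'a) \<Rightarrow> ('c \<Rightarrow> 'b) \<Rightarrow> 'a \<Rightarrow> ('a \<times> 'b) set"
where
  "proj1 A B f g x = \<Inter> {U \<in> pullback A B f g. {x} \<times> B \<subseteq> U}"

definition proj2 ::
  "'a::complete_lattice set \<Rightarrow> 'b::complete_lattice set \<Rightarrow> ('c \<Rightarrow> 'a) \<Rightarrow> ('c \<Rightarrow> 'b) \<Rightarrow> 'b \<Rightarrow> ('a \<times> 'b) set"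
where
  "proj2 A B f g y = \<Inter> {U \<in> pullback A B f g. A \<times> {y} \<subseteq> U}"

definition tensor ::
  "'a::complete_lattice set \<Rightarrow> 'b::complete_lattice set \<Rightarrow> ('c \<Rightarrow> 'a) \<Rightarrow> ('c \<Rightarrow> 'b) \<Rightarrow> 'a \<Rightarrow> 'b \<Rightarrow> ('a \<times> 'b) set"
where
  "tensor A B f g x y = inf (proj1 A B f g x) (proj2 A B f g y)"

text \<open>The pairing \<open>\<langle>h, k\<rangle>\<close> of \<open>h : T \<rightarrow> A\<close> and \<open>k : T \<rightarrow> B\<close>, as a map from \<open>T\<close> to a pullback of \<open>A\<close>
  and \<open>B\<close>.\<close>

definition pairing ::
  "'t::complete_lattice set \<Rightarrow> ('a \<Rightarrow> 't) \<Rightarrow> ('b \<Rightarrow> 't) \<Rightarrow> ('a \<times> 'b) set \<Rightarrow> 't" where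
  "pairing T h k U = join_in T ((\<lambda>(x, y). inf (h x) (k y)) ` U)"

text \<open>The construction is a pullback of locales: it is a frame, the projections are locale maps that
  agree over \<open>C\<close>, and pairings have the universal property.\<close>

lemma join_in_UNIV: "join_in UNIV S = Sup S"
  unfolding join_in_def by (rule antisym) (auto intro: Inf_lower Inf_greatest Sup_upper Sup_least)

lemma frame_on_UNIV: "frame_on (UNIV :: 'a::frame set)"
  by (auto simp: frame_on_def join_in_UNIV inf_Sup_distrib)

lemma frame_onD:
  assumes "frame_on A"
  shows frame_on_top: "Sup A \<in> A"
    and frame_on_inf: "a \<in> A \<Longrightarrow> b \<in> A \<Longrightarrow> inf a b \<in> A"
    and frame_on_join: "S \<subseteq> A \<Longrightarrow> join_in A S \<in> A"
    and frame_on_distrib: "a \<in> A \<Longrightarrow> S \<subseteq> A \<Longrightarrow> inf a (join_in A S) = join_in A (inf a ` S)"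
proof -
  have I: "\<And>S. S \<subseteq> A \<Longrightarrow> S \<noteq> {} \<Longrightarrow> Inf S \<in> A" and t: "Sup A \<in> A"
    using assms by (auto simp: frame_on_def)
  show "Sup A \<in> A" by (rule t)
  show "a \<in> A \<Longrightarrow> b \<in> A \<Longrightarrow> inf a b \<in> A" using I[of "{a, b}"] by simp
  show "S \<subseteq> A \<Longrightarrow> join_in A S \<in> A"
    unfolding join_in_def using t by (intro I) (auto intro: Sup_upper)
  show "a \<in> A \<Longrightarrow> S \<subseteq> A \<Longrightarrow> inf a (join_in A S) = join_in A (inf a ` S)"
    using assms by (auto simp: frame_on_def)
qed

lemma join_in_upper: "s \<in> S \<Longrightarrow> s \<le> join_in A S"
  unfolding join_in_def by (rule Inf_greatest) auto

lemma join_in_least: "c \<in> A \<Longrightarrow> (\<And>s. s \<in> S \<Longrightarrow> s \<le> c) \<Longrightarrow> join_in A S \<le> c"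
  unfolding join_in_def by (rule Inf_lower) auto

lemma pullbackI:
  assumes "U \<subseteq> A \<times> B"
    and "\<And>x y x' y'. (x, y) \<in> U \<Longrightarrow> x' \<in> A \<Longrightarrow> y' \<in> B \<Longrightarrow> x' \<le> x \<Longrightarrow> y' \<le> y \<Longrightarrow> (x', y') \<in> U"
    and "\<And>S y. S \<subseteq> A \<Longrightarrow> y \<in> B \<Longrightarrow> (\<And>s. s \<in> S \<Longrightarrow> (s, y) \<in> U) \<Longrightarrow> (join_in A S, y) \<in> U"
    and "\<And>x S. x \<in> A \<Longrightarrow> S \<subseteq> B \<Longrightarrow> (\<And>s. s \<in> S \<Longrightarrow> (x, s) \<in> U) \<Longrightarrow> (x, join_in B S) \<in> U"
    and "\<And>x y c. x \<in> A \<Longrightarrow> y \<in> B \<Longrightarrow> (inf x (f c), y) \<in> U \<longleftrightarrow> (x, inf (g c) y) \<in> U"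
  shows "U \<in> pullback A B f g"
proof -
  have 2: "(x', y') \<in> U" if "(x, y) \<in> U" "x' \<in> A" "y' \<in> B" "x' \<le> x" "y' \<le> y" for x y x' y'
    using assms(2) that .
  have 3: "(join_in A S, y) \<in> U" if "S \<subseteq> A" "y \<in> B" "S \<times> {y} \<subseteq> U" for S y
    using assms(3)[of S y] that by auto
  have 4: "(x, join_in B S) \<in> U" if "x \<in> A" "S \<subseteq> B" "{x} \<times> S \<subseteq> U" for S x
    using assms(4)[of x S] that by auto
  show ?thesis
    unfolding pullback_def mem_Collect_eq
    by (intro conjI allI impI ballI) (fact assms(1), fact 2, fact 3, fact 4, fact assms(5))
qed

lemma pullbackD:
  assumes "U \<in> pullback A B f g"
  shows pullback_subset: "U \<subseteq> A \<times> B"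
    and pullback_down:
      "(x, y) \<in> U \<Longrightarrow> x' \<in> A \<Longrightarrow> y' \<in> B \<Longrightarrow> x' \<le> x \<Longrightarrow> y' \<le> y \<Longrightarrow> (x', y') \<in> U"
    and pullback_join1: "S \<subseteq> A \<Longrightarrow> y \<in> B \<Longrightarrow> (\<And>s. s \<in> S \<Longrightarrow> (s, y) \<in> U) \<Longrightarrow> (join_in A S, y) \<in> U"
    and pullback_join2: "x \<in> A \<Longrightarrow> S' \<subseteq> B \<Longrightarrow> (\<And>s. s \<in> S' \<Longrightarrow> (x, s) \<in> U) \<Longrightarrow> (x, join_in B S') \<in> U"
    and pullback_bal: "x \<in> A \<Longrightarrow> y \<in> B \<Longrightarrow> (inf x (f c), y) \<in> U \<longleftrightarrow> (x, inf (g c) y) \<in> U"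
proof -
  have 1: "U \<subseteq> A \<times> B"
    and 2: "\<forall>x y x' y'. (x, y) \<in> U \<longrightarrow> x' \<in> A \<longrightarrow> y' \<in> B \<longrightarrow> x' \<le> x \<longrightarrow> y' \<le> y \<longrightarrow> (x', y') \<in> U"
    and 3: "\<forall>S\<subseteq>A. \<forall>y\<in>B. S \<times> {y} \<subseteq> U \<longrightarrow> (join_in A S, y) \<in> U"
    and 4: "\<forall>x\<in>A. \<forall>S\<subseteq>B. {x} \<times> S \<subseteq> U \<longrightarrow> (x, join_in B S) \<in> U"
    and 5: "\<forall>x\<in>A. \<forall>y\<in>B. \<forall>c. (inf x (f c), y) \<in> U \<longleftrightarrow> (x, inf (g c) y) \<in> U"
    by (rule assms[unfolded pullback_def mem_Collect_eq, THEN conjunct1]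
        assms[unfolded pullback_def mem_Collect_eq, THEN conjunct2, THEN conjunct1]
        assms[unfolded pullback_def mem_Collect_eq, THEN conjunct2, THEN conjunct2, THEN conjunct1]
        assms[unfolded pullback_def mem_Collect_eq, THEN conjunct2, THEN conjunct2, THEN conjunct2, THEN conjunct1]
        assms[unfolded pullback_def mem_Collect_eq, THEN conjunct2, THEN conjunct2, THEN conjunct2, THEN conjunct2])+
  show "U \<subseteq> A \<times> B" by (rule 1)
  show "(x, y) \<in> U \<Longrightarrow> x' \<in> A \<Longrightarrow> y' \<in> B \<Longrightarrow> x' \<le> x \<Longrightarrow> y' \<le> y \<Longrightarrow> (x', y') \<in> U"
    by (rule 2[rule_format])
  show "(join_in A S, y) \<in> U" if "S \<subseteq> A" "y \<in> B" "\<And>s. s \<in> S \<Longrightarrow> (s, y) \<in> U"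
    by (rule 3[rule_format]) (use that in auto)
  show "(x, join_in B S') \<in> U" if "x \<in> A" "S' \<subseteq> B" "\<And>s. s \<in> S' \<Longrightarrow> (x, s) \<in> U"
    by (rule 4[rule_format]) (use that in auto)
  show "x \<in> A \<Longrightarrow> y \<in> B \<Longrightarrow> (inf x (f c), y) \<in> U \<longleftrightarrow> (x, inf (g c) y) \<in> U"
    by (rule 5[rule_format])
qed

lemma pullback_Inter:
  assumes "\<U> \<subseteq> pullback A B f g" "\<U> \<noteq> {}"
  shows "\<Inter>\<U> \<in> pullback A B f g"
proof -
  have P: "U \<in> pullback A B f g" if "U \<in> \<U>" for U using assms that by auto
  show ?thesis
  proof (rule pullbackI)
    show "\<Inter>\<U> \<subseteq> A \<times> B" using assms(2) pullback_subset[OF P] by blast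
  next
    fix x y x' y' assume "(x, y) \<in> \<Inter>\<U>" "x' \<in> A" "y' \<in> B" "x' \<le> x" "y' \<le> y"
    then show "(x', y') \<in> \<Inter>\<U>" using pullback_down[OF P] by blast
  next
    fix S y assume "S \<subseteq> A" "y \<in> B" and *: "\<And>s. s \<in> S \<Longrightarrow> (s, y) \<in> \<Inter>\<U>"
    then show "(join_in A S, y) \<in> \<Inter>\<U>" using pullback_join1[OF P] * by blast
  next
    fix x S assume "x \<in> A" "S \<subseteq> B" and *: "\<And>s. s \<in> S \<Longrightarrow> (x, s) \<in> \<Inter>\<U>"
    then show "(x, join_in B S) \<in> \<Inter>\<U>" using pullback_join2[OF P] * by blast
  next
    fix x y c assume "x \<in> A" "y \<in> B"
    then show "(inf x (f c), y) \<in> \<Inter>\<U> \<longleftrightarrow> (x, inf (g c) y) \<in> \<Inter>\<U>"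
      using pullback_bal[OF P] by blast
  qed
qed

context
  fixes A :: "'a::complete_lattice set" and B :: "'b::complete_lattice set"
    and f :: "'c::frame \<Rightarrow> 'a" and g :: "'c \<Rightarrow> 'b"
  assumes A: "frame_on A" and B: "frame_on B"
    and f: "locale_map A UNIV f" and g: "locale_map B UNIV g"
begin

lemma fg_carrier: "f c \<in> A" "g c \<in> B"
  using f g by (auto simp: locale_map_def)

lemma pullback_top: "A \<times> B \<in> pullback A B f g"
  by (rule pullbackI) (auto intro!: frame_on_inf[OF A] frame_on_inf[OF B]
      frame_on_join[OF A] frame_on_join[OF B] fg_carrier)

lemma Sup_pullback: "Sup (pullback A B f g) = A \<times> B"
  using pullback_top by (auto dest: pullback_subset)

lemma pullback_residual:
  assumes J: "J \<in> pullback A B f g" and Z: "Z \<subseteq> A \<times> B"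
  shows "{(x, y). x \<in> A \<and> y \<in> B \<and> (\<forall>(u, v)\<in>Z. (inf u x, inf v y) \<in> J)} \<in> pullback A B f g"
    (is "?W \<in> _")
proof (rule pullbackI)
  show "?W \<subseteq> A \<times> B" by auto
next
  fix x y x' y' assume xy: "(x, y) \<in> ?W" and x': "x' \<in> A" and y': "y' \<in> B"
    and le: "x' \<le> x" "y' \<le> y"
  have "(inf u x', inf v y') \<in> J" if uv: "(u, v) \<in> Z" for u v
  proof (rule pullback_down[OF J])
    show "(inf u x, inf v y) \<in> J" using xy uv by blast
    show "inf u x' \<in> A" "inf v y' \<in> B"
      using uv Z x' y' by (auto intro!: frame_on_inf[OF A] frame_on_inf[OF B])
    show "inf u x' \<le> inf u x" "inf v y' \<le> inf v y" using le by (simp_all add: le_infI2)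
  qed
  then show "(x', y') \<in> ?W" using x' y' by blast
next
  fix S y assume S: "S \<subseteq> A" and y: "y \<in> B" and *: "\<And>s. s \<in> S \<Longrightarrow> (s, y) \<in> ?W"
  have "(inf u (join_in A S), inf v y) \<in> J" if uv: "(u, v) \<in> Z" for u v
  proof -
    have u: "u \<in> A" "v \<in> B" using uv Z by auto
    have "(join_in A (inf u ` S), inf v y) \<in> J"
    proof (rule pullback_join1[OF J])
      show "inf u ` S \<subseteq> A" using u(1) S by (auto intro!: frame_on_inf[OF A])
      show "inf v y \<in> B" by (rule frame_on_inf[OF B u(2) y])
      fix w assume "w \<in> inf u ` S"
      then show "(w, inf v y) \<in> J" using * uv by blast
    qed
    then show ?thesis unfolding frame_on_distrib[OF A u(1) S] .
  qed
  then show "(join_in A S, y) \<in> ?W" using y frame_on_join[OF A S] by blast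
next
  fix x S assume x: "x \<in> A" and S: "S \<subseteq> B" and *: "\<And>s. s \<in> S \<Longrightarrow> (x, s) \<in> ?W"
  have "(inf u x, inf v (join_in B S)) \<in> J" if uv: "(u, v) \<in> Z" for u v
  proof -
    have u: "u \<in> A" "v \<in> B" using uv Z by auto
    have "(inf u x, join_in B (inf v ` S)) \<in> J"
    proof (rule pullback_join2[OF J])
      show "inf v ` S \<subseteq> B" using u(2) S by (auto intro!: frame_on_inf[OF B])
      show "inf u x \<in> A" by (rule frame_on_inf[OF A u(1) x])
      fix w assume "w \<in> inf v ` S"
      then show "(inf u x, w) \<in> J" using * uv by blast
    qed
    then show ?thesis unfolding frame_on_distrib[OF B u(2) S] .
  qed
  then show "(x, join_in B S) \<in> ?W" using x frame_on_join[OF B S] by blast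
next
  fix x y c assume x: "x \<in> A" and y: "y \<in> B"
  have *: "(inf u (inf x (f c)), inf v y) \<in> J \<longleftrightarrow> (inf u x, inf v (inf (g c) y)) \<in> J"
    if uv: "(u, v) \<in> Z" for u v
  proof -
    have "u \<in> A" "v \<in> B" using uv Z by auto
    then have "inf u x \<in> A" "inf v y \<in> B" using x y by (simp_all add: frame_on_inf[OF A] frame_on_inf[OF B])
    from pullback_bal[OF J this, of c] show ?thesis
      by (simp add: inf.assoc inf.left_commute)
  qed
  have "inf x (f c) \<in> A" "inf (g c) y \<in> B"
    using x y fg_carrier by (simp_all add: frame_on_inf[OF A] frame_on_inf[OF B])
  then show "(inf x (f c), y) \<in> ?W \<longleftrightarrow> (x, inf (g c) y) \<in> ?W"
    using x y * by (auto simp: split_beta)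
qed

lemma pullback_generated_inter:
  assumes J: "J \<in> pullback A B f g" and Z: "Z \<subseteq> A \<times> B" and Z': "Z' \<subseteq> A \<times> B"
    and *: "\<And>x y x' y'. (x, y) \<in> Z \<Longrightarrow> (x', y') \<in> Z' \<Longrightarrow> (inf x x', inf y y') \<in> J"
  shows "\<Inter> {U \<in> pullback A B f g. Z \<subseteq> U} \<inter> \<Inter> {U \<in> pullback A B f g. Z' \<subseteq> U} \<subseteq> J"
    (is "?C \<inter> ?C' \<subseteq> J")
proof
  let ?R = "\<lambda>Z. {(x, y). x \<in> A \<and> y \<in> B \<and> (\<forall>(u, v)\<in>Z. (inf u x, inf v y) \<in> J)}"
  fix z assume z: "z \<in> ?C \<inter> ?C'"
  then have zAB: "z \<in> A \<times> B" using pullback_top Z by blast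
  have "Z \<subseteq> ?R Z'" using * Z by (auto simp: inf.commute)
  then have "z \<in> ?R Z'" using z pullback_residual[OF J Z'] by blast
  then have "Z' \<subseteq> ?R {z}" using Z' zAB by (auto simp: inf.commute)
  moreover have "?R {z} \<in> pullback A B f g" using zAB by (intro pullback_residual[OF J]) auto
  ultimately have "z \<in> ?R {z}" using z by blast
  then show "z \<in> J" by auto
qed

lemma pullback_join_in:
  assumes "\<S> \<subseteq> pullback A B f g"
  shows "join_in (pullback A B f g) \<S> \<in> pullback A B f g"
  unfolding join_in_def
proof (rule pullback_Inter)
  have "\<forall>V\<in>\<S>. V \<le> A \<times> B" using assms by (auto dest!: pullback_subset)
  then have "A \<times> B \<in> {c \<in> pullback A B f g. \<forall>s\<in>\<S>. s \<le> c}" using pullback_top by simp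
  then show "{c \<in> pullback A B f g. \<forall>s\<in>\<S>. s \<le> c} \<noteq> {}" by (metis empty_iff)
qed simp

lemma pullback_frame: "frame_on (pullback A B f g)"
  unfolding frame_on_def
proof (intro conjI allI impI ballI)
  show "Sup (pullback A B f g) \<in> pullback A B f g"
    using pullback_top Sup_pullback by simp
  show "Inf \<S> \<in> pullback A B f g" if "\<S> \<subseteq> pullback A B f g" "\<S> \<noteq> {}" for \<S>
    using pullback_Inter that .
  fix U \<S> assume U: "U \<in> pullback A B f g" and \<S>: "\<S> \<subseteq> pullback A B f g"
  have inf: "inf U V \<in> pullback A B f g" if "V \<in> \<S>" for V
    using pullback_Inter[of "{U, V}" A B f g] U \<S> that by auto
  let ?J = "join_in (pullback A B f g) (inf U ` \<S>)"
  have J: "?J \<in> pullback A B f g"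
    using inf by (intro pullback_join_in image_subsetI)
  show "inf U (join_in (pullback A B f g) \<S>) = ?J"
  proof
    have UAB: "U \<subseteq> A \<times> B" using pullback_subset[OF U] .
    have SAB: "\<Union>\<S> \<subseteq> A \<times> B" using \<S> by (auto dest!: pullback_subset)
    have "\<Inter> {V \<in> pullback A B f g. U \<subseteq> V} \<inter> \<Inter> {V \<in> pullback A B f g. \<Union>\<S> \<subseteq> V} \<subseteq> ?J"
    proof (rule pullback_generated_inter[OF J UAB SAB])
      fix x y x' y' assume xy: "(x, y) \<in> U" and xy': "(x', y') \<in> \<Union>\<S>"
      then obtain V where V: "(x', y') \<in> V" "V \<in> \<S>" by auto
      have "x \<in> A" "y \<in> B" "x' \<in> A" "y' \<in> B" using xy xy' UAB SAB by auto
      then have "inf x x' \<in> A" "inf y y' \<in> B" by (auto intro: frame_on_inf[OF A] frame_on_inf[OF B])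
      then have "(inf x x', inf y y') \<in> inf U V"
        using pullback_down[OF U xy] pullback_down[OF subsetD[OF \<S> V(2)] V(1)] by auto
      then show "(inf x x', inf y y') \<in> ?J"
        using join_in_upper[of "inf U V" "inf U ` \<S>" "pullback A B f g"] V(2) by auto
    qed
    moreover have "U \<inter> join_in (pullback A B f g) \<S> \<subseteq>
        \<Inter> {V \<in> pullback A B f g. U \<subseteq> V} \<inter> \<Inter> {V \<in> pullback A B f g. \<Union>\<S> \<subseteq> V}"
    proof (intro Int_mono Inter_greatest)
      fix V assume "V \<in> {V \<in> pullback A B f g. \<Union>\<S> \<subseteq> V}"
      then show "join_in (pullback A B f g) \<S> \<subseteq> V" by (intro join_in_least) auto
    qed simp
    ultimately show "inf U (join_in (pullback A B f g) \<S>) \<subseteq> ?J"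
      by (rule subset_trans[rotated])
    have "join_in (pullback A B f g) \<S> \<in> pullback A B f g"
      by (rule pullback_join_in[OF \<S>])
    then have "inf U (join_in (pullback A B f g) \<S>) \<in> pullback A B f g"
      using pullback_Inter[of "{U, join_in (pullback A B f g) \<S>}" A B f g] U by auto
    then show "?J \<subseteq> inf U (join_in (pullback A B f g) \<S>)"
    proof (rule join_in_least)
      fix W assume "W \<in> inf U ` \<S>"
      then obtain V where "V \<in> \<S>" "W = inf U V" by auto
      then show "W \<le> inf U (join_in (pullback A B f g) \<S>)"
        using inf_mono[OF order_refl join_in_upper[of V \<S> "pullback A B f g"]] by simp
    qed
  qed
qed

lemma proj1_mem: "x \<in> A \<Longrightarrow> proj1 A B f g x \<in> pullback A B f g"
  unfolding proj1_def using pullback_top by (intro pullback_Inter) auto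

lemma proj2_mem: "y \<in> B \<Longrightarrow> proj2 A B f g y \<in> pullback A B f g"
  unfolding proj2_def using pullback_top by (intro pullback_Inter) auto

lemma proj1_gen: "y \<in> B \<Longrightarrow> (x, y) \<in> proj1 A B f g x"
  unfolding proj1_def by auto

lemma proj2_gen: "x \<in> A \<Longrightarrow> (x, y) \<in> proj2 A B f g y"
  unfolding proj2_def by auto

lemma proj1_least: "U \<in> pullback A B f g \<Longrightarrow> {x} \<times> B \<subseteq> U \<Longrightarrow> proj1 A B f g x \<subseteq> U"
  unfolding proj1_def by auto

lemma proj2_least: "U \<in> pullback A B f g \<Longrightarrow> A \<times> {y} \<subseteq> U \<Longrightarrow> proj2 A B f g y \<subseteq> U"
  unfolding proj2_def by auto

lemma proj1_locale_map: "locale_map (pullback A B f g) A (proj1 A B f g)"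
  unfolding locale_map_def
proof (intro conjI allI ballI impI)
  let ?P = "pullback A B f g"
  show "proj1 A B f g ` A \<subseteq> ?P" using proj1_mem by auto
  have mono: "proj1 A B f g x \<subseteq> proj1 A B f g y" if "x \<le> y" "x \<in> A" "y \<in> A" for x y
    using that pullback_down[OF proj1_mem[of y] proj1_gen, of _ x]
    by (intro proj1_least[OF proj1_mem]) auto
  show "proj1 A B f g (Sup A) = Sup ?P"
    unfolding Sup_pullback
  proof
    show "proj1 A B f g (Sup A) \<subseteq> A \<times> B"
      using pullback_subset[OF proj1_mem[OF frame_on_top[OF A]]] .
    show "A \<times> B \<subseteq> proj1 A B f g (Sup A)"
      using pullback_down[OF proj1_mem[OF frame_on_top[OF A]] proj1_gen]
      by (auto intro: Sup_upper)
  qed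
  show "proj1 A B f g (inf x y) = inf (proj1 A B f g x) (proj1 A B f g y)"
    if x: "x \<in> A" and y: "y \<in> A" for x y
  proof
    have xy: "inf x y \<in> A" using frame_on_inf[OF A x y] .
    show "proj1 A B f g (inf x y) \<subseteq> inf (proj1 A B f g x) (proj1 A B f g y)"
      using mono[of "inf x y" x] mono[of "inf x y" y] x y xy by auto
    have "proj1 A B f g x \<inter> proj1 A B f g y \<subseteq> proj1 A B f g (inf x y)"
      unfolding proj1_def[of _ _ _ _ x] proj1_def[of _ _ _ _ y]
      by (rule pullback_generated_inter[OF proj1_mem[OF xy]])
        (use x y in \<open>auto intro!: proj1_gen frame_on_inf[OF B]\<close>)
    then show "inf (proj1 A B f g x) (proj1 A B f g y) \<subseteq> proj1 A B f g (inf x y)" by simp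
  qed
  show "proj1 A B f g (join_in A S) = join_in ?P (proj1 A B f g ` S)" if S: "S \<subseteq> A" for S
  proof
    have J: "join_in ?P (proj1 A B f g ` S) \<in> ?P"
      using S proj1_mem by (intro frame_on_join[OF pullback_frame]) auto
    have "(join_in A S, b) \<in> join_in ?P (proj1 A B f g ` S)" if b: "b \<in> B" for b
      using S b proj1_gen[OF b] join_in_upper[of _ "proj1 A B f g ` S" ?P]
      by (intro pullback_join1[OF J]) blast+
    then show "proj1 A B f g (join_in A S) \<subseteq> join_in ?P (proj1 A B f g ` S)"
      by (intro proj1_least[OF J]) auto
    show "join_in ?P (proj1 A B f g ` S) \<subseteq> proj1 A B f g (join_in A S)"
    proof (rule join_in_least[OF proj1_mem[OF frame_on_join[OF A S]]])
      fix W assume "W \<in> proj1 A B f g ` S"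
      then obtain s where s: "s \<in> S" "W = proj1 A B f g s" by auto
      show "W \<le> proj1 A B f g (join_in A S)"
        unfolding s(2) using mono[OF join_in_upper[OF s(1)]] s(1) S frame_on_join[OF A S] by auto
    qed
  qed
qed

lemma proj2_locale_map: "locale_map (pullback A B f g) B (proj2 A B f g)"
  unfolding locale_map_def
proof (intro conjI allI ballI impI)
  let ?P = "pullback A B f g"
  show "proj2 A B f g ` B \<subseteq> ?P" using proj2_mem by auto
  have mono: "proj2 A B f g x \<subseteq> proj2 A B f g y" if "x \<le> y" "x \<in> B" "y \<in> B" for x y
    using that pullback_down[OF proj2_mem[of y] proj2_gen, of _ _ x]
    by (intro proj2_least[OF proj2_mem]) auto
  show "proj2 A B f g (Sup B) = Sup ?P"
    unfolding Sup_pullback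
  proof
    show "proj2 A B f g (Sup B) \<subseteq> A \<times> B"
      using pullback_subset[OF proj2_mem[OF frame_on_top[OF B]]] .
    show "A \<times> B \<subseteq> proj2 A B f g (Sup B)"
      using pullback_down[OF proj2_mem[OF frame_on_top[OF B]] proj2_gen]
      by (auto intro: Sup_upper)
  qed
  show "proj2 A B f g (inf x y) = inf (proj2 A B f g x) (proj2 A B f g y)"
    if x: "x \<in> B" and y: "y \<in> B" for x y
  proof
    have xy: "inf x y \<in> B" using frame_on_inf[OF B x y] .
    show "proj2 A B f g (inf x y) \<subseteq> inf (proj2 A B f g x) (proj2 A B f g y)"
      using mono[of "inf x y" x] mono[of "inf x y" y] x y xy by auto
    have "proj2 A B f g x \<inter> proj2 A B f g y \<subseteq> proj2 A B f g (inf x y)"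
      unfolding proj2_def[of _ _ _ _ x] proj2_def[of _ _ _ _ y]
      by (rule pullback_generated_inter[OF proj2_mem[OF xy]])
        (use x y in \<open>auto intro!: proj2_gen frame_on_inf[OF A]\<close>)
    then show "inf (proj2 A B f g x) (proj2 A B f g y) \<subseteq> proj2 A B f g (inf x y)" by simp
  qed
  show "proj2 A B f g (join_in B S) = join_in ?P (proj2 A B f g ` S)" if S: "S \<subseteq> B" for S
  proof
    have J: "join_in ?P (proj2 A B f g ` S) \<in> ?P"
      using S proj2_mem by (intro frame_on_join[OF pullback_frame]) auto
    have "(a, join_in B S) \<in> join_in ?P (proj2 A B f g ` S)" if a: "a \<in> A" for a
      using S a proj2_gen[OF a] join_in_upper[of _ "proj2 A B f g ` S" ?P]
      by (intro pullback_join2[OF J]) blast+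
    then show "proj2 A B f g (join_in B S) \<subseteq> join_in ?P (proj2 A B f g ` S)"
      by (intro proj2_least[OF J]) auto
    show "join_in ?P (proj2 A B f g ` S) \<subseteq> proj2 A B f g (join_in B S)"
    proof (rule join_in_least[OF proj2_mem[OF frame_on_join[OF B S]]])
      fix W assume "W \<in> proj2 A B f g ` S"
      then obtain s where s: "s \<in> S" "W = proj2 A B f g s" by auto
      show "W \<le> proj2 A B f g (join_in B S)"
        unfolding s(2) using mono[OF join_in_upper[OF s(1)]] s(1) S frame_on_join[OF B S] by auto
    qed
  qed
qed

lemma pullback_commutes: "f \<odot> proj1 A B f g = g \<odot> proj2 A B f g"
  unfolding loc_comp_def
proof
  fix c
  have tA: "Sup A \<in> A" and tB: "Sup B \<in> B" using frame_on_top A B by auto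
  have fc: "f c \<in> A" "inf (Sup A) (f c) = f c" and gc: "g c \<in> B" "inf (g c) (Sup B) = g c"
    using fg_carrier[of c] by (auto intro!: inf_absorb1 inf_absorb2 Sup_upper)
  show "proj1 A B f g (f c) = proj2 A B f g (g c)"
  proof
    have J: "proj2 A B f g (g c) \<in> pullback A B f g" using proj2_mem gc by auto
    have "(Sup A, inf (g c) (Sup B)) \<in> proj2 A B f g (g c)" using gc(2) proj2_gen[OF tA] by simp
    then have "(f c, Sup B) \<in> proj2 A B f g (g c)"
      using pullback_bal[OF J tA tB, of c] fc(2) by simp
    then have "(f c, b) \<in> proj2 A B f g (g c)" if "b \<in> B" for b
      by (rule pullback_down[OF J]) (use that fc in \<open>auto intro: Sup_upper\<close>)
    then show "proj1 A B f g (f c) \<subseteq> proj2 A B f g (g c)" by (intro proj1_least[OF J]) auto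
    have J: "proj1 A B f g (f c) \<in> pullback A B f g" using proj1_mem fc by auto
    have "(inf (Sup A) (f c), Sup B) \<in> proj1 A B f g (f c)" using fc(2) proj1_gen[OF tB] by simp
    then have "(Sup A, g c) \<in> proj1 A B f g (f c)"
      using pullback_bal[OF J tA tB, of c] gc(2) by simp
    then have "(a, g c) \<in> proj1 A B f g (f c)" if "a \<in> A" for a
      by (rule pullback_down[OF J]) (use that gc in \<open>auto intro: Sup_upper\<close>)
    then show "proj2 A B f g (g c) \<subseteq> proj1 A B f g (f c)" by (intro proj2_least[OF J]) auto
  qed
qed

lemma tensor_eq:
  assumes x: "x \<in> A" and y: "y \<in> B"
  shows "tensor A B f g x y = \<Inter> {U \<in> pullback A B f g. (x, y) \<in> U}" (is "_ = ?C")
proof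
  have C: "?C \<in> pullback A B f g" using x y pullback_top by (intro pullback_Inter) blast+
  have xy: "(x, y) \<in> ?C" by auto
  have "(inf x' x'', inf y' y'') \<in> ?C"
    if "(x', y') \<in> {x} \<times> B" "(x'', y'') \<in> A \<times> {y}" for x' y' x'' y''
    by (rule pullback_down[OF C xy])
      (use that x y in \<open>auto intro!: frame_on_inf[OF A] frame_on_inf[OF B]\<close>)
  then show "tensor A B f g x y \<subseteq> ?C"
    unfolding tensor_def proj1_def proj2_def
    using x y pullback_generated_inter[OF C, of "{x} \<times> B" "A \<times> {y}"] by auto
  show "?C \<subseteq> tensor A B f g x y"
    unfolding tensor_def proj1_def proj2_def using x y by auto
qed

context
  fixes T :: "'t::complete_lattice set" and h k
  assumes T: "frame_on T" and h: "locale_map T A h" and k: "locale_map T B k"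
    and hk: "f \<odot> h = g \<odot> k"
begin

lemma hk_carrier: "x \<in> A \<Longrightarrow> h x \<in> T" "y \<in> B \<Longrightarrow> k y \<in> T"
  using h k by (auto simp: locale_map_def)

lemma hk_mono: "x \<in> A \<Longrightarrow> x' \<in> A \<Longrightarrow> x \<le> x' \<Longrightarrow> h x \<le> h x'"
  "y \<in> B \<Longrightarrow> y' \<in> B \<Longrightarrow> y \<le> y' \<Longrightarrow> k y \<le> k y'"
  using h k unfolding locale_map_def by (metis inf.absorb_iff1)+

lemma pullback_below:
  assumes t: "t \<in> T"
  shows "{(x, y). x \<in> A \<and> y \<in> B \<and> inf (h x) (k y) \<le> t} \<in> pullback A B f g" (is "?N \<in> _")
proof (rule pullbackI)
  show "?N \<subseteq> A \<times> B" by auto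
next
  fix x y x' y' assume *: "(x, y) \<in> ?N" "x' \<in> A" "y' \<in> B" "x' \<le> x" "y' \<le> y"
  then have "inf (h x') (k y') \<le> inf (h x) (k y)" by (intro inf_mono hk_mono) auto
  also have "\<dots> \<le> t" using * by simp
  finally show "(x', y') \<in> ?N" using * by simp
next
  fix S y assume S: "S \<subseteq> A" and y: "y \<in> B" and *: "\<And>s. s \<in> S \<Longrightarrow> (s, y) \<in> ?N"
  have "h (join_in A S) = join_in T (h ` S)" using h S by (auto simp: locale_map_def)
  then have "inf (k y) (h (join_in A S)) = join_in T (inf (k y) ` h ` S)"
    using frame_on_distrib[OF T hk_carrier(2)[OF y], of "h ` S"] S hk_carrier(1) by auto
  also have "\<dots> \<le> t" using * by (intro join_in_least[OF t]) (auto simp: inf.commute)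
  finally show "(join_in A S, y) \<in> ?N" using frame_on_join[OF A S] y by (auto simp: inf.commute)
next
  fix x S assume S: "S \<subseteq> B" and x: "x \<in> A" and *: "\<And>s. s \<in> S \<Longrightarrow> (x, s) \<in> ?N"
  have "k (join_in B S) = join_in T (k ` S)" using k S by (auto simp: locale_map_def)
  then have "inf (h x) (k (join_in B S)) = join_in T (inf (h x) ` k ` S)"
    using frame_on_distrib[OF T hk_carrier(1)[OF x], of "k ` S"] S hk_carrier(2) by auto
  also have "\<dots> \<le> t" using * by (intro join_in_least[OF t]) auto
  finally show "(x, join_in B S) \<in> ?N" using frame_on_join[OF B S] x by auto
next
  fix x y c assume x: "x \<in> A" and y: "y \<in> B"
  have "h (f c) = k (g c)" using hk by (metis loc_comp_def)
  moreover have "h (inf x (f c)) = inf (h x) (h (f c))" "k (inf (g c) y) = inf (k (g c)) (k y)"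
    using h k x y fg_carrier by (auto simp: locale_map_def)
  ultimately show "(inf x (f c), y) \<in> ?N \<longleftrightarrow> (x, inf (g c) y) \<in> ?N"
    using x y fg_carrier by (auto simp: frame_on_inf[OF A] frame_on_inf[OF B] inf.assoc)
qed

lemma pairing_le_iff:
  assumes "U \<subseteq> A \<times> B" "t \<in> T"
  shows "pairing T h k U \<le> t \<longleftrightarrow> U \<subseteq> {(x, y). x \<in> A \<and> y \<in> B \<and> inf (h x) (k y) \<le> t}"
proof
  assume *: "pairing T h k U \<le> t"
  have "inf (h x) (k y) \<le> t" if "(x, y) \<in> U" for x y
    using join_in_upper[of "inf (h x) (k y)" "(\<lambda>(x, y). inf (h x) (k y)) ` U" T] that * 
    unfolding pairing_def by force
  then show "U \<subseteq> {(x, y). x \<in> A \<and> y \<in> B \<and> inf (h x) (k y) \<le> t}" using assms(1) by auto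
next
  assume "U \<subseteq> {(x, y). x \<in> A \<and> y \<in> B \<and> inf (h x) (k y) \<le> t}"
  then show "pairing T h k U \<le> t"
    unfolding pairing_def by (intro join_in_least[OF assms(2)]) auto
qed

lemma pairing_upper: "(x, y) \<in> U \<Longrightarrow> inf (h x) (k y) \<le> pairing T h k U"
  unfolding pairing_def by (rule join_in_upper) force

lemma pairing_mem: "U \<subseteq> A \<times> B \<Longrightarrow> pairing T h k U \<in> T"
  unfolding pairing_def
  by (rule frame_on_join[OF T]) (auto intro!: frame_on_inf[OF T] hk_carrier)

lemma pairing_locale_map: "locale_map T (pullback A B f g) (pairing T h k)"
  unfolding locale_map_def
proof (intro conjI allI ballI impI)
  let ?P = "pullback A B f g"
  show "pairing T h k ` ?P \<subseteq> T" by (intro image_subsetI pairing_mem pullback_subset)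
  show "pairing T h k (Sup ?P) = Sup T"
  proof (rule antisym)
    show "pairing T h k (Sup ?P) \<le> Sup T"
      unfolding Sup_pullback using pairing_mem by (auto intro: Sup_upper)
    have "h (Sup A) = Sup T" "k (Sup B) = Sup T" using h k by (auto simp: locale_map_def)
    then show "Sup T \<le> pairing T h k (Sup ?P)"
      unfolding Sup_pullback
      using pairing_upper[of "Sup A" "Sup B" "A \<times> B"] frame_on_top[OF A] frame_on_top[OF B]
      by simp
  qed
  show "pairing T h k (inf U V) = inf (pairing T h k U) (pairing T h k V)"
    if U: "U \<in> ?P" and V: "V \<in> ?P" for U V
  proof (rule antisym)
    have UA: "U \<subseteq> A \<times> B" and VA: "V \<subseteq> A \<times> B" using U V by (simp_all add: pullback_subset)
    then have UV: "inf U V \<subseteq> A \<times> B" by auto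
    have pU: "pairing T h k U \<in> T" and pV: "pairing T h k V \<in> T"
      and pUV: "pairing T h k (inf U V) \<in> T" using pairing_mem UA VA UV by auto
    show "pairing T h k (inf U V) \<le> inf (pairing T h k U) (pairing T h k V)"
    proof (rule le_infI)
      show "pairing T h k (inf U V) \<le> pairing T h k U"
        unfolding pairing_le_iff[OF UV pU] using UA pairing_upper by auto
      show "pairing T h k (inf U V) \<le> pairing T h k V"
        unfolding pairing_le_iff[OF UV pV] using VA pairing_upper by auto
    qed
    have *: "inf (inf (h x) (k y)) (inf (h x') (k y')) \<le> pairing T h k (inf U V)"
      if xy: "(x, y) \<in> U" and xy': "(x', y') \<in> V" for x y x' y'
    proof -
      have c: "x \<in> A" "y \<in> B" "x' \<in> A" "y' \<in> B" using xy xy' UA VA by auto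
      then have "inf x x' \<in> A" "inf y y' \<in> B" by (auto intro: frame_on_inf[OF A] frame_on_inf[OF B])
      then have "(inf x x', inf y y') \<in> inf U V"
        using pullback_down[OF U xy] pullback_down[OF V xy'] by auto
      from pairing_upper[OF this]
      have "inf (h (inf x x')) (k (inf y y')) \<le> pairing T h k (inf U V)" .
      moreover have "h (inf x x') = inf (h x) (h x')" "k (inf y y') = inf (k y) (k y')"
        using h k c by (auto simp: locale_map_def)
      ultimately show ?thesis by (simp add: inf.assoc inf.left_commute)
    qed
    have "inf (inf (h x) (k y)) (pairing T h k V) \<le> pairing T h k (inf U V)"
      if xy: "(x, y) \<in> U" for x y
    proof -
      have "inf (h x) (k y) \<in> T" using xy UA by (auto intro!: frame_on_inf[OF T] hk_carrier)
      then have "inf (inf (h x) (k y)) (pairing T h k V) =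
          join_in T (inf (inf (h x) (k y)) ` (\<lambda>(x, y). inf (h x) (k y)) ` V)"
        unfolding pairing_def using VA
        by (intro frame_on_distrib[OF T]) (auto intro!: frame_on_inf[OF T] hk_carrier)
      also have "\<dots> \<le> pairing T h k (inf U V)"
        by (rule join_in_least[OF pUV]) (auto intro: *[OF xy])
      finally show ?thesis .
    qed
    then have **: "inf (pairing T h k V) (inf (h x) (k y)) \<le> pairing T h k (inf U V)"
      if "(x, y) \<in> U" for x y using that by (simp add: inf.commute)
    have "inf (pairing T h k V) (pairing T h k U) =
        join_in T (inf (pairing T h k V) ` (\<lambda>(x, y). inf (h x) (k y)) ` U)"
      unfolding pairing_def[of _ _ _ U] using UA
      by (intro frame_on_distrib[OF T pV]) (auto intro!: frame_on_inf[OF T] hk_carrier)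
    also have "\<dots> \<le> pairing T h k (inf U V)"
      by (rule join_in_least[OF pUV]) (auto intro: **)
    finally show "inf (pairing T h k U) (pairing T h k V) \<le> pairing T h k (inf U V)"
      by (simp add: inf.commute)
  qed
  show "pairing T h k (join_in ?P \<S>) = join_in T (pairing T h k ` \<S>)" if \<S>: "\<S> \<subseteq> ?P" for \<S>
  proof (rule antisym)
    have J: "join_in ?P \<S> \<in> ?P" using frame_on_join[OF pullback_frame \<S>] .
    have JT: "join_in T (pairing T h k ` \<S>) \<in> T"
      using \<S> by (intro frame_on_join[OF T] image_subsetI pairing_mem pullback_subset) auto
    have S: "V \<subseteq> {(x, y). x \<in> A \<and> y \<in> B \<and> inf (h x) (k y) \<le> join_in T (pairing T h k ` \<S>)}"
      if "V \<in> \<S>" for V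
      using that \<S> pullback_subset[of V A B f g]
      by (subst pairing_le_iff[symmetric, OF _ JT]) (auto intro!: join_in_upper)
    show "pairing T h k (join_in ?P \<S>) \<le> join_in T (pairing T h k ` \<S>)"
      unfolding pairing_le_iff[OF pullback_subset[OF J] JT]
      by (rule join_in_least[OF pullback_below[OF JT] S])
    have "pairing T h k V \<le> pairing T h k (join_in ?P \<S>)" if V: "V \<in> \<S>" for V
    proof -
      have "V \<subseteq> A \<times> B" using V \<S> by (intro pullback_subset) auto
      moreover have "V \<subseteq> join_in ?P \<S>" using join_in_upper[OF V] .
      ultimately show ?thesis
        using pairing_mem[OF pullback_subset[OF J]] pairing_upper by (subst pairing_le_iff) auto
    qed
    then show "join_in T (pairing T h k ` \<S>) \<le> pairing T h k (join_in ?P \<S>)"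
      by (intro join_in_least pairing_mem pullback_subset[OF J]) auto
  qed
qed

lemma pairing_proj1: assumes x: "x \<in> A" shows "pairing T h k (proj1 A B f g x) = h x"
proof (rule antisym)
  show "pairing T h k (proj1 A B f g x) \<le> h x"
    unfolding pairing_le_iff[OF pullback_subset[OF proj1_mem[OF x]] hk_carrier(1)[OF x]]
    by (rule proj1_least[OF pullback_below]) (use x hk_carrier in auto)
  have "k (Sup B) = Sup T" using k by (auto simp: locale_map_def)
  then have "h x = inf (h x) (k (Sup B))"
    using hk_carrier(1)[OF x] by (auto intro!: inf_absorb1[symmetric] Sup_upper)
  also have "\<dots> \<le> pairing T h k (proj1 A B f g x)"
    by (intro pairing_upper proj1_gen frame_on_top[OF B])
  finally show "h x \<le> pairing T h k (proj1 A B f g x)" .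
qed

lemma pairing_proj2: assumes y: "y \<in> B" shows "pairing T h k (proj2 A B f g y) = k y"
proof (rule antisym)
  show "pairing T h k (proj2 A B f g y) \<le> k y"
    unfolding pairing_le_iff[OF pullback_subset[OF proj2_mem[OF y]] hk_carrier(2)[OF y]]
    by (rule proj2_least[OF pullback_below]) (use y hk_carrier in auto)
  have "h (Sup A) = Sup T" using h by (auto simp: locale_map_def)
  then have "k y = inf (h (Sup A)) (k y)"
    using hk_carrier(2)[OF y] by (auto intro!: inf_absorb2[symmetric] Sup_upper)
  also have "\<dots> \<le> pairing T h k (proj2 A B f g y)"
    by (intro pairing_upper proj2_gen frame_on_top[OF A])
  finally show "k y \<le> pairing T h k (proj2 A B f g y)" .
qed

lemma pairing_unique:
  assumes \<phi>: "locale_map T (pullback A B f g) \<phi>"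
    and 1: "\<And>x. x \<in> A \<Longrightarrow> \<phi> (proj1 A B f g x) = h x"
    and 2: "\<And>y. y \<in> B \<Longrightarrow> \<phi> (proj2 A B f g y) = k y"
    and U: "U \<in> pullback A B f g"
  shows "\<phi> U = pairing T h k U"
proof -
  let ?P = "pullback A B f g"
  let ?S = "(\<lambda>(x, y). tensor A B f g x y) ` U"
  have UA: "U \<subseteq> A \<times> B" using pullback_subset[OF U] .
  have xy: "(x, y) \<in> tensor A B f g x y" if "(x, y) \<in> U" for x y
    using that UA by (subst tensor_eq) auto
  have S: "?S \<subseteq> ?P"
  proof clarsimp
    fix x y assume "(x, y) \<in> U"
    then have "x \<in> A" "y \<in> B" using UA by auto
    then show "tensor A B f g x y \<in> ?P"
      unfolding tensor_def by (intro frame_on_inf[OF pullback_frame] proj1_mem proj2_mem)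
  qed
  have "U = join_in ?P ?S"
  proof
    show "U \<subseteq> join_in ?P ?S"
    proof clarify
      fix x y assume "(x, y) \<in> U"
      then have "tensor A B f g x y \<in> ?S" by force
      from join_in_upper[OF this] show "(x, y) \<in> join_in ?P ?S" using xy[OF \<open>(x, y) \<in> U\<close>] by auto
    qed
    show "join_in ?P ?S \<subseteq> U"
    proof (rule join_in_least[OF U])
      fix V assume "V \<in> ?S"
      then show "V \<le> U" using UA U by (auto simp: tensor_eq)
    qed
  qed
  then have "\<phi> U = join_in T (\<phi> ` ?S)" using \<phi> S by (metis locale_map_def)
  also have "\<phi> ` ?S = (\<lambda>(x, y). inf (h x) (k y)) ` U"
    unfolding image_image
  proof (rule image_cong[OF refl], clarify)
    fix x y assume "(x, y) \<in> U"
    then have "x \<in> A" "y \<in> B" using UA by auto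
    then show "\<phi> (tensor A B f g x y) = inf (h x) (k y)"
      using \<phi> 1 2 proj1_mem proj2_mem unfolding locale_map_def tensor_def by metis
  qed
  finally show ?thesis by (simp add: pairing_def)
qed

end

end

section \<open>Localic groupoids and their quantales\<close>

record ('o, 'm) groupoid_data =
  gdom :: "'o \<Rightarrow> 'm"
  grng :: "'o \<Rightarrow> 'm"
  gunit :: "'m \<Rightarrow> 'o"
  ginv :: "'m \<Rightarrow> 'm"
  gmult :: "'m \<Rightarrow> ('m \<times> 'm) set"

text \<open>
  Multiplication is written in diagrammatic order, \<open>d(ab) = d(a)\<close> and \<open>r(ab) = r(b)\<close>. Below, \<open>G2\<close>
  is the locale of composable pairs and \<open>G3\<close>, the pullback of \<open>r \<circ> \<pi>2 : G2 \<rightarrow> G0\<close> and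
  \<open>d : G1 \<rightarrow> G0\<close>, that of composable triples.
\<close>

definition localic_groupoid :: "('o::frame, 'm::frame) groupoid_data \<Rightarrow> bool" where
  "localic_groupoid G \<longleftrightarrow>
    (let d = gdom G; r = grng G; u = gunit G; i = ginv G; m = gmult G;
         G2 = pullback UNIV UNIV r d;
         \<pi>1 = proj1 UNIV UNIV r d; \<pi>2 = proj2 UNIV UNIV r d;
         G3 = pullback G2 UNIV (r \<odot> \<pi>2) d;
         \<rho>1 = proj1 G2 UNIV (r \<odot> \<pi>2) d; \<rho>2 = proj2 G2 UNIV (r \<odot> \<pi>2) d
     in
       locale_map UNIV UNIV d \<and> locale_map UNIV UNIV r \<and> locale_map UNIV UNIV u \<and>
       locale_map UNIV UNIV i \<and> locale_map G2 UNIV m \<and>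
       d \<odot> u = id \<and> r \<odot> u = id \<and>
       d \<odot> m = d \<odot> \<pi>1 \<and> r \<odot> m = r \<odot> \<pi>2 \<and>
       m \<odot> pairing UNIV (u \<odot> d) id = id \<and>
       m \<odot> pairing UNIV id (u \<odot> r) = id \<and>
       m \<odot> pairing G3 (m \<odot> \<rho>1) \<rho>2 =
         m \<odot> pairing G3 (\<pi>1 \<odot> \<rho>1) (m \<odot> pairing G3 (\<pi>2 \<odot> \<rho>1) \<rho>2) \<and>
       d \<odot> i = r \<and> r \<odot> i = d \<and>
       m \<odot> pairing UNIV id i = u \<odot> d \<and>
       m \<odot> pairing UNIV i id = u \<odot> r)"

definition etale_groupoid :: "('o::frame, 'm::frame) groupoid_data \<Rightarrow> bool" where
  "etale_groupoid G \<longleftrightarrow> localic_groupoid G \<and> local_homeomorphism (gdom G)"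

definition qmult :: "('o::frame, 'm::frame) groupoid_data \<Rightarrow> 'm \<Rightarrow> 'm \<Rightarrow> 'm" where
  "qmult G a b = direct_image (gmult G) (tensor UNIV UNIV (grng G) (gdom G) a b)"

definition qstar :: "('o::frame, 'm::frame) groupoid_data \<Rightarrow> 'm \<Rightarrow> 'm" where
  "qstar G a = direct_image (ginv G) a"

definition qunit :: "('o::frame, 'm::frame) groupoid_data \<Rightarrow> 'm" where
  "qunit G = direct_image (gunit G) top"

definition partial_units :: "('o::frame, 'm::frame) groupoid_data \<Rightarrow> 'm set" where
  "partial_units G = {s. sup (qmult G s (qstar G s)) (qmult G (qstar G s) s) \<le> qunit G}"

definition qsupp :: "('o::frame, 'm::frame) groupoid_data \<Rightarrow> 'm \<Rightarrow> 'm" where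
  "qsupp G a = inf (qmult G a (qstar G a)) (qunit G)"


section \<open>Actions\<close>

record ('g0, 'g1, 'h0, 'h1, 'x) bilocale_data =
  lproj :: "'g0 \<Rightarrow> 'x"
  lact :: "'x \<Rightarrow> ('g1 \<times> 'x) set"
  rproj :: "'h0 \<Rightarrow> 'x"
  ract :: "'x \<Rightarrow> ('x \<times> 'h1) set"

definition left_glocale ::
  "('g0::frame, 'g1::frame) groupoid_data \<Rightarrow> ('g0 \<Rightarrow> 'x::frame) \<Rightarrow> ('x \<Rightarrow> ('g1 \<times> 'x) set) \<Rightarrow> bool"
where
  "left_glocale G p \<aa> \<longleftrightarrow>
    (let d = gdom G; r = grng G; u = gunit G; m = gmult G;
         G2 = pullback UNIV UNIV r d;
         \<gamma>1 = proj1 UNIV UNIV r d; \<gamma>2 = proj2 UNIV UNIV r d;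
         GX = pullback UNIV UNIV r p;
         \<pi>1 = proj1 UNIV UNIV r p; \<pi>2 = proj2 UNIV UNIV r p;
         GGX = pullback G2 UNIV (r \<odot> \<gamma>2) p;
         \<rho>1 = proj1 G2 UNIV (r \<odot> \<gamma>2) p; \<rho>2 = proj2 G2 UNIV (r \<odot> \<gamma>2) p
     in
       locale_map UNIV UNIV p \<and> locale_map GX UNIV \<aa> \<and>
       p \<odot> \<aa> = d \<odot> \<pi>1 \<and>
       \<aa> \<odot> pairing UNIV (u \<odot> p) id = id \<and>
       \<aa> \<odot> pairing GGX (m \<odot> \<rho>1) \<rho>2 =
         \<aa> \<odot> pairing GGX (\<gamma>1 \<odot> \<rho>1) (\<aa> \<odot> pairing GGX (\<gamma>2 \<odot> \<rho>1) \<rho>2))"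

definition right_glocale ::
  "('h0::frame, 'h1::frame) groupoid_data \<Rightarrow> ('h0 \<Rightarrow> 'x::frame) \<Rightarrow> ('x \<Rightarrow> ('x \<times> 'h1) set) \<Rightarrow> bool"
where
  "right_glocale H q \<bb> \<longleftrightarrow>
    (let d = gdom H; r = grng H; u = gunit H; m = gmult H;
         XH = pullback UNIV UNIV q d;
         \<pi>1 = proj1 UNIV UNIV q d; \<pi>2 = proj2 UNIV UNIV q d;
         XHH = pullback XH UNIV (r \<odot> \<pi>2) d;
         \<rho>1 = proj1 XH UNIV (r \<odot> \<pi>2) d; \<rho>2 = proj2 XH UNIV (r \<odot> \<pi>2) d
     in
       locale_map UNIV UNIV q \<and> locale_map XH UNIV \<bb> \<and>
       q \<odot> \<bb> = r \<odot> \<pi>2 \<and>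
       \<bb> \<odot> pairing UNIV id (u \<odot> q) = id \<and>
       \<bb> \<odot> pairing XHH (\<bb> \<odot> \<rho>1) \<rho>2 =
         \<bb> \<odot> pairing XHH (\<pi>1 \<odot> \<rho>1) (m \<odot> pairing XHH (\<pi>2 \<odot> \<rho>1) \<rho>2))"

text \<open>The actions commute as maps on \<open>GXH = (G1 \<otimes> X) \<otimes> H1\<close>, the pullback of \<open>q \<circ> \<pi>2\<close> and \<open>d\<close>.\<close>

definition bilocale ::
  "('g0::frame, 'g1::frame) groupoid_data \<Rightarrow> ('h0::frame, 'h1::frame) groupoid_data \<Rightarrow>
   ('g0, 'g1, 'h0, 'h1, 'x::frame) bilocale_data \<Rightarrow> bool"
where
  "bilocale G H X \<longleftrightarrow>
    (let p = lproj X; \<aa> = lact X; q = rproj X; \<bb> = ract X;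
         GX = pullback UNIV UNIV (grng G) p;
         \<pi>1 = proj1 UNIV UNIV (grng G) p; \<pi>2 = proj2 UNIV UNIV (grng G) p;
         \<kappa>1 = proj1 UNIV UNIV q (gdom H);
         GXH = pullback GX UNIV (q \<odot> \<pi>2) (gdom H);
         \<rho>1 = proj1 GX UNIV (q \<odot> \<pi>2) (gdom H); \<rho>2 = proj2 GX UNIV (q \<odot> \<pi>2) (gdom H)
     in
       left_glocale G p \<aa> \<and> right_glocale H q \<bb> \<and>
       p \<odot> \<bb> = p \<odot> \<kappa>1 \<and>
       q \<odot> \<aa> = q \<odot> \<pi>2 \<and>
       \<bb> \<odot> pairing GXH (\<aa> \<odot> \<rho>1) \<rho>2 =
         \<aa> \<odot> pairing GXH (\<pi>1 \<odot> \<rho>1) (\<bb> \<odot> pairing GXH (\<pi>2 \<odot> \<rho>1) \<rho>2))"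

definition bisheaf ::
  "('g0::frame, 'g1::frame) groupoid_data \<Rightarrow> ('h0::frame, 'h1::frame) groupoid_data \<Rightarrow>
   ('g0, 'g1, 'h0, 'h1, 'x::frame) bilocale_data \<Rightarrow> bool"
where
  "bisheaf G H X \<longleftrightarrow>
     bilocale G H X \<and> local_homeomorphism (lproj X) \<and> local_homeomorphism (rproj X)"

definition principal_bisheaf ::
  "('g0::frame, 'g1::frame) groupoid_data \<Rightarrow> ('h0::frame, 'h1::frame) groupoid_data \<Rightarrow>
   ('g0, 'g1, 'h0, 'h1, 'x::frame) bilocale_data \<Rightarrow> bool"
where
  "principal_bisheaf G H X \<longleftrightarrow>
     bisheaf G H X \<and>
     surjection (rproj X) \<and>
     (let GX = pullback UNIV UNIV (grng G) (lproj X);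
          \<pi>2 = proj2 UNIV UNIV (grng G) (lproj X);
          XX = pullback UNIV UNIV (rproj X) (rproj X)
      in locale_iso GX XX (pairing GX (lact X) \<pi>2))"


section \<open>Bimodule structure, local bisections and inner products\<close>

definition lmod ::
  "('g0::frame, 'g1::frame) groupoid_data \<Rightarrow> ('g0, 'g1, 'h0, 'h1, 'x::frame) bilocale_data \<Rightarrow>
   'g1 \<Rightarrow> 'x \<Rightarrow> 'x"
where
  "lmod G X a x = direct_image (lact X) (tensor UNIV UNIV (grng G) (lproj X) a x)"

definition rmod ::
  "('h0::frame, 'h1::frame) groupoid_data \<Rightarrow> ('g0, 'g1, 'h0, 'h1, 'x::frame) bilocale_data \<Rightarrow>
   'x \<Rightarrow> 'h1 \<Rightarrow> 'x"
where
  "rmod H X x b = direct_image (ract X) (tensor UNIV UNIV (rproj X) (gdom H) x b)"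

definition lsupp ::
  "('g0::frame, 'g1::frame) groupoid_data \<Rightarrow> ('g0, 'g1, 'h0, 'h1, 'x::frame) bilocale_data \<Rightarrow>
   'x \<Rightarrow> 'g1"
where
  "lsupp G X x = direct_image (gunit G) (direct_image (lproj X) x)"

definition rsupp ::
  "('h0::frame, 'h1::frame) groupoid_data \<Rightarrow> ('g0, 'g1, 'h0, 'h1, 'x::frame) bilocale_data \<Rightarrow>
   'x \<Rightarrow> 'h1"
where
  "rsupp H X x = direct_image (gunit H) (direct_image (rproj X) x)"

definition local_sections :: "('q \<Rightarrow> 'x::order \<Rightarrow> 'x) \<Rightarrow> ('x \<Rightarrow> 'q) \<Rightarrow> 'x set" where
  "local_sections act \<sigma> = {s. \<forall>x\<le>s. act (\<sigma> x) s = x}"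

text \<open>\<open>\<Gamma>\<^sub>X\<close>, \<open>\<Gamma>\<^sup>\<tau>\<^sub>X\<close> and their intersection.\<close>

definition left_sections ::
  "('g0::frame, 'g1::frame) groupoid_data \<Rightarrow> ('g0, 'g1, 'h0, 'h1, 'x::frame) bilocale_data \<Rightarrow> 'x set"
where
  "left_sections G X = local_sections (lmod G X) (lsupp G X)"

definition right_sections ::
  "('h0::frame, 'h1::frame) groupoid_data \<Rightarrow> ('g0, 'g1, 'h0, 'h1, 'x::frame) bilocale_data \<Rightarrow> 'x set"
where
  "right_sections H X = local_sections (\<lambda>b x. rmod H X x b) (rsupp H X)"

definition local_bisections ::
  "('g0::frame, 'g1::frame) groupoid_data \<Rightarrow> ('h0::frame, 'h1::frame) groupoid_data \<Rightarrow>
   ('g0, 'g1, 'h0, 'h1, 'x::frame) bilocale_data \<Rightarrow> 'x set"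
where
  "local_bisections G H X = left_sections G X \<inter> right_sections H X"

definition sup_bimorphism ::
  "('x::complete_lattice \<Rightarrow> 'y::complete_lattice \<Rightarrow> 'z::complete_lattice) \<Rightarrow> bool"
where
  "sup_bimorphism \<phi> \<longleftrightarrow>
     (\<forall>S y. \<phi> (Sup S) y = (SUP x\<in>S. \<phi> x y)) \<and> (\<forall>x S. \<phi> x (Sup S) = (SUP y\<in>S. \<phi> x y))"

text \<open>
  The sup-lattice homomorphism \<open>X \<otimes> Y \<rightarrow> Z\<close> induced by a map preserving joins in each variable is
  surjective: since \<open>X \<otimes> Y\<close> consists of the joins of pure tensors, its image consists of the joins
  of values of that map. (Surjectivity of the bare function \<open>X \<times> Y \<rightarrow> Z\<close> would be too much to ask of
  an inner product: for the pair groupoid on \<open>{1, 2}\<close> acting on \<open>{1, 2}\<close>, the values are the sets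
  \<open>S \<times> T\<close>, and the diagonal is only a union of these.)
\<close>

definition surjective_bimorphism ::
  "('x::complete_lattice \<Rightarrow> 'y::complete_lattice \<Rightarrow> 'z::complete_lattice) \<Rightarrow> bool"
where
  "surjective_bimorphism \<phi> \<longleftrightarrow> sup_bimorphism \<phi> \<and> (\<forall>z. \<exists>W. z = (SUP (x, y)\<in>W. \<phi> x y))"

text \<open>The inner product of a left \<open>\<O>(G)\<close>-sheaf, given by its module action \<open>act\<close> and support \<open>\<sigma>\<close>.\<close>

definition sheaf_inner ::
  "('g0::frame, 'g1::frame) groupoid_data \<Rightarrow> ('g1 \<Rightarrow> 'x::frame \<Rightarrow> 'x) \<Rightarrow> ('x \<Rightarrow> 'g1) \<Rightarrow>
   'x \<Rightarrow> 'x \<Rightarrow> 'g1"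
where
  "sheaf_inner G act \<sigma> =
     (THE \<phi>. sup_bimorphism \<phi> \<and>
        (\<forall>s\<in>local_sections act \<sigma>. \<forall>t\<in>local_sections act \<sigma>.
           \<phi> s t = Sup {v \<in> partial_units G.
              qsupp G v \<le> \<sigma> s \<and> qsupp G (qstar G v) \<le> \<sigma> t \<and> act v t \<le> s}))"

definition left_inner ::
  "('g0::frame, 'g1::frame) groupoid_data \<Rightarrow> ('g0, 'g1, 'h0, 'h1, 'x::frame) bilocale_data \<Rightarrow>
   'x \<Rightarrow> 'x \<Rightarrow> 'g1"
where
  "left_inner G X = sheaf_inner G (lmod G X) (lsupp G X)"

text \<open>For \<open>[-,-]\<close>, \<open>X\<close> is regarded as a left \<open>\<O>(H)\<close>-sheaf by \<open>b \<cdot> x = x b\<^sup>*\<close>, with projection \<open>q\<close>.\<close>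

definition right_inner ::
  "('h0::frame, 'h1::frame) groupoid_data \<Rightarrow> ('g0, 'g1, 'h0, 'h1, 'x::frame) bilocale_data \<Rightarrow>
   'x \<Rightarrow> 'x \<Rightarrow> 'h1"
where
  "right_inner H X = sheaf_inner H (\<lambda>b x. rmod H X x (qstar H b)) (rsupp H X)"

end

theory Submission
  imports Defs
begin

text \<open>
  All maps in sight are open, so an arrow set \<open>a\<close> acts on \<open>x\<close> with \<open>\<aa>\<^sup>*(y) = {(a, x). a x \<le> y}\<close>, and
  the inner product is the set of arrows carrying a point of \<open>y\<close> to a point of \<open>x\<close>, that is
  \<open>\<langle>x, y\<rangle> = \<pi>\<^sub>1\<^sub>! (\<aa>\<^sup>*x \<and> \<pi>\<^sub>2\<^sup>*y)\<close>. Write \<open>\<phi> = \<langle>\<aa>, \<pi>\<^sub>2\<rangle> : G\<^sub>1 \<otimes> X \<rightarrow> X \<otimes> X\<close> (over \<open>H\<^sub>0\<close>). Condition 2 says that \<open>q\<close> is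
  surjective, condition 1 that the action is free and condition 3 that it is transitive on the fibres
  of \<open>q\<close>. Freeness gives \<open>\<langle>a s, s\<rangle> \<le> a \<langle>s, s\<rangle> \<le> a\<close>, whence \<open>\<phi>\<^sup>*(a s \<otimes> s) = a \<otimes> s\<close> for local bisections \<open>s\<close>,
  so \<open>\<phi>\<^sup>*\<close> is onto; transitivity makes \<open>\<phi>\<^sup>*\<close> reflect the order, since \<open>x \<otimes> s\<close> is then covered by the
  elements \<open>v z \<otimes> z\<close> with \<open>z \<le> s\<close>, \<open>v\<close> a partial unit and \<open>v z \<le> x\<close>. The right action enters only through the
  left action \<open>(h, x) \<mapsto> x h\<^sup>-\<^sup>1\<close>.
\<close>

subsection \<open>Frame homomorphisms and open maps\<close>

text \<open>An element \<open>U\<close> of a pullback is a saturated set of pairs, and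
  \<open>(x, y) \<in> U\<close> says that the rectangle on \<open>x\<close> and \<open>y\<close>
  lies below \<open>U\<close>. Inclusions are therefore tested pair by pair, at the price of a
  saturation check for each candidate set. Only \<open>d\<close>, \<open>p\<close> and
  \<open>q\<close> are given as local homeomorphisms; direct images along \<open>r\<close>,
  \<open>u\<close>, multiplication and action have to be derived. The axioms are equations between
  locale maps, with no points to compute with, so groupoid calculations use generalised elements,
  that is, maps from a test locale \<open>T\<close>, and are then translated into inequalities
  between products of opens. Two devices keep this short: a groupoid acts on itself by
  multiplication, so quantale laws are instances of module laws; and the inner product, introduced
  by a description, is replaced by an explicit formula that is recognised by its values on
  sections.\<close>

lemma locale_map_UNIV_iff:
  "locale_map UNIV UNIV f \<longleftrightarrow>
    f top = top \<and> (\<forall>x y. f (inf x y) = inf (f x) (f y)) \<and> (\<forall>S. f (Sup S) = Sup (f ` S))"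
  by (auto simp: locale_map_def join_in_UNIV)

lemma
  assumes "locale_map UNIV UNIV f"
  shows frame_hom_top: "f top = top"
    and frame_hom_inf: "f (inf x y) = inf (f x) (f y)"
    and frame_hom_Sup: "f (Sup S) = Sup (f ` S)"
    and frame_hom_mono: "x \<le> y \<Longrightarrow> f x \<le> f y"
  using assms unfolding locale_map_UNIV_iff by (auto simp: inf.absorb_iff1) metis

lemma direct_image_eqI:
  assumes "\<And>c. b \<le> c \<longleftrightarrow> a \<le> f c"
  shows "direct_image f a = b"
  unfolding direct_image_def
  by (rule the_equality) (use assms in \<open>auto intro: order.antisym\<close>)

text \<open>Monotonicity and the adjunction already give
  \<open>g (inf x (f y)) \<le> inf (g x) y\<close>, so Frobenius reciprocity has only one half to
  check.\<close>

lemma open_mapI: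
  assumes f: "locale_map UNIV UNIV f" and adj: "\<And>a c. g a \<le> c \<longleftrightarrow> a \<le> f c"
    and frob: "\<And>x y. inf (g x) y \<le> g (inf x (f y))"
  shows "open_map f" "direct_image f = g"
proof -
  show g: "direct_image f = g"
    by (rule ext, rule direct_image_eqI) (rule adj)
  have mono: "g a \<le> g b" if "a \<le> b" for a b using adj that order.trans by blast
  have "g (inf x (f y)) \<le> inf (g x) y" for x y
    by (intro le_infI mono) (auto simp: adj)
  then show "open_map f"
    unfolding open_map_def g using f adj frob by (auto intro: order.antisym)
qed

lemma
  assumes "open_map f"
  shows open_map_hom: "locale_map UNIV UNIV f"
    and direct_image_le_iff: "direct_image f a \<le> c \<longleftrightarrow> a \<le> f c"
    and direct_image_frobenius: "direct_image f (inf x (f y)) = inf (direct_image f x) y"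
  using assms by (auto simp: open_map_def)

lemma
  assumes "open_map f"
  shows direct_image_mono: "a \<le> b \<Longrightarrow> direct_image f a \<le> direct_image f b"
    and direct_image_unit: "a \<le> f (direct_image f a)"
proof -
  show unit: "a \<le> f (direct_image f a)" for a
    using direct_image_le_iff[OF assms] by blast
  then show "a \<le> b \<Longrightarrow> direct_image f a \<le> direct_image f b"
    using direct_image_le_iff[OF assms] order.trans by blast
qed

text \<open>Frobenius reciprocity at \<open>top\<close> gives
  \<open>direct_image f (f c) = inf (direct_image f top) c\<close>, so a full image makes
  \<open>direct_image f\<close> a left inverse of \<open>f\<close>.\<close>

lemma surjection_iff_direct_image_top:
  assumes f: "open_map f"
  shows "surjection f \<longleftrightarrow> direct_image f top = top"
proof
  assume "surjection f"
  then have "inj f" by (simp add: surjection_def)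
  moreover have "f (direct_image f top) = f top"
    using direct_image_unit[OF f, of top] frame_hom_top[OF open_map_hom[OF f]] by (simp add: top_unique)
  ultimately show "direct_image f top = top" by (simp add: inj_eq)
next
  assume *: "direct_image f top = top"
  have "direct_image f (f c) = c" for c
    using direct_image_frobenius[OF f, of top c] * by simp
  then show "surjection f"
    unfolding surjection_def using open_map_hom[OF f] by (metis injI)
qed

text \<open>The elements on which a local homeomorphism restricts to an isomorphism onto its image.\<close>

definition section_of :: "('b::frame \<Rightarrow> 'a::frame) \<Rightarrow> 'a \<Rightarrow> bool" where
  "section_of f s \<longleftrightarrow> (\<forall>x\<le>s. inf (f (direct_image f x)) s = x)"

lemma section_ofD: "section_of f s \<Longrightarrow> x \<le> s \<Longrightarrow> inf (f (direct_image f x)) s = x"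
  by (simp add: section_of_def)

lemma section_of_down:
  assumes s: "section_of f s" and t: "t \<le> s"
  shows "section_of f t"
  unfolding section_of_def
proof (intro allI impI)
  fix x assume x: "x \<le> t"
  then have "inf (f (direct_image f x)) s = x" using section_ofD[OF s] t by (meson order.trans)
  then show "inf (f (direct_image f x)) t = x"
    using x t by (metis inf.absorb1 inf.commute inf.left_commute)
qed

definition join_dense :: "'a::complete_lattice set \<Rightarrow> bool" where
  "join_dense B \<longleftrightarrow> (\<forall>a. Sup {b \<in> B. b \<le> a} = a)"

lemma join_denseI:
  fixes S :: "'a::frame set"
  assumes "Sup S = top" and "\<And>s x. s \<in> S \<Longrightarrow> x \<le> s \<Longrightarrow> x \<in> B"
  shows "join_dense B"
  unfolding join_dense_def
proof (intro allI order.antisym Sup_least)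
  fix a :: 'a
  have "a = inf a (Sup S)" by (simp add: assms(1))
  also have "\<dots> = Sup (inf a ` S)" by (rule inf_Sup_distrib)
  also have "\<dots> \<le> Sup {b \<in> B. b \<le> a}"
    by (rule Sup_mono) (use assms(2) in \<open>fastforce\<close>)
  finally show "a \<le> Sup {b \<in> B. b \<le> a}" .
qed auto

text \<open>Each member of \<open>C\<close> is the join of the members of \<open>B\<close> below it,
  and these stay in \<open>C\<close> because \<open>C\<close> is downward closed. This provides
  bases of opens that are sections of two maps at once.\<close>

lemma join_dense_Int:
  fixes B C :: "'a::frame set"
  assumes B: "join_dense B" and C: "join_dense C" and dC: "\<And>x y. x \<in> C \<Longrightarrow> y \<le> x \<Longrightarrow> y \<in> C"
  shows "join_dense (B \<inter> C)"
  unfolding join_dense_def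
proof (intro allI order.antisym Sup_least)
  fix a
  let ?S = "Sup {b \<in> B \<inter> C. b \<le> a}"
  have "c \<le> ?S" if c: "c \<in> C" "c \<le> a" for c
  proof -
    have "c = Sup {b \<in> B. b \<le> c}" using B by (simp add: join_dense_def)
    also have "\<dots> \<le> ?S" by (rule Sup_subset_mono) (use c dC in auto)
    finally show ?thesis .
  qed
  then have "Sup {c \<in> C. c \<le> a} \<le> ?S" by (auto intro: Sup_least)
  then show "a \<le> ?S" using C by (simp add: join_dense_def)
qed auto

lemma local_homeomorphism_open: "local_homeomorphism f \<Longrightarrow> open_map f"
  by (simp add: local_homeomorphism_def)

text \<open>By Frobenius reciprocity \<open>x\<close> and
  \<open>inf (f (direct_image f x)) s\<close> have the same image, so injectivity of the direct
  image below \<open>s\<close> identifies them. Sections are closed downwards, so a cover by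
  sections is a base.\<close>

lemma local_homeomorphism_join_dense:
  assumes "local_homeomorphism f"
  shows "join_dense (Collect (section_of f))"
proof -
  have f: "open_map f" using assms by (rule local_homeomorphism_open)
  obtain S where S: "Sup S = top"
    and inj: "\<And>s x y. s \<in> S \<Longrightarrow> x \<le> s \<Longrightarrow> y \<le> s \<Longrightarrow> direct_image f x \<le> direct_image f y \<longleftrightarrow> x \<le> y"
    using assms unfolding local_homeomorphism_def by blast
  have "section_of f s" if s: "s \<in> S" for s
    unfolding section_of_def
  proof (intro allI impI)
    fix x assume x: "x \<le> s"
    let ?y = "inf (f (direct_image f x)) s"
    have "direct_image f ?y = inf (direct_image f s) (direct_image f x)"
      using direct_image_frobenius[OF f, of s "direct_image f x"] by (simp add: inf.commute)
    also have "\<dots> = direct_image f x"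
      using direct_image_mono[OF f x] by (simp add: inf_absorb2)
    finally have "direct_image f ?y = direct_image f x" .
    then show "?y = x"
      using inj[OF s, of ?y x] inj[OF s, of x ?y] x by (auto intro: order.antisym)
  qed
  then show ?thesis
    using S by (intro join_denseI[OF S]) (auto intro: section_of_down)
qed

subsection \<open>Composition with pairings\<close>

lemma locale_mapD:
  assumes "locale_map A B f"
  shows locale_map_mem: "x \<in> B \<Longrightarrow> f x \<in> A"
    and locale_map_Sup: "f (Sup B) = Sup A"
    and locale_map_inf: "x \<in> B \<Longrightarrow> y \<in> B \<Longrightarrow> f (inf x y) = inf (f x) (f y)"
    and locale_map_join: "S \<subseteq> B \<Longrightarrow> f (join_in B S) = join_in A (f ` S)"
  using assms by (auto simp: locale_map_def)

lemma locale_map_mono: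
  assumes "locale_map A B f" "x \<in> B" "y \<in> B" "x \<le> y"
  shows "f x \<le> f y"
  using locale_map_inf[OF assms(1-3)] assms(4) by (metis inf.absorb_iff1)

lemma locale_map_comp:
  assumes g: "locale_map A B g" and f: "locale_map B C f"
  shows "locale_map A C (f \<odot> g)"
  unfolding locale_map_def loc_comp_def
proof (intro conjI ballI allI impI)
  show "(\<lambda>z. g (f z)) ` C \<subseteq> A" using f g by (auto simp: locale_map_def)
  show "g (f (Sup C)) = Sup A" using f g by (simp add: locale_map_Sup)
  show "g (f (inf x y)) = inf (g (f x)) (g (f y))" if "x \<in> C" "y \<in> C" for x y
    using that by (simp add: locale_map_inf[OF f] locale_map_inf[OF g] locale_map_mem[OF f])
  show "g (f (join_in C S)) = join_in A ((\<lambda>z. g (f z)) ` S)" if "S \<subseteq> C" for S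
  proof -
    have "f ` S \<subseteq> B" using that locale_map_mem[OF f] by auto
    then show ?thesis
      using that by (simp add: locale_map_join[OF f] locale_map_join[OF g] image_image)
  qed
qed

lemma locale_map_id: "locale_map A A id"
  by (simp add: locale_map_def)

lemma loc_comp_assoc: "(f \<odot> g) \<odot> h = f \<odot> (g \<odot> h)"
  by (simp add: loc_comp_def)

lemma loc_comp_id [simp]: "id \<odot> f = f" "f \<odot> id = f"
  by (simp_all add: loc_comp_def)

lemma loc_comp_eq_left: "f \<odot> g = h \<Longrightarrow> f \<odot> (g \<odot> k) = h \<odot> k"
  by (auto simp: loc_comp_def)

lemma loc_comp_apply: "(f \<odot> g) z = g (f z)"
  by (simp add: loc_comp_def)

text \<open>Reindexing along \<open>t\<close> turns an axiom, an equation of pairings on a universal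
  domain, into the same equation for arbitrary generalised elements.\<close>

lemma pairing_loc_comp:
  assumes T: "frame_on T" and h: "locale_map T UNIV h" and k: "locale_map T UNIV k"
    and t: "locale_map T' T t"
  shows "pairing T h k \<odot> t = pairing T' (h \<odot> t) (k \<odot> t)"
proof
  fix U
  have mem: "h x \<in> T" "k y \<in> T" for x y
    using locale_map_mem[OF h] locale_map_mem[OF k] by auto
  have "(\<lambda>(x, y). inf (h x) (k y)) ` U \<subseteq> T"
    using mem frame_on_inf[OF T] by auto
  then have "t (pairing T h k U) = join_in T' (t ` (\<lambda>(x, y). inf (h x) (k y)) ` U)"
    unfolding pairing_def by (rule locale_map_join[OF t])
  also have "t ` (\<lambda>(x, y). inf (h x) (k y)) ` U = (\<lambda>(x, y). inf (t (h x)) (t (k y))) ` U"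
    unfolding image_image using mem by (intro image_cong) (auto simp: locale_map_inf[OF t])
  finally show "(pairing T h k \<odot> t) U = pairing T' (h \<odot> t) (k \<odot> t) U"
    by (simp add: loc_comp_def pairing_def)
qed

lemma loc_comp_pairing_comp:
  assumes "frame_on T" "locale_map T UNIV h" "locale_map T UNIV k" "locale_map T' T t"
  shows "(f \<odot> pairing T h k) \<odot> t = f \<odot> pairing T' (h \<odot> t) (k \<odot> t)"
  by (simp add: loc_comp_assoc pairing_loc_comp[OF assms])

subsection \<open>Pullbacks of open maps\<close>

context
  fixes f :: "'c::frame \<Rightarrow> 'a::frame" and g :: "'c \<Rightarrow> 'b::frame"
  assumes f: "locale_map UNIV UNIV f" and g: "locale_map UNIV UNIV g"
begin

abbreviation "PB \<equiv> pullback UNIV UNIV f g"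

lemma PB_I:
  assumes "\<And>x y x' y'. (x, y) \<in> U \<Longrightarrow> x' \<le> x \<Longrightarrow> y' \<le> y \<Longrightarrow> (x', y') \<in> U"
    and "\<And>S y. (\<And>s. s \<in> S \<Longrightarrow> (s, y) \<in> U) \<Longrightarrow> (Sup S, y) \<in> U"
    and "\<And>x S. (\<And>s. s \<in> S \<Longrightarrow> (x, s) \<in> U) \<Longrightarrow> (x, Sup S) \<in> U"
    and "\<And>x y c. (inf x (f c), y) \<in> U \<longleftrightarrow> (x, inf (g c) y) \<in> U"
  shows "U \<in> PB"
proof (rule pullbackI)
  show "U \<subseteq> UNIV \<times> UNIV" by simp
  show "(x', y') \<in> U" if "(x, y) \<in> U" "x' \<le> x" "y' \<le> y" for x y x' y' using assms(1) that .
  show "(join_in UNIV S, y) \<in> U" if "\<And>s. s \<in> S \<Longrightarrow> (s, y) \<in> U" for S y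
    unfolding join_in_UNIV using assms(2) that .
  show "(x, join_in UNIV S) \<in> U" if "\<And>s. s \<in> S \<Longrightarrow> (x, s) \<in> U" for x S
    unfolding join_in_UNIV using assms(3) that .
  show "(inf x (f c), y) \<in> U \<longleftrightarrow> (x, inf (g c) y) \<in> U" for x y c by (rule assms(4))
qed

context
  fixes U assumes U: "U \<in> PB"
begin

lemma PB_down: "(x, y) \<in> U \<Longrightarrow> x' \<le> x \<Longrightarrow> y' \<le> y \<Longrightarrow> (x', y') \<in> U"
  using pullback_down[OF U] by blast

lemma PB_Sup1: "(\<And>s. s \<in> S \<Longrightarrow> (s, y) \<in> U) \<Longrightarrow> (Sup S, y) \<in> U"
  using pullback_join1[OF U, of S y] by (simp add: join_in_UNIV)

lemma PB_Sup2: "(\<And>s. s \<in> S \<Longrightarrow> (x, s) \<in> U) \<Longrightarrow> (x, Sup S) \<in> U"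
  using pullback_join2[OF U, of x S] by (simp add: join_in_UNIV)

lemma PB_bal: "(inf x (f c), y) \<in> U \<longleftrightarrow> (x, inf (g c) y) \<in> U"
  using pullback_bal[OF U] by blast

lemma PB_dense2:
  assumes B: "join_dense B" and *: "\<And>s. s \<in> B \<Longrightarrow> s \<le> y \<Longrightarrow> (x, s) \<in> U"
  shows "(x, y) \<in> U"
  using PB_Sup2[of "{b \<in> B. b \<le> y}" x] B * by (simp add: join_dense_def)

text \<open>Since \<open>x\<close> lies over its own image, a rectangle sees only the part of
  \<open>y\<close> over that image.\<close>

lemma PB_restrict2:
  assumes "open_map f"
  shows "(x, y) \<in> U \<longleftrightarrow> (x, inf (g (direct_image f x)) y) \<in> U"
  using PB_bal[of x "direct_image f x" y] direct_image_unit[OF assms, of x]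
  by (simp add: inf_absorb1)

lemma PB_restrict1:
  assumes "open_map g"
  shows "(x, y) \<in> U \<longleftrightarrow> (inf x (f (direct_image g y)), y) \<in> U"
  using PB_bal[of x "direct_image g y" y] direct_image_unit[OF assms, of y]
  by (simp add: inf_absorb2)

lemma tensor_subset_iff: "tensor UNIV UNIV f g x y \<subseteq> U \<longleftrightarrow> (x, y) \<in> U"
  using tensor_eq[OF frame_on_UNIV frame_on_UNIV f g, of x y] U by auto

end

lemma PB_frame: "frame_on PB"
  by (rule pullback_frame[OF frame_on_UNIV frame_on_UNIV f g])

lemma PB_proj1: "locale_map PB UNIV (proj1 UNIV UNIV f g)"
  by (rule proj1_locale_map[OF frame_on_UNIV frame_on_UNIV f g])

lemma PB_proj2: "locale_map PB UNIV (proj2 UNIV UNIV f g)"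
  by (rule proj2_locale_map[OF frame_on_UNIV frame_on_UNIV f g])

lemma PB_proj1_mem: "proj1 UNIV UNIV f g x \<in> PB"
  using locale_map_mem[OF PB_proj1] by auto

lemma PB_proj2_mem: "proj2 UNIV UNIV f g y \<in> PB"
  using locale_map_mem[OF PB_proj2] by auto

lemma PB_commutes: "f \<odot> proj1 UNIV UNIV f g = g \<odot> proj2 UNIV UNIV f g"
  by (rule pullback_commutes[OF frame_on_UNIV frame_on_UNIV f g])

lemma PB_inf: "U \<in> PB \<Longrightarrow> V \<in> PB \<Longrightarrow> U \<inter> V \<in> PB"
  using frame_on_inf[OF PB_frame] by auto

lemma tensor_mem: "tensor UNIV UNIV f g x y \<in> PB"
  unfolding tensor_def inf_set_def[symmetric]
  by (intro frame_on_inf[OF PB_frame] PB_proj1_mem PB_proj2_mem)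

lemma tensor_gen: "(x, y) \<in> tensor UNIV UNIV f g x y"
  using tensor_subset_iff[OF tensor_mem] by blast

text \<open>Pulling back the open map \<open>f\<close> makes the second projection open, and the
  image of the rectangle on \<open>x\<close> and \<open>y\<close> is
  \<open>inf y (g (direct_image f x))\<close> (Beck-Chevalley). The set cut out by this inequality
  is the one generated by all pairs \<open>(x, b)\<close>.\<close>

lemma proj2_iff:
  assumes fo: "open_map f"
  shows "(x, y) \<in> proj2 UNIV UNIV f g b \<longleftrightarrow> inf y (g (direct_image f x)) \<le> b"
proof
  let ?f = "direct_image f"
  have "{(x, y). inf y (g (?f x)) \<le> b} \<in> PB"
  proof (rule PB_I; clarsimp)
    fix x y x' y' assume *: "inf y (g (?f x)) \<le> b" "x' \<le> x" "y' \<le> y"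
    have "inf y' (g (?f x')) \<le> inf y (g (?f x))"
      by (intro inf_mono *(3) frame_hom_mono[OF g] direct_image_mono[OF fo] *(2))
    then show "inf y' (g (?f x')) \<le> b" using *(1) by (rule order.trans)
  next
    fix S y assume *: "\<And>s. s \<in> S \<Longrightarrow> inf y (g (?f s)) \<le> b"
    have "?f (Sup S) \<le> Sup (?f ` S)"
      unfolding direct_image_le_iff[OF fo]
      by (rule Sup_least) (auto simp: direct_image_le_iff[OF fo, symmetric] intro: Sup_upper)
    then have "g (?f (Sup S)) \<le> Sup (g ` ?f ` S)"
      unfolding frame_hom_Sup[OF g, symmetric] by (rule frame_hom_mono[OF g])
    then have "inf y (g (?f (Sup S))) \<le> inf y (Sup (g ` ?f ` S))" by (simp add: inf.coboundedI2)
    also have "\<dots> = Sup (inf y ` g ` ?f ` S)" by (rule inf_Sup_distrib)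
    also have "\<dots> \<le> b" using * by (auto intro!: Sup_least)
    finally show "inf y (g (?f (Sup S))) \<le> b" .
  next
    fix x S assume *: "\<And>s. s \<in> S \<Longrightarrow> inf s (g (?f x)) \<le> b"
    have "inf (Sup S) (g (?f x)) = Sup (inf (g (?f x)) ` S)"
      by (subst inf.commute) (rule inf_Sup_distrib)
    also have "\<dots> \<le> b" using * by (auto intro!: Sup_least simp: inf.commute)
    finally show "inf (Sup S) (g (?f x)) \<le> b" .
  next
    fix x y c
    \<comment> \<open>Frobenius reciprocity of \<open>f\<close> is what balances the set over the
      base.\<close>
    show "(inf y (g (?f (inf x (f c)))) \<le> b) = (inf (inf (g c) y) (g (?f x)) \<le> b)"
      by (simp add: direct_image_frobenius[OF fo] frame_hom_inf[OF g] ac_simps)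
  qed
  moreover have "UNIV \<times> {b} \<subseteq> {(x, y). inf y (g (?f x)) \<le> b}" by auto
  ultimately have "proj2 UNIV UNIV f g b \<subseteq> {(x, y). inf y (g (?f x)) \<le> b}"
    by (rule proj2_least[OF frame_on_UNIV frame_on_UNIV f g])
  then show "(x, y) \<in> proj2 UNIV UNIV f g b \<Longrightarrow> inf y (g (?f x)) \<le> b" by auto
  assume *: "inf y (g (?f x)) \<le> b"
  have "(x, b) \<in> proj2 UNIV UNIV f g b"
    by (rule proj2_gen[OF frame_on_UNIV frame_on_UNIV f g]) simp
  then have "(x, inf (g (?f x)) y) \<in> proj2 UNIV UNIV f g b"
    by (rule PB_down[OF PB_proj2_mem]) (use * in \<open>simp_all add: inf.commute\<close>)
  then show "(x, y) \<in> proj2 UNIV UNIV f g b"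
    using PB_restrict2[OF PB_proj2_mem fo] by blast
qed

lemma PB_pairing:
  assumes "frame_on T" "locale_map T UNIV h" "locale_map T UNIV k" "f \<odot> h = g \<odot> k"
  shows PB_pairing_map: "locale_map T PB (pairing T h k)"
    and PB_pairing_proj1: "proj1 UNIV UNIV f g \<odot> pairing T h k = h"
    and PB_pairing_proj2: "proj2 UNIV UNIV f g \<odot> pairing T h k = k"
proof -
  note 1 = frame_on_UNIV frame_on_UNIV f g assms
  show "locale_map T PB (pairing T h k)" by (rule pairing_locale_map[OF 1])
  show "proj1 UNIV UNIV f g \<odot> pairing T h k = h"
    unfolding loc_comp_def using pairing_proj1[OF 1] by auto
  show "proj2 UNIV UNIV f g \<odot> pairing T h k = k"
    unfolding loc_comp_def using pairing_proj2[OF 1] by auto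
qed

lemma PB_converse:
  assumes U: "U \<in> PB"
  shows "U\<inverse> \<in> pullback UNIV UNIV g f"
  using PB_down[OF U] PB_Sup1[OF U] PB_Sup2[OF U] PB_bal[OF U]
  by (intro pullbackI) (auto simp: join_in_UNIV inf.commute)

end

lemma proj1_eq_converse:
  fixes f :: "'c::frame \<Rightarrow> 'a::frame" and g :: "'c \<Rightarrow> 'b::frame"
  assumes f: "locale_map UNIV UNIV f" and g: "locale_map UNIV UNIV g"
  shows "proj1 UNIV UNIV f g x = (proj2 UNIV UNIV g f x)\<inverse>"
proof
  note 1 = frame_on_UNIV frame_on_UNIV f g and 2 = frame_on_UNIV frame_on_UNIV g f
  show "proj1 UNIV UNIV f g x \<subseteq> (proj2 UNIV UNIV g f x)\<inverse>"
    by (rule proj1_least[OF 1 PB_converse[OF g f PB_proj2_mem[OF g f]]])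
      (auto intro: proj2_gen[OF 2])
  have "proj2 UNIV UNIV g f x \<subseteq> (proj1 UNIV UNIV f g x)\<inverse>"
    by (rule proj2_least[OF 2 PB_converse[OF f g PB_proj1_mem[OF f g]]])
      (auto intro: proj1_gen[OF 1])
  then show "(proj2 UNIV UNIV g f x)\<inverse> \<subseteq> proj1 UNIV UNIV f g x" by auto
qed

lemma proj1_iff:
  fixes f :: "'c::frame \<Rightarrow> 'a::frame" and g :: "'c \<Rightarrow> 'b::frame"
  assumes "locale_map UNIV UNIV f" "open_map g"
  shows "(x, y) \<in> proj1 UNIV UNIV f g a \<longleftrightarrow> inf x (f (direct_image g y)) \<le> a"
  using proj2_iff[OF open_map_hom[OF assms(2)] assms(1,2)]
  by (simp add: proj1_eq_converse[OF assms(1) open_map_hom[OF assms(2)]])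

subsection \<open>Generalised elements of a localic groupoid and of its actions\<close>

locale localic_gpd =
  fixes G :: "('o::frame, 'm::frame) groupoid_data"
  assumes groupoid: "localic_groupoid G"
begin

abbreviation "d \<equiv> gdom G"
abbreviation "r \<equiv> grng G"
abbreviation "u \<equiv> gunit G"
abbreviation "i \<equiv> ginv G"
abbreviation "m \<equiv> gmult G"

lemma d: "locale_map UNIV UNIV d" and r: "locale_map UNIV UNIV r"
  and u: "locale_map UNIV UNIV u" and i: "locale_map UNIV UNIV i"
  and m: "locale_map (pullback UNIV UNIV r d) UNIV m"
  and d_u: "d \<odot> u = id" and r_u: "r \<odot> u = id"
  and m_unit_right: "m \<odot> pairing UNIV id (u \<odot> r) = id"
  and r_m: "r \<odot> m = r \<odot> proj2 UNIV UNIV r d"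
  and d_i: "d \<odot> i = r" and r_i: "r \<odot> i = d"
  and m_i_right: "m \<odot> pairing UNIV id i = u \<odot> d"
  and m_i_left: "m \<odot> pairing UNIV i id = u \<odot> r"
  using groupoid unfolding localic_groupoid_def Let_def by blast+

text \<open>Multiplication is an action of the groupoid on its arrows with projection
  \<open>d\<close>, so each later fact about actions also yields one about multiplication.\<close>

lemma left_glocale_self: "left_glocale G d m"
  using groupoid unfolding localic_groupoid_def left_glocale_def Let_def by blast

end

locale localic_action = localic_gpd G for G :: "('o::frame, 'm::frame) groupoid_data" +
  fixes p :: "'o \<Rightarrow> 'x::frame" and \<aa> :: "'x \<Rightarrow> ('m \<times> 'x) set"
  assumes left_glocale: "left_glocale G p \<aa>"
begin

abbreviation "GX \<equiv> pullback UNIV UNIV r p"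
abbreviation "\<pi>1 \<equiv> proj1 UNIV UNIV r p"
abbreviation "\<pi>2 \<equiv> proj2 UNIV UNIV r p"
abbreviation "G2 \<equiv> pullback UNIV UNIV r d"
abbreviation "\<gamma>1 \<equiv> proj1 UNIV UNIV r d"
abbreviation "\<gamma>2 \<equiv> proj2 UNIV UNIV r d"
abbreviation "GGX \<equiv> pullback G2 UNIV (r \<odot> \<gamma>2) p"
abbreviation "\<rho>1 \<equiv> proj1 G2 UNIV (r \<odot> \<gamma>2) p"
abbreviation "\<rho>2 \<equiv> proj2 G2 UNIV (r \<odot> \<gamma>2) p"

lemma p: "locale_map UNIV UNIV p" and \<aa>: "locale_map GX UNIV \<aa>"
  and p_\<aa>: "p \<odot> \<aa> = d \<odot> \<pi>1"
  and \<aa>_unit: "\<aa> \<odot> pairing UNIV (u \<odot> p) id = id"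
  and \<aa>_assoc: "\<aa> \<odot> pairing GGX (m \<odot> \<rho>1) \<rho>2 =
     \<aa> \<odot> pairing GGX (\<gamma>1 \<odot> \<rho>1) (\<aa> \<odot> pairing GGX (\<gamma>2 \<odot> \<rho>1) \<rho>2)"
  using left_glocale unfolding left_glocale_def Let_def by blast+

lemma GX_frame: "frame_on GX" by (rule PB_frame[OF r p])
lemma \<pi>1: "locale_map GX UNIV \<pi>1" by (rule PB_proj1[OF r p])
lemma \<pi>2: "locale_map GX UNIV \<pi>2" by (rule PB_proj2[OF r p])
lemma r_\<pi>1: "r \<odot> \<pi>1 = p \<odot> \<pi>2" by (rule PB_commutes[OF r p])

lemma GGX_args: "frame_on G2" "frame_on (UNIV :: 'x set)" "locale_map G2 UNIV (r \<odot> \<gamma>2)" "locale_map UNIV UNIV p"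
  using PB_frame[OF r d] frame_on_UNIV locale_map_comp[OF PB_proj2[OF r d] r] p by auto

lemma GGX_frame: "frame_on GGX" by (rule pullback_frame[OF GGX_args])
lemma \<rho>1: "locale_map GGX G2 \<rho>1" by (rule proj1_locale_map[OF GGX_args])
lemma \<rho>2: "locale_map GGX UNIV \<rho>2" by (rule proj2_locale_map[OF GGX_args])
lemma r_\<rho>1: "(r \<odot> \<gamma>2) \<odot> \<rho>1 = p \<odot> \<rho>2" by (rule pullback_commutes[OF GGX_args])

lemma act_map:
  assumes "frame_on T" "locale_map T UNIV g" "locale_map T UNIV x" "r \<odot> g = p \<odot> x"
  shows "locale_map T UNIV (\<aa> \<odot> pairing T g x)" "p \<odot> (\<aa> \<odot> pairing T g x) = d \<odot> g"
proof -
  show "locale_map T UNIV (\<aa> \<odot> pairing T g x)"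
    by (rule locale_map_comp[OF PB_pairing_map[OF r p assms] \<aa>])
  show "p \<odot> (\<aa> \<odot> pairing T g x) = d \<odot> g"
    by (simp add: loc_comp_eq_left[OF p_\<aa>] loc_comp_assoc PB_pairing_proj1[OF r p assms])
qed

lemma act_unit:
  assumes "locale_map T UNIV x"
  shows "\<aa> \<odot> pairing T (u \<odot> (p \<odot> x)) x = x"
  using loc_comp_pairing_comp[OF frame_on_UNIV locale_map_comp[OF p u] locale_map_id assms, of \<aa>]
  by (simp add: \<aa>_unit loc_comp_assoc)

lemma \<rho>_maps:
  "locale_map GGX UNIV (m \<odot> \<rho>1)" "locale_map GGX UNIV (\<gamma>1 \<odot> \<rho>1)" "locale_map GGX UNIV (\<gamma>2 \<odot> \<rho>1)"
  "locale_map GGX UNIV (\<aa> \<odot> pairing GGX (\<gamma>2 \<odot> \<rho>1) \<rho>2)"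
proof -
  show 1: "locale_map GGX UNIV (m \<odot> \<rho>1)" "locale_map GGX UNIV (\<gamma>1 \<odot> \<rho>1)"
    "locale_map GGX UNIV (\<gamma>2 \<odot> \<rho>1)"
    by (rule locale_map_comp[OF \<rho>1 m] locale_map_comp[OF \<rho>1 PB_proj1[OF r d]]
        locale_map_comp[OF \<rho>1 PB_proj2[OF r d]])+
  have 2: "r \<odot> (\<gamma>2 \<odot> \<rho>1) = p \<odot> \<rho>2" using r_\<rho>1 by (simp add: loc_comp_assoc)
  show "locale_map GGX UNIV (\<aa> \<odot> pairing GGX (\<gamma>2 \<odot> \<rho>1) \<rho>2)"
    by (rule act_map(1)[OF GGX_frame 1(3) \<rho>2 2])
qed

text \<open>The triple \<open>(g, h, x)\<close> is a single map from \<open>T\<close> to the locale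
  \<open>GGX\<close> of composable triples, and the axiom is composed with that map.\<close>

lemma act_assoc:
  assumes T: "frame_on T" and g: "locale_map T UNIV g" and h: "locale_map T UNIV h"
    and x: "locale_map T UNIV x" and gh: "r \<odot> g = d \<odot> h" and hx: "r \<odot> h = p \<odot> x"
  shows "\<aa> \<odot> pairing T (m \<odot> pairing T g h) x = \<aa> \<odot> pairing T g (\<aa> \<odot> pairing T h x)"
proof -
  let ?gh = "pairing T g h"
  let ?t = "pairing T ?gh x"
  have ghm: "locale_map T G2 ?gh" by (rule PB_pairing_map[OF r d T g h gh])
  have g1: "\<gamma>1 \<odot> ?gh = g" and g2: "\<gamma>2 \<odot> ?gh = h"
    using PB_pairing_proj1[OF r d T g h gh] PB_pairing_proj2[OF r d T g h gh] by auto
  have ghx: "(r \<odot> \<gamma>2) \<odot> ?gh = p \<odot> x" by (simp add: loc_comp_assoc g2 hx)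
  note args = GGX_args T ghm x ghx
  have t: "locale_map T GGX ?t" by (rule pairing_locale_map[OF args])
  have c1: "(f \<odot> \<rho>1) \<odot> ?t = f \<odot> ?gh" if "\<And>z. f z \<in> G2" for f :: "'z \<Rightarrow> _"
    by (rule ext) (simp add: loc_comp_apply pairing_proj1[OF args that])
  have c2: "\<rho>2 \<odot> ?t = x"
    by (rule ext) (simp add: loc_comp_apply pairing_proj2[OF args])
  have mem: "m z \<in> G2" "\<gamma>1 z' \<in> G2" "\<gamma>2 z' \<in> G2" for z z'
    using locale_map_mem[OF m] PB_proj1_mem[OF r d] PB_proj2_mem[OF r d] by auto
  have "(\<aa> \<odot> pairing GGX (m \<odot> \<rho>1) \<rho>2) \<odot> ?t = \<aa> \<odot> pairing T (m \<odot> ?gh) x"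
    by (simp add: loc_comp_pairing_comp[OF GGX_frame \<rho>_maps(1) \<rho>2 t] c1 c2 mem)
  moreover have "(\<aa> \<odot> pairing GGX (\<gamma>1 \<odot> \<rho>1) (\<aa> \<odot> pairing GGX (\<gamma>2 \<odot> \<rho>1) \<rho>2)) \<odot> ?t =
     \<aa> \<odot> pairing T g (\<aa> \<odot> pairing T h x)"
    by (simp add: loc_comp_pairing_comp[OF GGX_frame \<rho>_maps(2) \<rho>_maps(4) t]
        loc_comp_pairing_comp[OF GGX_frame \<rho>_maps(3) \<rho>2 t] c1 c2 mem g1 g2)
  ultimately show ?thesis using \<aa>_assoc by simp
qed

lemma act_inv_cancel:
  assumes T: "frame_on T" and g: "locale_map T UNIV g" and x: "locale_map T UNIV x"
    and gx: "r \<odot> g = p \<odot> x"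
  shows "\<aa> \<odot> pairing T (i \<odot> g) (\<aa> \<odot> pairing T g x) = x"
proof -
  have ig: "locale_map T UNIV (i \<odot> g)" by (rule locale_map_comp[OF g i])
  have rig: "r \<odot> (i \<odot> g) = d \<odot> g" by (rule loc_comp_eq_left[OF r_i])
  have "m \<odot> pairing T (i \<odot> g) g = (m \<odot> pairing UNIV i id) \<odot> g"
    by (simp add: loc_comp_pairing_comp[OF frame_on_UNIV i locale_map_id g])
  also have "\<dots> = u \<odot> (p \<odot> x)" by (simp add: m_i_left loc_comp_assoc gx)
  finally have "\<aa> \<odot> pairing T (m \<odot> pairing T (i \<odot> g) g) x = x"
    by (simp add: act_unit[OF x])
  then show ?thesis using act_assoc[OF T ig g x rig gx] by simp
qed

end

context localic_gpd
begin

lemma self_action: "localic_action G d m"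
  by unfold_locales (rule left_glocale_self)

lemmas mult_map = localic_action.act_map[OF self_action]
lemmas mult_unit_left = localic_action.act_unit[OF self_action]
lemmas mult_assoc = localic_action.act_assoc[OF self_action]
lemmas mult_inv_cancel = localic_action.act_inv_cancel[OF self_action]

lemma mult_unit_right:
  assumes "locale_map T UNIV g"
  shows "m \<odot> pairing T g (u \<odot> (r \<odot> g)) = g"
  using loc_comp_pairing_comp[OF frame_on_UNIV locale_map_id locale_map_comp[OF r u] assms, of m]
  by (simp add: m_unit_right loc_comp_assoc)

lemma mult_inv_right:
  assumes "locale_map T UNIV g"
  shows "m \<odot> pairing T g (i \<odot> g) = u \<odot> (d \<odot> g)"
  using loc_comp_pairing_comp[OF frame_on_UNIV locale_map_id i assms, of m]
  by (simp add: m_i_right loc_comp_assoc)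

lemma mult_range:
  assumes "frame_on T" "locale_map T UNIV g" "locale_map T UNIV h" "r \<odot> g = d \<odot> h"
  shows "r \<odot> (m \<odot> pairing T g h) = r \<odot> h"
  by (simp add: loc_comp_eq_left[OF r_m] loc_comp_assoc PB_pairing_proj2[OF r d assms])

text \<open>In (g^-1)^-1 (g^-1 g) = g the inner product is a unit, which the right unit law
  removes.\<close>

lemma i_i: "i \<odot> i = id"
proof -
  have ii: "locale_map UNIV UNIV (i \<odot> i)" by (rule locale_map_comp[OF i i])
  have "m \<odot> pairing UNIV (i \<odot> i) (m \<odot> pairing UNIV i id) = id"
    by (rule mult_inv_cancel[OF frame_on_UNIV i locale_map_id]) (simp add: r_i)
  moreover have "r \<odot> (i \<odot> i) = r" by (simp add: loc_comp_eq_left[OF r_i] d_i)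
  ultimately show ?thesis using mult_unit_right[OF ii] by (simp add: m_i_left)
qed

lemma i_i_apply: "i (i a) = a"
  using i_i by (metis id_apply loc_comp_apply)

text \<open>The product of a unit with its inverse is that inverse by the left unit law, and that
  unit by the inverse law.\<close>

lemma i_u: "i \<odot> u = u"
proof -
  have iu: "locale_map UNIV UNIV (i \<odot> u)" by (rule locale_map_comp[OF u i])
  have "d \<odot> (i \<odot> u) = id" by (simp add: loc_comp_eq_left[OF d_i] r_u)
  then show ?thesis
    using mult_unit_left[OF iu] mult_inv_right[OF u] by (simp add: d_u)
qed

text \<open>With \<open>?k\<close> the product of the inverses, gh times \<open>?k\<close> is a
  unit; multiplying by the inverse of gh on the left leaves \<open>?k\<close> on one side and that
  inverse on the other.\<close>

lemma inv_mult:
  assumes T: "frame_on T" and g: "locale_map T UNIV g" and h: "locale_map T UNIV h"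
    and gh: "r \<odot> g = d \<odot> h"
  shows "i \<odot> (m \<odot> pairing T g h) = m \<odot> pairing T (i \<odot> h) (i \<odot> g)"
proof -
  let ?gh = "m \<odot> pairing T g h" and ?k = "m \<odot> pairing T (i \<odot> h) (i \<odot> g)"
  have ig: "locale_map T UNIV (i \<odot> g)" and ih: "locale_map T UNIV (i \<odot> h)"
    using locale_map_comp g h i by blast+
  have dig: "d \<odot> (i \<odot> g) = r \<odot> g" and rih: "r \<odot> (i \<odot> h) = d \<odot> h"
    and dih: "d \<odot> (i \<odot> h) = r \<odot> h" and rig: "r \<odot> (i \<odot> g) = d \<odot> g"
    by (simp_all add: loc_comp_eq_left[OF d_i] loc_comp_eq_left[OF r_i])
  have ihig: "r \<odot> (i \<odot> h) = d \<odot> (i \<odot> g)" by (simp add: dig rih gh)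
  note ghm = mult_map[OF T g h gh]
  have k: "locale_map T UNIV ?k" "d \<odot> ?k = r \<odot> h"
    using mult_map[OF T ih ig ihig] by (simp_all add: dih)
  have rgh: "r \<odot> ?gh = r \<odot> h" by (rule mult_range[OF T g h gh])
  have "m \<odot> pairing T ?gh ?k = m \<odot> pairing T g (m \<odot> pairing T h ?k)"
    by (rule mult_assoc[OF T g h k(1) gh]) (simp add: k)
  also have "m \<odot> pairing T h ?k = i \<odot> g"
  proof -
    have iih: "i \<odot> (i \<odot> h) = h" by (simp add: loc_comp_assoc[symmetric] i_i)
    show ?thesis using mult_inv_cancel[OF T ih ig ihig] by (simp only: iih)
  qed
  also have "m \<odot> pairing T g (i \<odot> g) = u \<odot> (d \<odot> g)" by (rule mult_inv_right[OF g])
  finally have 1: "m \<odot> pairing T ?gh ?k = u \<odot> (d \<odot> g)" .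
  have igh: "locale_map T UNIV (i \<odot> ?gh)" by (rule locale_map_comp[OF ghm(1) i])
  have "?k = m \<odot> pairing T (i \<odot> ?gh) (m \<odot> pairing T ?gh ?k)"
    by (rule mult_inv_cancel[OF T ghm(1) k(1), symmetric]) (simp add: rgh k)
  also have "\<dots> = m \<odot> pairing T (i \<odot> ?gh) (u \<odot> (r \<odot> (i \<odot> ?gh)))"
    by (simp add: 1 loc_comp_eq_left[OF r_i] ghm(2))
  also have "\<dots> = i \<odot> ?gh" by (rule mult_unit_right[OF igh])
  finally show ?thesis by simp
qed

end

subsection \<open>Structure maps of an etale groupoid\<close>

locale etale_gpd = localic_gpd +
  assumes d_etale: "local_homeomorphism d"
begin

abbreviation "e \<equiv> qunit G"

lemma d_open: "open_map d" by (rule local_homeomorphism_open[OF d_etale])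

lemma i_le_iff: "i a \<le> b \<longleftrightarrow> a \<le> i b"
  using frame_hom_mono[OF i] i_i_apply by metis

lemma i_open: "open_map i" "direct_image i = i"
proof (atomize (full), intro conjI)
  note 1 = open_mapI[OF i, of i]
  show "open_map i" "direct_image i = i"
    by (rule 1; simp add: i_le_iff frame_hom_inf[OF i] i_i_apply)+
qed

lemma qstar_eq: "qstar G = i"
  by (rule ext) (simp add: qstar_def i_open)

lemma r_eq: "r c = i (d c)"
  using d_i by (metis loc_comp_apply)

lemma r_open: "open_map r" and direct_image_r: "direct_image r = (\<lambda>a. direct_image d (i a))"
proof -
  note 1 = open_mapI[OF r, of "\<lambda>a. direct_image d (i a)"]
  show "open_map r" "direct_image r = (\<lambda>a. direct_image d (i a))"
    by (rule 1; simp add: r_eq direct_image_le_iff[OF d_open] i_le_iff frame_hom_inf[OF i]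
        direct_image_frobenius[OF d_open] i_i_apply)+
qed

lemma direct_image_d_i: "direct_image d (i a) = direct_image r a"
  by (simp add: direct_image_r)

lemma section_of_r_iff: "section_of r s \<longleftrightarrow> section_of d (i s)"
proof
  assume s: "section_of r s"
  show "section_of d (i s)"
    unfolding section_of_def
  proof (intro allI impI)
    fix x assume "x \<le> i s"
    then have "inf (r (direct_image r (i x))) s = i x"
      by (intro section_ofD[OF s]) (simp add: i_le_iff)
    then have "i (inf (r (direct_image r (i x))) s) = i (i x)" by simp
    then show "inf (d (direct_image d x)) (i s) = x"
      by (simp add: frame_hom_inf[OF i] r_eq direct_image_r i_i_apply)
  qed
next
  assume s: "section_of d (i s)"
  show "section_of r s"
    unfolding section_of_def
  proof (intro allI impI)
    fix x assume "x \<le> s"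
    then have "inf (d (direct_image d (i x))) (i s) = i x"
      by (intro section_ofD[OF s]) (simp add: i_le_iff i_i_apply)
    then have "i (inf (d (direct_image d (i x))) (i s)) = i (i x)" by simp
    then show "inf (r (direct_image r x)) s = x"
      by (simp add: frame_hom_inf[OF i] r_eq direct_image_r i_i_apply)
  qed
qed

lemma u_d: "u (d c) = c" and u_r: "u (r c) = c"
  using d_u r_u by (metis id_apply loc_comp_apply)+

lemma i_u_apply: "u (i a) = u a"
  using i_u by (metis loc_comp_apply)

text \<open>The map \<open>u\<close> is a section of the local homeomorphism \<open>d\<close>. On a
  sheet \<open>s\<close> of \<open>d\<close>, the units over \<open>c\<close> that lie in
  \<open>s\<close> form the part of \<open>s\<close> over \<open>inf c (u s)\<close>;
  \<open>g c\<close> joins these parts over all sheets.\<close>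

lemma u_open: "open_map u"
proof -
  let ?B = "Collect (section_of d)"
  define g where "g c = Sup {inf s (d (inf c (u s))) |s. section_of d s}" for c
  \<comment> \<open>Since \<open>u (d c) = c\<close>, restricting \<open>?x\<close> along
    \<open>u\<close> gives something below its image along \<open>d\<close>; on the sheet
    \<open>s\<close>, the part over that image is \<open>?x\<close> itself.\<close>
  have counit: "inf s (d (inf (u b) (u s))) \<le> b" if s: "section_of d s" for s b
  proof -
    let ?x = "inf b s"
    have "u ?x \<le> direct_image d ?x"
      using frame_hom_mono[OF u direct_image_unit[OF d_open, of ?x]] by (simp add: u_d)
    then have "inf s (d (u ?x)) \<le> inf s (d (direct_image d ?x))"
      using frame_hom_mono[OF d] by (intro inf_mono) auto
    also have "\<dots> = ?x" using section_ofD[OF s, of ?x] by (simp add: inf.commute)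
    finally show ?thesis by (simp add: frame_hom_inf[OF u])
  qed
  have top: "Sup ?B = top"
    using local_homeomorphism_join_dense[OF d_etale] unfolding join_dense_def
    by (metis (mono_tags, lifting) Sup_subset_mono mem_Collect_eq subsetI top_unique)
  have unit: "c \<le> u (g c)" for c
  proof -
    have "c = inf c (u (Sup ?B))" by (simp add: top frame_hom_top[OF u])
    also have "\<dots> = Sup (inf c ` u ` ?B)" by (simp add: frame_hom_Sup[OF u] inf_Sup_distrib)
    also have "\<dots> \<le> u (g c)"
    proof (rule Sup_least, clarsimp)
      fix s assume "section_of d s"
      then have "u (inf s (d (inf c (u s)))) \<le> u (g c)"
        unfolding g_def by (intro frame_hom_mono[OF u] Sup_upper) auto
      then show "inf c (u s) \<le> u (g c)"
        by (simp add: frame_hom_inf[OF u] u_d inf.left_commute[of "u s"])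
    qed
    finally show ?thesis .
  qed
  have adj: "g c \<le> b \<longleftrightarrow> c \<le> u b" for c b
  proof
    assume "g c \<le> b"
    then show "c \<le> u b" using unit frame_hom_mono[OF u] order.trans by blast
  next
    assume c: "c \<le> u b"
    show "g c \<le> b"
      unfolding g_def
    proof (rule Sup_least, clarsimp)
      fix s assume s: "section_of d s"
      have "inf s (d (inf c (u s))) \<le> inf s (d (inf (u b) (u s)))"
        using c by (intro inf_mono frame_hom_mono[OF d]) auto
      then show "inf s (d (inf c (u s))) \<le> b" using counit[OF s] order.trans by blast
    qed
  qed
  have "inf (g c) b \<le> g (inf c (u b))" for c b
  proof -
    have "inf b (g c) = Sup (inf b ` {inf s (d (inf c (u s))) |s. section_of d s})"
      unfolding g_def by (rule inf_Sup_distrib)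
    also have "\<dots> \<le> g (inf c (u b))"
    proof (rule Sup_least, clarsimp)
      fix s assume s: "section_of d s"
      let ?x = "inf b (inf s (d (inf c (u s))))"
      have xs: "?x \<le> s" by (simp add: inf.coboundedI2)
      have "?x \<le> d (inf c (u s))" by (simp add: inf.coboundedI2)
      then have "direct_image d ?x \<le> inf c (u s)" by (simp only: direct_image_le_iff[OF d_open])
      then have dx: "direct_image d ?x \<le> u s" by simp
      have "u (inf (d (direct_image d ?x)) s) = u ?x" using section_ofD[OF s xs] by simp
      \<comment> \<open>On the part of a sheet lying over its own units, image along
        \<open>d\<close> and restriction along \<open>u\<close> agree.\<close>
      then have ux: "direct_image d ?x = u ?x"
        using dx by (simp only: frame_hom_inf[OF u] u_d inf_absorb1)
      have "?x \<le> d (u ?x)" using direct_image_unit[OF d_open, of ?x] by (simp add: ux)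
      also have "\<dots> \<le> d (u b)" by (intro frame_hom_mono[OF d] frame_hom_mono[OF u]) simp
      finally have "?x \<le> inf s (d (inf (inf c (u b)) (u s)))"
        using xs by (simp add: frame_hom_inf[OF d] inf.coboundedI2)
      also have "\<dots> \<le> g (inf c (u b))" unfolding g_def using s by (intro Sup_upper) auto
      finally show "?x \<le> g (inf c (u b))" .
    qed
    finally show ?thesis by (simp add: inf.commute)
  qed
  then show ?thesis by (rule open_mapI(1)[OF u adj])
qed

text \<open>Frobenius reciprocity for \<open>u\<close>, applied to
  \<open>c = u (d c) = u (r c)\<close>: an open of the base becomes the part of \<open>e\<close>
  over it.\<close>

lemma direct_image_u: "direct_image u c = inf e (d c)" "direct_image u c = inf e (r c)"
  using direct_image_frobenius[OF u_open, of top "d c"] direct_image_frobenius[OF u_open, of top "r c"]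
  by (simp_all add: qunit_def u_d u_r)

lemma direct_image_u_u: "direct_image u (u a) = inf e a"
  using direct_image_frobenius[OF u_open, of top a] by (simp add: qunit_def)

lemma unit_le_iff: "e \<le> a \<longleftrightarrow> u a = top"
  by (simp add: qunit_def direct_image_le_iff[OF u_open] top_unique)

lemma u_direct_image_u: "u (direct_image u c) = c"
proof -
  have "u e = top" using unit_le_iff by blast
  then show ?thesis by (simp add: direct_image_u frame_hom_inf[OF u] u_d)
qed

lemma direct_image_u_le_iff: "direct_image u a \<le> direct_image u b \<longleftrightarrow> a \<le> b"
  by (simp add: direct_image_le_iff[OF u_open] u_direct_image_u)

lemma i_direct_image_u: "i (direct_image u c) = direct_image u c"
proof -
  have "i e = e"
  proof (rule order.antisym)
    show "e \<le> i e" "i e \<le> e" by (auto simp: i_le_iff unit_le_iff i_u_apply) (auto simp: unit_le_iff[symmetric])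
  qed
  then show ?thesis
    using direct_image_u by (metis frame_hom_inf[OF i] i_i_apply r_eq)
qed

end

subsection \<open>The module of a sheaf\<close>

locale gsheaf = localic_action + etale_gpd +
  assumes p_etale: "local_homeomorphism p"
begin

lemma p_open: "open_map p" by (rule local_homeomorphism_open[OF p_etale])

lemmas \<pi>2_iff = proj2_iff[OF r p r_open]
lemmas \<pi>1_iff = proj1_iff[OF r p_open]

text \<open>The involution \<open>(g, x) \<mapsto> (g\<^sup>-\<^sup>1, gx)\<close> carries the action to the second projection, so the action
  is open because \<open>r\<close> is.\<close>

definition "\<sigma> = pairing GX (i \<odot> \<pi>1) \<aa>"

lemma \<sigma>_args: "frame_on GX" "locale_map GX UNIV (i \<odot> \<pi>1)" "locale_map GX UNIV \<aa>"
  "r \<odot> (i \<odot> \<pi>1) = p \<odot> \<aa>"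
  using GX_frame locale_map_comp[OF \<pi>1 i] \<aa> by (simp_all add: loc_comp_eq_left[OF r_i] p_\<aa>)

lemma \<sigma>: "locale_map GX GX \<sigma>"
  and \<sigma>_\<pi>1: "\<sigma> (\<pi>1 a) = \<pi>1 (i a)" and \<sigma>_\<pi>2: "\<sigma> (\<pi>2 y) = \<aa> y"
  unfolding \<sigma>_def
  using PB_pairing_map[OF r p \<sigma>_args] PB_pairing_proj1[OF r p \<sigma>_args] PB_pairing_proj2[OF r p \<sigma>_args]
  by (auto simp: loc_comp_def fun_eq_iff)

lemma pairing_projections: "U \<in> GX \<Longrightarrow> pairing GX \<pi>1 \<pi>2 U = U"
  using pairing_unique[OF frame_on_UNIV frame_on_UNIV r p GX_frame \<pi>1 \<pi>2 r_\<pi>1 locale_map_id, of U]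
  by simp

lemma \<sigma>_\<aa>: "\<sigma> (\<aa> y) = \<pi>2 y"
proof -
  have 1: "pairing GX \<pi>1 \<pi>2 (\<aa> y) = \<aa> y"
    using pairing_projections locale_map_mem[OF \<aa>] by simp
  have "\<aa> \<odot> pairing GX \<pi>1 \<pi>2 = \<aa>"
    using pairing_projections locale_map_mem[OF \<aa>] by (auto simp: loc_comp_def)
  then show ?thesis
    using act_inv_cancel[OF GX_frame \<pi>1 \<pi>2 r_\<pi>1] by (metis \<sigma>_def loc_comp_apply)
qed

lemma \<sigma>_\<sigma>: assumes U: "U \<in> GX" shows "\<sigma> (\<sigma> U) = U"
proof -
  have "(\<sigma> \<odot> \<sigma>) U = pairing GX \<pi>1 \<pi>2 U"
    by (rule pairing_unique[OF frame_on_UNIV frame_on_UNIV r p GX_frame \<pi>1 \<pi>2 r_\<pi>1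
          locale_map_comp[OF \<sigma> \<sigma>] _ _ U])
      (simp_all add: loc_comp_apply \<sigma>_\<pi>1 \<sigma>_\<pi>2 \<sigma>_\<aa> i_i_apply)
  then show ?thesis by (simp add: pairing_projections[OF U] loc_comp_apply)
qed

lemma \<sigma>_mem: "U \<in> GX \<Longrightarrow> \<sigma> U \<in> GX" and \<aa>_mem: "\<aa> y \<in> GX"
  and \<pi>1_mem: "\<pi>1 a \<in> GX" and \<pi>2_mem: "\<pi>2 y \<in> GX"
  using locale_map_mem[OF \<sigma>] locale_map_mem[OF \<aa>] PB_proj1_mem[OF r p] PB_proj2_mem[OF r p] by auto

lemma \<sigma>_subset_iff: "U \<in> GX \<Longrightarrow> V \<in> GX \<Longrightarrow> \<sigma> U \<subseteq> V \<longleftrightarrow> U \<subseteq> \<sigma> V"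
  using locale_map_mono[OF \<sigma>] \<sigma>_\<sigma> \<sigma>_mem by metis

text \<open>The direct image along the action: \<sigma> is its own adjoint, and the inner term is
  the image of a rectangle under the second projection. It is built by hand because
  \<open>open_map\<close> speaks of maps between whole types, whereas \<open>GX\<close> is a carrier
  inside a larger type.\<close>

definition push :: "('b \<times> 'c) set \<Rightarrow> 'c" where
  "push U = Sup ((\<lambda>(a, x). inf x (p (direct_image r a))) ` \<sigma> U)"

lemma push_le_iff:
  assumes U: "U \<in> GX"
  shows "push U \<le> y \<longleftrightarrow> U \<subseteq> \<aa> y"
proof -
  have "push U \<le> y \<longleftrightarrow> \<sigma> U \<subseteq> \<pi>2 y"
    unfolding push_def Sup_le_iff using \<pi>2_iff by fastforce
  then show ?thesis by (simp add: \<sigma>_subset_iff[OF U \<pi>2_mem] \<sigma>_\<pi>2)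
qed

text \<open>Because \<sigma> exchanges \<open>\<aa> y\<close> with \<open>\<pi>2 y\<close>,
  Frobenius reciprocity for the action reduces to that of the second projection.\<close>

lemma push_inf:
  assumes U: "U \<in> GX"
  shows "inf (push U) y = push (U \<inter> \<aa> y)"
proof (rule order.antisym)
  have Uy: "U \<inter> \<aa> y \<in> GX" by (rule PB_inf[OF r p U \<aa>_mem])
  have "U \<subseteq> \<aa> (push U)" using push_le_iff[OF U] by blast
  then have "push (U \<inter> \<aa> y) \<le> push U" "push (U \<inter> \<aa> y) \<le> y"
    unfolding push_le_iff[OF Uy] by auto
  then show "push (U \<inter> \<aa> y) \<le> inf (push U) y" by simp
  have s: "\<sigma> (U \<inter> \<aa> y) = \<sigma> U \<inter> \<pi>2 y"
    using locale_map_inf[OF \<sigma> U \<aa>_mem[of y]] by (simp add: \<sigma>_\<aa>)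
  have "inf y (push U) = Sup (inf y ` (\<lambda>(a, x). inf x (p (direct_image r a))) ` \<sigma> U)"
    unfolding push_def by (rule inf_Sup_distrib)
  also have "\<dots> \<le> push (U \<inter> \<aa> y)"
  proof (rule Sup_least, clarsimp)
    fix a x assume "(a, x) \<in> \<sigma> U"
    then have "(a, inf x y) \<in> \<sigma> U" using PB_down[OF r p \<sigma>_mem[OF U]] by fastforce
    moreover have "(a, inf x y) \<in> \<pi>2 y" by (simp add: \<pi>2_iff inf.coboundedI1)
    ultimately have "inf (inf x y) (p (direct_image r a)) \<le> push (U \<inter> \<aa> y)"
      unfolding push_def s by (intro Sup_upper) force
    then show "inf y (inf x (p (direct_image r a))) \<le> push (U \<inter> \<aa> y)" by (simp add: ac_simps)
  qed
  finally show "inf (push U) y \<le> push (U \<inter> \<aa> y)" by (simp add: inf.commute)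
qed

abbreviation act (infixr "\<cdot>" 75) where
  "a \<cdot> x \<equiv> direct_image \<aa> (tensor UNIV UNIV r p a x)"

lemma act_eq_push: "a \<cdot> x = push (tensor UNIV UNIV r p a x)"
  by (rule direct_image_eqI) (rule push_le_iff[OF tensor_mem[OF r p]])

lemma act_le_iff: "a \<cdot> x \<le> y \<longleftrightarrow> (a, x) \<in> \<aa> y"
  unfolding act_eq_push push_le_iff[OF tensor_mem[OF r p]] by (rule tensor_subset_iff[OF r p \<aa>_mem])

lemma act_mem: "(a, x) \<in> \<aa> (a \<cdot> x)"
  using act_le_iff by blast

lemma act_mono: "a \<le> b \<Longrightarrow> x \<le> y \<Longrightarrow> a \<cdot> x \<le> b \<cdot> y"
  unfolding act_le_iff by (rule PB_down[OF r p \<aa>_mem act_mem])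

lemma act_Sup_left_le: "(\<And>a. a \<in> S \<Longrightarrow> a \<cdot> x \<le> y) \<Longrightarrow> Sup S \<cdot> x \<le> y"
  unfolding act_le_iff by (rule PB_Sup1[OF r p \<aa>_mem])

lemma act_Sup_right_le: "(\<And>x. x \<in> S \<Longrightarrow> a \<cdot> x \<le> y) \<Longrightarrow> a \<cdot> Sup S \<le> y"
  unfolding act_le_iff by (rule PB_Sup2[OF r p \<aa>_mem])

lemma act_balance: "inf a (r c) \<cdot> x = a \<cdot> inf (p c) x"
proof -
  have "inf a (r c) \<cdot> x \<le> y \<longleftrightarrow> a \<cdot> inf (p c) x \<le> y" for y
    unfolding act_le_iff by (rule PB_bal[OF r p \<aa>_mem])
  then show ?thesis by (meson order.antisym order.refl)
qed

text \<open>The result of an action lies over the domain of the arrow, that is,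
  \<open>\<aa> (p c) = \<pi>1 (d c)\<close>; \<open>push_inf\<close> then moves the restriction from
  the arrows to the result.\<close>

lemma act_frobenius: "inf a (d c) \<cdot> x = inf (a \<cdot> x) (p c)"
proof -
  have "\<aa> (p c) = \<pi>1 (d c)" using p_\<aa> by (metis loc_comp_apply)
  moreover have "tensor UNIV UNIV r p (inf a (d c)) x = tensor UNIV UNIV r p a x \<inter> \<pi>1 (d c)"
    unfolding tensor_def using locale_map_inf[OF \<pi>1, of a "d c"] by auto
  ultimately show ?thesis
    unfolding act_eq_push by (simp add: push_inf[OF tensor_mem[OF r p]])
qed

lemma act_restrict: "a \<cdot> x = a \<cdot> inf (p (direct_image r a)) x"
  using act_balance[of a "direct_image r a" x] direct_image_unit[OF r_open, of a] by (simp add: inf_absorb1)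

lemma direct_image_act_le: "direct_image p (a \<cdot> x) \<le> direct_image d a"
proof -
  have "a \<cdot> x = inf a (d (direct_image d a)) \<cdot> x"
    using direct_image_unit[OF d_open, of a] by (simp add: inf_absorb1)
  then have "a \<cdot> x \<le> p (direct_image d a)" unfolding act_frobenius by (metis inf_le2)
  then show ?thesis by (simp add: direct_image_le_iff[OF p_open])
qed

text \<open>The unit axiom writes \<open>x\<close> as the join of the pieces
  \<open>inf (p (u a)) z\<close> with \<open>(a, z) \<in> \<aa> x\<close>. Balancing moves
  \<open>u a\<close> to the left factor, where the units over \<open>u a\<close> lie in
  \<open>a\<close>.\<close>

lemma unit_act_le: "e \<cdot> x \<le> x"
proof -
  have "x = Sup ((\<lambda>(a, z). inf (p (u a)) z) ` \<aa> x)"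
    using fun_cong[OF \<aa>_unit, of x] by (simp add: loc_comp_def pairing_def join_in_UNIV)
  moreover have "(e, Sup ((\<lambda>(a, z). inf (p (u a)) z) ` \<aa> x)) \<in> \<aa> x"
  proof (rule PB_Sup2[OF r p \<aa>_mem], clarsimp)
    fix a z assume "(a, z) \<in> \<aa> x"
    moreover have "inf e (r (u a)) \<le> a"
      by (simp flip: direct_image_u add: direct_image_u_u)
    ultimately have "(inf e (r (u a)), z) \<in> \<aa> x" using PB_down[OF r p \<aa>_mem] by blast
    then show "(e, inf (p (u a)) z) \<in> \<aa> x" by (simp add: PB_bal[OF r p \<aa>_mem])
  qed
  ultimately show ?thesis unfolding act_le_iff by simp
qed

lemma unit_act: "e \<cdot> x = x"
proof (rule order.antisym[OF unit_act_le])
  let ?y = "e \<cdot> x"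
  have "?y = Sup ((\<lambda>(a, z). inf (p (u a)) z) ` \<aa> ?y)"
    using fun_cong[OF \<aa>_unit, of ?y] by (simp add: loc_comp_def pairing_def join_in_UNIV)
  moreover have "inf (p (u e)) x \<le> Sup ((\<lambda>(a, z). inf (p (u a)) z) ` \<aa> ?y)"
    using act_mem[of e x] by (intro Sup_upper) force
  moreover have "p (u e) = top"
    using unit_le_iff[of e] by (simp add: frame_hom_top[OF p])
  ultimately show "x \<le> ?y" by simp
qed

lemma direct_image_u_act: "direct_image u c \<cdot> x = inf (p c) x"
  by (simp add: direct_image_u(2) act_balance unit_act)

end

context gsheaf
begin

text \<open>Invariance makes \<open>\<aa>\<close> and \<open>\<pi>2\<close> agree on opens
  \<open>q c\<close>, so these pass through the action. Since a product has the range of its second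
  factor, the self-action is covered too, with \<open>r\<close> in the role of
  \<open>q\<close>.\<close>

lemma act_inf_invariant:
  assumes "locale_map UNIV UNIV q" and "q \<odot> \<aa> = q \<odot> \<pi>2"
  shows "a \<cdot> inf x (q c) = inf (a \<cdot> x) (q c)"
proof -
  have "\<aa> (q c) = \<pi>2 (q c)" using assms(2) by (metis loc_comp_apply)
  moreover have "tensor UNIV UNIV r p a (inf x (q c)) = tensor UNIV UNIV r p a x \<inter> \<pi>2 (q c)"
    unfolding tensor_def using locale_map_inf[OF \<pi>2, of x "q c"] by auto
  ultimately show ?thesis
    unfolding act_eq_push by (simp add: push_inf[OF tensor_mem[OF r p]])
qed

end

section \<open>The quantale of an etale groupoid: units, supports and partial units\<close>

context etale_gpd
begin

lemma self_sheaf: "gsheaf G d m"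
  using self_action d_etale etale_gpd_axioms unfolding gsheaf_def gsheaf_axioms_def by auto

lemmas qmult_le_iff = gsheaf.act_le_iff[OF self_sheaf, folded qmult_def]
  and qmult_mem = gsheaf.act_mem[OF self_sheaf, folded qmult_def]
  and qmult_mono = gsheaf.act_mono[OF self_sheaf, folded qmult_def]
  and qmult_Sup_left_le = gsheaf.act_Sup_left_le[OF self_sheaf, folded qmult_def]
  and qmult_Sup_right_le = gsheaf.act_Sup_right_le[OF self_sheaf, folded qmult_def]
  and qmult_balance = gsheaf.act_balance[OF self_sheaf, folded qmult_def]
  and direct_image_d_qmult_le = gsheaf.direct_image_act_le[OF self_sheaf, folded qmult_def]
  and direct_image_u_qmult = gsheaf.direct_image_u_act[OF self_sheaf, folded qmult_def]
  and m_mem = gsheaf.\<aa>_mem[OF self_sheaf]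
  and qmult_inf_r = gsheaf.act_inf_invariant[OF self_sheaf r r_m, folded qmult_def]

lemma direct_image_r_qmult_le: "direct_image r (qmult G a b) \<le> direct_image r b"
proof -
  have "qmult G a b = qmult G a (inf b (r (direct_image r b)))"
    using direct_image_unit[OF r_open, of b] by (simp add: inf_absorb1)
  then have "qmult G a b \<le> r (direct_image r b)" unfolding qmult_inf_r by (metis inf_le2)
  then show ?thesis by (simp add: direct_image_le_iff[OF r_open])
qed

text \<open>The self-action yields the unit law on the left; on the right the argument is repeated
  with the other unit axiom, now cutting the first factor into pieces.\<close>

lemma qmult_unit_right_le: "qmult G a e \<le> a"
proof -
  have "a = Sup ((\<lambda>(b, c). inf b (r (u c))) ` m a)"
    using fun_cong[OF m_unit_right, of a] by (simp add: loc_comp_def pairing_def join_in_UNIV)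
  moreover have "(Sup ((\<lambda>(b, c). inf b (r (u c))) ` m a), e) \<in> m a"
  proof (rule PB_Sup1[OF r d m_mem], clarsimp)
    fix b c assume "(b, c) \<in> m a"
    moreover have "inf (d (u c)) e \<le> c"
      by (simp only: inf.commute[of "d (u c)"] direct_image_u(1)[symmetric] direct_image_u_u inf_le2)
    ultimately have "(b, inf (d (u c)) e) \<in> m a" using PB_down[OF r d m_mem] by blast
    then show "(inf b (r (u c)), e) \<in> m a" by (simp add: PB_bal[OF r d m_mem])
  qed
  ultimately show ?thesis unfolding qmult_le_iff by simp
qed

text \<open>Units in \<open>qmult G v (i v)\<close> lie over the domain of \<open>v\<close>, since
  restriction along \<open>u\<close> is below the image along \<open>d\<close>. Conversely, the
  axiom that an arrow times its inverse is the unit at its domain puts each of these units into the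
  product.\<close>

lemma qsupp_eq: "qsupp G v = direct_image u (direct_image d v)"
proof (rule order.antisym)
  let ?z = "qmult G v (i v)"
  have "u ?z \<le> direct_image d ?z"
    using frame_hom_mono[OF u direct_image_unit[OF d_open, of ?z]] by (simp add: u_d)
  also have "\<dots> \<le> direct_image d v" by (rule direct_image_d_qmult_le)
  finally have "direct_image u (u ?z) \<le> direct_image u (direct_image d v)"
    by (rule direct_image_mono[OF u_open])
  then show "qsupp G v \<le> direct_image u (direct_image d v)"
    by (simp add: qsupp_def qstar_eq direct_image_u_u inf.commute)
  have "d (u ?z) = Sup ((\<lambda>(b, c). inf b (i c)) ` m ?z)"
    using fun_cong[OF m_i_right, of ?z] by (simp add: loc_comp_def pairing_def join_in_UNIV)
  also have "inf v (i (i v)) \<le> \<dots>" using qmult_mem[of v "i v"] by (intro Sup_upper) force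
  finally have "v \<le> d (u ?z)" by (simp add: i_i_apply)
  then have "direct_image u (direct_image d v) \<le> ?z"
    by (simp add: direct_image_le_iff[OF u_open] direct_image_le_iff[OF d_open])
  moreover have "direct_image u (direct_image d v) \<le> e" by (simp add: direct_image_u)
  ultimately show "direct_image u (direct_image d v) \<le> qsupp G v"
    by (simp add: qsupp_def qstar_eq)
qed

text \<open>Two arrows of \<open>v\<close> with the same range coincide, so a composable pair from
  \<open>v\<close> and \<open>i v\<close> multiplies to a unit. Without points: \<open>v\<close> is
  covered by pieces \<open>?k\<close> with \<open>(?k, i ?k) \<in> m e\<close>, and the section
  property makes \<open>i ?k\<close> the whole part of \<open>i v\<close> composable with
  \<open>?k\<close>.\<close>

lemma qmult_star_le_unit:
  assumes v: "section_of r v"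
  shows "qmult G v (i v) \<le> e"
proof -
  have "u e = top" using unit_le_iff by blast
  then have "Sup ((\<lambda>(b, c). inf b (i c)) ` m e) = top"
    using fun_cong[OF m_i_right, of e]
    by (simp add: loc_comp_def pairing_def join_in_UNIV frame_hom_top[OF d])
  then have "v = Sup (inf v ` (\<lambda>(b, c). inf b (i c)) ` m e)"
    by (simp only: inf_Sup_distrib[symmetric] inf_top_right)
  moreover have "(Sup (inf v ` (\<lambda>(b, c). inf b (i c)) ` m e), i v) \<in> m e"
  proof (rule PB_Sup1[OF r d m_mem], clarsimp)
    fix b c assume bc: "(b, c) \<in> m e"
    let ?k = "inf v (inf b (i c))"
    have "i ?k \<le> c" unfolding i_le_iff by (simp add: inf.coboundedI2)
    then have *: "(?k, i ?k) \<in> m e"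
      using PB_down[OF r d m_mem bc, of ?k] by (simp add: inf.coboundedI2)
    have "i ?k = i (inf (r (direct_image r ?k)) v)"
      by (subst section_ofD[OF v]) simp_all
    also have "\<dots> = inf (d (direct_image r ?k)) (i v)"
      by (simp only: frame_hom_inf[OF i] r_eq i_i_apply)
    finally have "i ?k = inf (d (direct_image r ?k)) (i v)" .
    then have "(?k, inf (d (direct_image r ?k)) (i v)) \<in> m e" using * by (simp only:)
    then show "(?k, i v) \<in> m e" by (rule PB_restrict2[OF r d m_mem r_open, THEN iffD2])
  qed
  ultimately show ?thesis unfolding qmult_le_iff by simp
qed

lemma partial_unit_iff: "v \<in> partial_units G \<longleftrightarrow> qmult G v (i v) \<le> e \<and> qmult G (i v) v \<le> e"
  by (simp add: partial_units_def qstar_eq)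

lemma join_dense_mono: "join_dense B \<Longrightarrow> B \<subseteq> C \<Longrightarrow> join_dense C"
  unfolding join_dense_def
proof (intro allI order.antisym Sup_least)
  fix a assume B: "\<forall>a. Sup {b \<in> B. b \<le> a} = a" and BC: "B \<subseteq> C"
  have "a = Sup {b \<in> B. b \<le> a}" using B by simp
  also have "\<dots> \<le> Sup {b \<in> C. b \<le> a}" using BC by (intro Sup_subset_mono) auto
  finally show "a \<le> Sup {b \<in> C. b \<le> a}" .
qed auto

text \<open>Opens that are sections of both \<open>d\<close> and \<open>r\<close> are partial units.
  Inversion exchanges the two kinds of sections, so both form bases, and hence so does their
  intersection.\<close>

lemma partial_units_join_dense: "join_dense (partial_units G)"
proof -
  let ?D = "Collect (section_of d)" and ?R = "Collect (section_of r)"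
  have D: "join_dense ?D" by (rule local_homeomorphism_join_dense[OF d_etale])
  have R: "join_dense ?R"
    unfolding join_dense_def
  proof (intro allI order.antisym Sup_least)
    fix a
    have "i a = Sup {s \<in> ?D. s \<le> i a}" using D by (simp add: join_dense_def)
    then have "a = Sup (i ` {s \<in> ?D. s \<le> i a})" by (metis frame_hom_Sup[OF i] i_i_apply)
    also have "\<dots> \<le> Sup {s \<in> ?R. s \<le> a}"
      by (rule Sup_subset_mono) (auto simp: section_of_r_iff i_i_apply i_le_iff)
    finally show "a \<le> Sup {s \<in> ?R. s \<le> a}" .
  qed auto
  have "?D \<inter> ?R \<subseteq> partial_units G"
    using qmult_star_le_unit qmult_star_le_unit[of "i _"]
    by (auto simp: partial_unit_iff section_of_r_iff i_i_apply)
  then show ?thesis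
    using join_dense_Int[OF D R] by (blast intro: join_dense_mono section_of_down)
qed

end

context gsheaf
begin

text \<open>
  Elements of \<open>GGX\<close> are sets of pairs \<open>(Z, x)\<close> with \<open>Z \<in> G2\<close>, so the triple \<open>a \<otimes> b \<otimes> x\<close> lies below \<open>V\<close>
  iff \<open>(a \<otimes> b, x) \<in> V\<close>. Testing the two sides of the associativity axiom on such triples gives
  the associativity of the module action.
\<close>

lemma GGX_memI:
  assumes down: "\<And>a b x a' b' x'. P a b x \<Longrightarrow> a' \<le> a \<Longrightarrow> b' \<le> b \<Longrightarrow> x' \<le> x \<Longrightarrow> P a' b' x'"
    and G2: "\<And>x. {(a, b). P a b x} \<in> G2"
    and Sup: "\<And>a b S. (\<And>x. x \<in> S \<Longrightarrow> P a b x) \<Longrightarrow> P a b (Sup S)"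
    and bal: "\<And>a b c x. P a (inf b (r c)) x \<longleftrightarrow> P a b (inf (p c) x)"
  shows "{(Z, x). Z \<in> G2 \<and> (\<forall>(a, b)\<in>Z. P a b x)} \<in> GGX" (is "?N \<in> _")
proof (rule pullbackI)
  have iff: "(Z, x) \<in> ?N \<longleftrightarrow> Z \<in> G2 \<and> Z \<subseteq> {(a, b). P a b x}" for Z x by auto
  show "?N \<subseteq> G2 \<times> UNIV" by auto
  show "(Z', x') \<in> ?N" if "(Z, x) \<in> ?N" "Z' \<in> G2" "x' \<in> UNIV" "Z' \<le> Z" "x' \<le> x" for Z x Z' x'
    using that down by blast
  show "(join_in G2 S, x) \<in> ?N" if "S \<subseteq> G2" "\<And>Z. Z \<in> S \<Longrightarrow> (Z, x) \<in> ?N" for S x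
    using that frame_on_join[OF PB_frame[OF r d]] join_in_least[OF G2[of x], of S]
    unfolding iff by blast
  show "(Z, join_in UNIV S) \<in> ?N" if "Z \<in> G2" "\<And>x. x \<in> S \<Longrightarrow> (Z, x) \<in> ?N" for Z S
    using that Sup unfolding join_in_UNIV by blast
  fix Z and x :: 'c and c assume Z: "Z \<in> G2"
  have mem: "inf Z ((r \<odot> \<gamma>2) c) \<in> G2"
    using PB_inf[OF r d Z PB_proj2_mem[OF r d]] by (simp add: loc_comp_apply)
  have 1: "Z \<inter> \<gamma>2 (r c) \<subseteq> {(a, b). P a b x}" if P: "Z \<subseteq> {(a, b). P a b (inf (p c) x)}"
  proof clarify
    fix a b assume ab: "(a, b) \<in> Z" "(a, b) \<in> \<gamma>2 (r c)"
    \<comment> \<open>Membership in \<open>\<gamma>2 (r c)\<close> bounds only the part of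
      \<open>b\<close> composable with \<open>a\<close>, but by \<open>PB_restrict2\<close> the
      predicate \<open>P\<close> depends on no more than that part.\<close>
    have "inf b (d (direct_image r a)) \<le> r c" using ab(2) by (simp add: proj2_iff[OF r d r_open])
    then have le: "inf (d (direct_image r a)) b \<le> inf b (r c)" by (simp add: inf.commute)
    have "P a (inf b (r c)) x" using P ab(1) bal by auto
    then have "P a (inf (d (direct_image r a)) b) x" using le by (rule down[OF _ order.refl _ order.refl])
    then show "P a b x" using PB_restrict2[OF r d G2[of x] r_open, of a b] by simp
  qed
  have 2: "Z \<subseteq> {(a, b). P a b (inf (p c) x)}" if P: "Z \<inter> \<gamma>2 (r c) \<subseteq> {(a, b). P a b x}"
  proof clarify
    fix a b assume ab: "(a, b) \<in> Z"
    have "(a, inf b (r c)) \<in> Z" using PB_down[OF r d Z ab] by simp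
    moreover have "(a, inf b (r c)) \<in> \<gamma>2 (r c)" by (simp add: proj2_iff[OF r d r_open] inf.coboundedI1)
    ultimately show "P a b (inf (p c) x)" using P bal by auto
  qed
  show "(inf Z ((r \<odot> \<gamma>2) c), x) \<in> ?N \<longleftrightarrow> (Z, inf (p c) x) \<in> ?N"
    unfolding iff loc_comp_apply using 1 2 Z mem[unfolded loc_comp_apply] by blast
qed

lemma qmult_act_mem: "{(a, b). (qmult G a b, x) \<in> W} \<in> G2" if W: "W \<in> GX"
proof (rule PB_I[OF r d]; clarsimp)
  show "(qmult G a' b', x) \<in> W" if "(qmult G a b, x) \<in> W" "a' \<le> a" "b' \<le> b" for a b a' b'
    using PB_down[OF r p W that(1) qmult_mono] that by blast
  show "(qmult G (Sup S) b, x) \<in> W" if "\<And>a. a \<in> S \<Longrightarrow> (qmult G a b, x) \<in> W" for S b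
  proof -
    have "(Sup ((\<lambda>a. qmult G a b) ` S), x) \<in> W" using that by (auto intro: PB_Sup1[OF r p W])
    moreover have "qmult G (Sup S) b \<le> Sup ((\<lambda>a. qmult G a b) ` S)"
      by (intro qmult_Sup_left_le Sup_upper imageI)
    ultimately show ?thesis using PB_down[OF r p W] by blast
  qed
  show "(qmult G a (Sup S), x) \<in> W" if "\<And>b. b \<in> S \<Longrightarrow> (qmult G a b, x) \<in> W" for S a
  proof -
    have "(Sup (qmult G a ` S), x) \<in> W" using that by (auto intro: PB_Sup1[OF r p W])
    moreover have "qmult G a (Sup S) \<le> Sup (qmult G a ` S)"
      by (intro qmult_Sup_right_le Sup_upper imageI)
    ultimately show ?thesis using PB_down[OF r p W] by blast
  qed
qed (simp add: qmult_balance)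

lemma act_act_mem: "{(a, b). (a, b \<cdot> x) \<in> W} \<in> G2" if W: "W \<in> GX"
proof (rule PB_I[OF r d]; clarsimp)
  show "(a', b' \<cdot> x) \<in> W" if "(a, b \<cdot> x) \<in> W" "a' \<le> a" "b' \<le> b" for a b a' b'
    using PB_down[OF r p W that(1)] that act_mono by blast
  show "(Sup S, b \<cdot> x) \<in> W" if "\<And>a. a \<in> S \<Longrightarrow> (a, b \<cdot> x) \<in> W" for S b
    using that by (rule PB_Sup1[OF r p W])
  show "(a, Sup S \<cdot> x) \<in> W" if "\<And>b. b \<in> S \<Longrightarrow> (a, b \<cdot> x) \<in> W" for S a
  proof -
    have "(a, Sup ((\<lambda>b. b \<cdot> x) ` S)) \<in> W" using that by (auto intro: PB_Sup2[OF r p W])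
    moreover have "Sup S \<cdot> x \<le> Sup ((\<lambda>b. b \<cdot> x) ` S)"
      by (intro act_Sup_left_le Sup_upper imageI)
    ultimately show ?thesis using PB_down[OF r p W] by blast
  qed
  show "(inf a (r c), b \<cdot> x) \<in> W \<longleftrightarrow> (a, inf (d c) b \<cdot> x) \<in> W" for a b c
    by (simp add: PB_bal[OF r p W] inf.commute[of "d c"] act_frobenius inf.commute[of _ "p c"])
qed

lemma \<rho>1_memI:
  assumes "Z \<in> G2" "Z' \<in> G2" "Z' \<subseteq> Z"
  shows "(Z', x) \<in> \<rho>1 Z"
proof (rule pullback_down[OF proj1_mem[OF GGX_args assms(1)]])
  show "(Z, x) \<in> \<rho>1 Z" by (rule proj1_gen[OF GGX_args]) simp
qed (use assms in auto)

text \<open>The generators of the defining join all land in the saturated set \<open>?N\<close>;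
  conversely the generator on \<open>qmult G a b\<close> and \<open>x\<close> already contains the
  triple.\<close>

lemma assoc_left_iff:
  assumes W: "W \<in> GX"
  shows "(tensor UNIV UNIV r d a b, x) \<in> pairing GGX (m \<odot> \<rho>1) \<rho>2 W \<longleftrightarrow> (qmult G a b, x) \<in> W"
proof
  let ?N = "{(Z, x). Z \<in> G2 \<and> (\<forall>(a, b)\<in>Z. (qmult G a b, x) \<in> W)}"
  have N: "?N \<in> GGX"
  proof (rule GGX_memI)
    show "{(a, b). (qmult G a b, x) \<in> W} \<in> G2" for x by (rule qmult_act_mem[OF W])
    show "(qmult G a' b', x') \<in> W" if "(qmult G a b, x) \<in> W" "a' \<le> a" "b' \<le> b" "x' \<le> x"
      for a b x a' b' x'
      using PB_down[OF r p W that(1) qmult_mono] that by blast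
    show "(qmult G a b, Sup S) \<in> W" if "\<And>x. x \<in> S \<Longrightarrow> (qmult G a b, x) \<in> W" for a b S
      using that by (rule PB_Sup2[OF r p W])
    show "(qmult G a (inf b (r c)), x) \<in> W \<longleftrightarrow> (qmult G a b, inf (p c) x) \<in> W" for a b c x
      by (simp add: qmult_inf_r PB_bal[OF r p W])
  qed
  have "pairing GGX (m \<odot> \<rho>1) \<rho>2 W \<subseteq> ?N"
    unfolding pairing_def
  proof (rule join_in_least[OF N])
    fix V assume "V \<in> (\<lambda>(c, x). inf ((m \<odot> \<rho>1) c) (\<rho>2 x)) ` W"
    then obtain c x where cx: "(c, x) \<in> W" and V: "V = inf ((m \<odot> \<rho>1) c) (\<rho>2 x)" by auto
    have "tensor G2 UNIV (r \<odot> \<gamma>2) p (m c) x \<subseteq> ?N"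
    proof -
      have "(m c, x) \<in> ?N"
        using cx m_mem PB_down[OF r p W] by (auto simp flip: qmult_le_iff)
      then show ?thesis using tensor_eq[OF GGX_args m_mem, of x c] N by auto
    qed
    then show "V \<le> ?N" by (simp only: V tensor_def loc_comp_apply)
  qed
  then show "(qmult G a b, x) \<in> W" if "(tensor UNIV UNIV r d a b, x) \<in> pairing GGX (m \<odot> \<rho>1) \<rho>2 W"
    using that tensor_gen[OF r d, of a b] by blast
  assume *: "(qmult G a b, x) \<in> W"
  let ?t = "tensor UNIV UNIV r d a b" and ?c = "qmult G a b"
  have t: "?t \<in> G2" by (rule tensor_mem[OF r d])
  have "?t \<subseteq> m ?c" unfolding tensor_subset_iff[OF r d m_mem] by (rule qmult_mem)
  then have "(?t, x) \<in> \<rho>1 (m ?c)"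
    by (rule \<rho>1_memI[OF m_mem t])
  moreover have "(?t, x) \<in> \<rho>2 x" using proj2_gen[OF GGX_args t] .
  moreover have "inf ((m \<odot> \<rho>1) ?c) (\<rho>2 x) \<le> pairing GGX (m \<odot> \<rho>1) \<rho>2 W"
    unfolding pairing_def using * by (intro join_in_upper) force
  ultimately show "(?t, x) \<in> pairing GGX (m \<odot> \<rho>1) \<rho>2 W" by (auto simp: loc_comp_apply)
qed

lemma assoc_right_iff:
  assumes W: "W \<in> GX"
  shows "(tensor UNIV UNIV r d a b, x) \<in> pairing GGX (\<gamma>1 \<odot> \<rho>1) (\<aa> \<odot> pairing GGX (\<gamma>2 \<odot> \<rho>1) \<rho>2) W
    \<longleftrightarrow> (a, b \<cdot> x) \<in> W"
    (is "_ \<in> ?R W \<longleftrightarrow> _")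
proof
  let ?N = "{(Z, x). Z \<in> G2 \<and> (\<forall>(a, b)\<in>Z. (a, b \<cdot> x) \<in> W)}"
  let ?I = "pairing GGX (\<gamma>2 \<odot> \<rho>1) \<rho>2"
  have \<gamma>: "\<gamma>1 a \<in> G2" "\<gamma>2 b \<in> G2" for a b by (rule PB_proj1_mem[OF r d] PB_proj2_mem[OF r d])+
  have N: "?N \<in> GGX"
  proof (rule GGX_memI)
    show "{(a, b). (a, b \<cdot> x) \<in> W} \<in> G2" for x by (rule act_act_mem[OF W])
    show "(a', b' \<cdot> x') \<in> W" if "(a, b \<cdot> x) \<in> W" "a' \<le> a" "b' \<le> b" "x' \<le> x"
      for a b x a' b' x'
      using PB_down[OF r p W that(1)] that act_mono by blast
    show "(a, b \<cdot> Sup S) \<in> W" if "\<And>x. x \<in> S \<Longrightarrow> (a, b \<cdot> x) \<in> W" for a b S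
    proof -
      have "(a, Sup ((\<lambda>x. b \<cdot> x) ` S)) \<in> W" using that by (auto intro: PB_Sup2[OF r p W])
      moreover have "b \<cdot> Sup S \<le> Sup ((\<lambda>x. b \<cdot> x) ` S)"
        by (intro act_Sup_right_le Sup_upper imageI)
      ultimately show ?thesis using PB_down[OF r p W] by blast
    qed
    show "(a, inf b (r c) \<cdot> x) \<in> W \<longleftrightarrow> (a, b \<cdot> inf (p c) x) \<in> W" for a b c x
      by (simp add: act_balance)
  qed
  have gen: "inf ((\<gamma>1 \<odot> \<rho>1) a) (inf ((\<gamma>2 \<odot> \<rho>1) b) (\<rho>2 x)) \<subseteq> ?N" if "(a, b \<cdot> x) \<in> W" for a b x
  proof -
    have t: "tensor UNIV UNIV r d a b \<in> G2" by (rule tensor_mem[OF r d])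
    have "tensor UNIV UNIV r d a b \<subseteq> {(a, b). (a, b \<cdot> x) \<in> W}"
      unfolding tensor_subset_iff[OF r d act_act_mem[OF W]] using that by simp
    then have "(tensor UNIV UNIV r d a b, x) \<in> ?N" using t by auto
    then have "tensor G2 UNIV (r \<odot> \<gamma>2) p (tensor UNIV UNIV r d a b) x \<subseteq> ?N"
      using tensor_eq[OF GGX_args t, of x] N by auto
    moreover have "\<rho>1 (tensor UNIV UNIV r d a b) = inf (\<rho>1 (\<gamma>1 a)) (\<rho>1 (\<gamma>2 b))"
      using locale_map_inf[OF \<rho>1 \<gamma>, of a b] by (simp add: tensor_def)
    ultimately show ?thesis by (auto simp: tensor_def[of G2] loc_comp_apply)
  qed
  have "?R W \<subseteq> ?N"
    unfolding pairing_def[of GGX "\<gamma>1 \<odot> \<rho>1"]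
  proof (rule join_in_least[OF N])
    fix V assume "V \<in> (\<lambda>(a, y). inf ((\<gamma>1 \<odot> \<rho>1) a) ((\<aa> \<odot> ?I) y)) ` W"
    then obtain a y where ay: "(a, y) \<in> W" and V: "V = inf ((\<gamma>1 \<odot> \<rho>1) a) ((\<aa> \<odot> ?I) y)" by auto
    have "(\<gamma>1 \<odot> \<rho>1) a \<in> GGX" using locale_map_mem[OF \<rho>_maps(2)] by simp
    then have "inf ((\<gamma>1 \<odot> \<rho>1) a) (?I (\<aa> y)) =
      join_in GGX (inf ((\<gamma>1 \<odot> \<rho>1) a) ` (\<lambda>(b, x). inf ((\<gamma>2 \<odot> \<rho>1) b) (\<rho>2 x)) ` \<aa> y)"
      unfolding pairing_def
      by (rule frame_on_distrib[OF GGX_frame])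
        (auto intro!: frame_on_inf[OF GGX_frame] simp del: inf_set_def
          simp: locale_map_mem[OF \<rho>_maps(3)] locale_map_mem[OF \<rho>2])
    also have "\<dots> \<subseteq> ?N"
    proof (rule join_in_least[OF N])
      fix V assume "V \<in> inf ((\<gamma>1 \<odot> \<rho>1) a) ` (\<lambda>(b, x). inf ((\<gamma>2 \<odot> \<rho>1) b) (\<rho>2 x)) ` \<aa> y"
      then obtain b x where bx: "(b, x) \<in> \<aa> y"
        and V: "V = inf ((\<gamma>1 \<odot> \<rho>1) a) (inf ((\<gamma>2 \<odot> \<rho>1) b) (\<rho>2 x))" by auto
      have "(a, b \<cdot> x) \<in> W" using PB_down[OF r p W ay] bx by (simp add: act_le_iff)
      then show "V \<le> ?N" unfolding V by (rule gen)
    qed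
    finally show "V \<le> ?N" by (simp only: V loc_comp_apply[of \<aa>])
  qed
  then show "(a, b \<cdot> x) \<in> W" if "(tensor UNIV UNIV r d a b, x) \<in> ?R W"
    using that tensor_gen[OF r d, of a b] by blast
  assume *: "(a, b \<cdot> x) \<in> W"
  let ?t = "tensor UNIV UNIV r d a b"
  have t: "?t \<in> G2" by (rule tensor_mem[OF r d])
  have "?t \<subseteq> \<gamma>1 a" "?t \<subseteq> \<gamma>2 b" by (auto simp: tensor_def)
  then have 1: "(?t, x) \<in> \<rho>1 (\<gamma>1 a)" "(?t, x) \<in> \<rho>1 (\<gamma>2 b)"
    by (simp_all add: \<rho>1_memI[OF \<gamma>(1) t] \<rho>1_memI[OF \<gamma>(2) t])
  have "(?t, x) \<in> \<rho>2 x" using proj2_gen[OF GGX_args t] .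
  moreover have "inf ((\<gamma>2 \<odot> \<rho>1) b) (\<rho>2 x) \<le> ?I (\<aa> (b \<cdot> x))"
    unfolding pairing_def using act_mem[of b x] by (intro join_in_upper) force
  ultimately have "(?t, x) \<in> ?I (\<aa> (b \<cdot> x))" using 1 by (auto simp: loc_comp_apply)
  moreover have "inf ((\<gamma>1 \<odot> \<rho>1) a) ((\<aa> \<odot> ?I) (b \<cdot> x)) \<le> ?R W"
    unfolding pairing_def[of GGX "\<gamma>1 \<odot> \<rho>1"] using * by (intro join_in_upper) force
  ultimately show "(?t, x) \<in> ?R W" using 1 by (auto simp: loc_comp_apply)
qed

lemma act_qmult: "qmult G a b \<cdot> x = a \<cdot> b \<cdot> x"
proof -
  have "qmult G a b \<cdot> x \<le> y \<longleftrightarrow> a \<cdot> b \<cdot> x \<le> y" for y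
    unfolding act_le_iff
    using fun_cong[OF \<aa>_assoc, of y] assoc_left_iff[OF \<aa>_mem] assoc_right_iff[OF \<aa>_mem]
    by (metis loc_comp_apply)
  then show ?thesis by (meson order.antisym order.refl)
qed

end

lemmas (in etale_gpd) qmult_assoc = gsheaf.act_qmult[OF self_sheaf, folded qmult_def]

subsection \<open>The inner product\<close>

context gsheaf
begin

text \<open>Pointwise, \<open>ip x y\<close> consists of the arrows that carry some point of \<open>y\<close> to a point of \<open>x\<close>: it is
  the direct image of \<open>\<aa>\<^sup>*x \<and> \<pi>\<^sub>2\<^sup>*y\<close> along \<open>\<pi>\<^sub>1\<close>.\<close>

definition ip :: "'c \<Rightarrow> 'c \<Rightarrow> 'b" where
  "ip x y = Sup ((\<lambda>(a, z). inf a (r (direct_image p z))) ` (\<aa> x \<inter> \<pi>2 y))"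

lemma ip_le_iff: "ip x y \<le> c \<longleftrightarrow> \<aa> x \<inter> \<pi>2 y \<subseteq> \<pi>1 c"
proof -
  have "ip x y \<le> c \<longleftrightarrow> (\<forall>(a, z) \<in> \<aa> x \<inter> \<pi>2 y. inf a (r (direct_image p z)) \<le> c)"
    unfolding ip_def Sup_le_iff ball_simps(9) split_beta ..
  also have "\<dots> \<longleftrightarrow> \<aa> x \<inter> \<pi>2 y \<subseteq> \<pi>1 c"
    unfolding \<pi>1_iff[symmetric] by auto
  finally show ?thesis .
qed

lemma ip_mono: "x \<le> x' \<Longrightarrow> y \<le> y' \<Longrightarrow> ip x y \<le> ip x' y'"
  using locale_map_mono[OF \<aa>, of x x'] locale_map_mono[OF \<pi>2, of y y'] ip_le_iff[of x' y' "ip x' y'"]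
  unfolding ip_le_iff[of x y] by blast

text \<open>Both inverse images preserve joins, meets distribute over them in \<open>GX\<close>, and
  the direct image along \<open>\<pi>1\<close> is a left adjoint.\<close>

lemma sup_bimorphism_ip: "sup_bimorphism ip"
  unfolding sup_bimorphism_def
proof (intro conjI allI order.antisym)
  fix S and x y :: 'c
  have sub: "\<aa> ` S \<subseteq> GX" "\<pi>2 ` S \<subseteq> GX" using \<aa>_mem \<pi>2_mem by auto
  show "ip (Sup S) y \<le> (SUP x\<in>S. ip x y)"
  proof -
    have "\<pi>2 y \<inter> \<aa> (Sup S) = join_in GX (inf (\<pi>2 y) ` \<aa> ` S)"
      using frame_on_distrib[OF GX_frame \<pi>2_mem[of y] sub(1)] locale_map_join[OF \<aa>, of S]
      by (simp add: join_in_UNIV)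
    also have "\<dots> \<subseteq> \<pi>1 (SUP x\<in>S. ip x y)"
    proof (rule join_in_least[OF \<pi>1_mem])
      fix V assume "V \<in> inf (\<pi>2 y) ` \<aa> ` S"
      then obtain x where x: "x \<in> S" and V: "V = \<pi>2 y \<inter> \<aa> x" by auto
      from x have "ip x y \<le> (SUP x\<in>S. ip x y)" by (rule SUP_upper)
      then show "V \<le> \<pi>1 (SUP x\<in>S. ip x y)" unfolding ip_le_iff V by blast
    qed
    finally show ?thesis unfolding ip_le_iff by blast
  qed
  show "(SUP x\<in>S. ip x y) \<le> ip (Sup S) y"
    by (intro SUP_least ip_mono Sup_upper order.refl)
  show "ip x (Sup S) \<le> (SUP y\<in>S. ip x y)"
  proof -
    have "\<aa> x \<inter> \<pi>2 (Sup S) = join_in GX (inf (\<aa> x) ` \<pi>2 ` S)"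
      using frame_on_distrib[OF GX_frame \<aa>_mem[of x] sub(2)] locale_map_join[OF \<pi>2, of S]
      by (simp add: join_in_UNIV)
    also have "\<dots> \<subseteq> \<pi>1 (SUP y\<in>S. ip x y)"
    proof (rule join_in_least[OF \<pi>1_mem])
      fix V assume "V \<in> inf (\<aa> x) ` \<pi>2 ` S"
      then obtain y where y: "y \<in> S" and V: "V = \<aa> x \<inter> \<pi>2 y" by auto
      from y have "ip x y \<le> (SUP y\<in>S. ip x y)" by (rule SUP_upper)
      then show "V \<le> \<pi>1 (SUP y\<in>S. ip x y)" unfolding ip_le_iff V by blast
    qed
    finally show ?thesis unfolding ip_le_iff .
  qed
  show "(SUP y\<in>S. ip x y) \<le> ip x (Sup S)"
    by (intro SUP_least ip_mono Sup_upper order.refl)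
qed

lemma ip_le_d: "ip x y \<le> d (direct_image p x)"
proof -
  have "\<aa> x \<subseteq> \<aa> (p (direct_image p x))"
    using locale_map_mono[OF \<aa>, of x] direct_image_unit[OF p_open, of x] by simp
  also have "\<aa> (p (direct_image p x)) = \<pi>1 (d (direct_image p x))"
    using p_\<aa> by (metis loc_comp_apply)
  finally show ?thesis unfolding ip_le_iff by blast
qed

text \<open>Over a section \<open>t\<close> an arrow determines the point of \<open>t\<close> that
  it moves, so "carries some point of \<open>t\<close> into \<open>x\<close>" becomes "has such a
  point, and carries it into \<open>x\<close>". This links the inner product to the module
  action.\<close>

lemma le_ip_iff:
  assumes t: "section_of p t"
  shows "a \<le> ip x t \<longleftrightarrow> direct_image r a \<le> direct_image p t \<and> a \<cdot> t \<le> x"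
proof (intro iffI conjI)
  assume a: "a \<le> ip x t"
  have r_ip: "inf a (r (direct_image p z)) \<le> r (direct_image p t) \<and> inf a (r (direct_image p z)) \<cdot> t \<le> x"
    if az: "(a, z) \<in> \<aa> x" "(a, z) \<in> \<pi>2 t" for a z
  proof -
    \<comment> \<open>The part of \<open>z\<close> that arrows of \<open>a\<close> can move; it lies
      in \<open>t\<close>, so the section property recovers it from its projection.\<close>
    let ?z = "inf z (p (direct_image r a))"
    have zt: "?z \<le> t" using az(2) by (simp add: \<pi>2_iff)
    have "inf a (r (direct_image r a)) = a" by (rule inf_absorb1[OF direct_image_unit[OF r_open]])
    then have ra: "inf a (r (direct_image p ?z)) = inf a (r (direct_image p z))"
      unfolding direct_image_frobenius[OF p_open] frame_hom_inf[OF r]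
      by (metis inf.assoc inf.commute)
    have "r (direct_image p ?z) \<le> r (direct_image p t)"
      by (rule frame_hom_mono[OF r direct_image_mono[OF p_open zt]])
    then have 1: "inf a (r (direct_image p z)) \<le> r (direct_image p t)"
      unfolding ra[symmetric] by (rule le_infI2)
    have "inf a (r (direct_image p z)) \<cdot> t = a \<cdot> ?z"
      by (simp only: ra[symmetric] act_balance section_ofD[OF t zt])
    also have "\<dots> \<le> a \<cdot> z" by (rule act_mono) auto
    also have "\<dots> \<le> x" using az(1) by (simp add: act_le_iff)
    finally show ?thesis using 1 by (rule conjI[rotated])
  qed
  have "ip x t \<le> r (direct_image p t)" unfolding ip_def using r_ip by (intro Sup_least) auto
  then show "direct_image r a \<le> direct_image p t"
    using a by (simp add: direct_image_le_iff[OF r_open])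
  have "ip x t \<cdot> t \<le> x" unfolding ip_def using r_ip by (intro act_Sup_left_le) auto
  then show "a \<cdot> t \<le> x" using act_mono[OF a order.refl, of t] by simp
next
  assume *: "direct_image r a \<le> direct_image p t \<and> a \<cdot> t \<le> x"
  have "(a, t) \<in> \<aa> x \<inter> \<pi>2 t" using * by (simp add: act_le_iff \<pi>2_iff)
  then have "(a, t) \<in> \<pi>1 (ip x t)" using ip_le_iff by blast
  moreover have "a \<le> r (direct_image p t)" using * by (simp add: direct_image_le_iff[OF r_open])
  ultimately show "a \<le> ip x t" by (simp add: \<pi>1_iff inf_absorb1)
qed

text \<open>By join density it suffices to treat a partial unit \<open>v\<close> and a section
  \<open>t\<close>. Moving \<open>v\<close> across gives that \<open>i v\<close> times
  \<open>?w\<close> is below \<open>ip x t\<close>; as the domain of \<open>?w\<close> lies in that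
  of \<open>v\<close>, the factor \<open>qmult G v (i v)\<close> can be put in front of
  \<open>?w\<close>.\<close>

lemma ip_act_le: "ip (a \<cdot> x) y \<le> qmult G a (ip x y)"
proof -
  have *: "ip (v \<cdot> x) t \<le> qmult G v (ip x t)"
    if v: "v \<in> partial_units G" and t: "section_of p t" for v t
  proof -
    let ?w = "ip (v \<cdot> x) t" and ?v' = "i v"
    have "direct_image r ?w \<le> direct_image p t" and wt: "?w \<cdot> t \<le> v \<cdot> x"
      using le_ip_iff[OF t] by blast+
    then have "direct_image r (qmult G ?v' ?w) \<le> direct_image p t"
      using direct_image_r_qmult_le order.trans by blast
    moreover have "qmult G ?v' ?w \<cdot> t \<le> x"
    proof -
      have "qmult G ?v' ?w \<cdot> t \<le> ?v' \<cdot> v \<cdot> x" by (simp add: act_qmult act_mono wt)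
      also have "\<dots> = qmult G ?v' v \<cdot> x" by (simp add: act_qmult)
      also have "\<dots> \<le> e \<cdot> x" using v by (intro act_mono) (auto simp: partial_unit_iff)
      finally show ?thesis by (simp add: unit_act)
    qed
    ultimately have v'w: "qmult G ?v' ?w \<le> ip x t" using le_ip_iff[OF t] by blast
    have "?w \<le> d (direct_image p (v \<cdot> x))" by (rule ip_le_d)
    also have "\<dots> \<le> d (direct_image d v)" by (rule frame_hom_mono[OF d direct_image_act_le])
    finally have "?w = qmult G (direct_image u (direct_image d v)) ?w"
      by (simp add: direct_image_u_qmult inf_absorb2)
    also have "\<dots> \<le> qmult G (qmult G v ?v') ?w"
      by (rule qmult_mono) (auto simp: qsupp_def qstar_eq simp flip: qsupp_eq)
    also have "\<dots> = qmult G v (qmult G ?v' ?w)" by (rule qmult_assoc)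
    also have "\<dots> \<le> qmult G v (ip x t)" by (rule qmult_mono[OF order.refl v'w])
    finally show ?thesis .
  qed
  have Sup1: "ip (Sup S) y = (SUP x\<in>S. ip x y)" and Sup2: "ip x (Sup S) = (SUP y\<in>S. ip x y)" for S x y
    using sup_bimorphism_ip by (simp_all add: sup_bimorphism_def)
  let ?V = "{v \<in> partial_units G. v \<le> a}" and ?T = "{t \<in> Collect (section_of p). t \<le> y}"
  have a: "Sup ?V = a" using partial_units_join_dense by (simp add: join_dense_def)
  have y: "Sup ?T = y" using local_homeomorphism_join_dense[OF p_etale] by (simp add: join_dense_def)
  have "a \<cdot> x \<le> Sup ((\<lambda>v. v \<cdot> x) ` ?V)"
    by (subst a[symmetric]) (intro act_Sup_left_le Sup_upper imageI)
  then have "ip (a \<cdot> x) y \<le> ip (Sup ((\<lambda>v. v \<cdot> x) ` ?V)) (Sup ?T)" by (simp only: y ip_mono order.refl)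
  also have "\<dots> \<le> qmult G a (ip x y)"
    unfolding Sup1 Sup2
  proof (intro SUP_least, clarify)
    fix v t assume v: "v \<in> partial_units G" "v \<le> a" and t: "section_of p t" "t \<le> y"
    have "ip (v \<cdot> x) t \<le> qmult G v (ip x t)" by (rule *[OF v(1) t(1)])
    also have "\<dots> \<le> qmult G a (ip x y)" by (intro qmult_mono v(2) ip_mono t(2) order.refl)
    finally show "ip (v \<cdot> x) t \<le> qmult G a (ip x y)" .
  qed
  finally show ?thesis .
qed

abbreviation supp :: "'c \<Rightarrow> 'b" where
  "supp x \<equiv> direct_image u (direct_image p x)"

lemma local_sections_eq: "local_sections (\<lambda>a x. a \<cdot> x) (\<lambda>x. supp x) = Collect (section_of p)"
  by (simp add: local_sections_def section_of_def[abs_def] direct_image_u_act)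

text \<open>By \<open>le_ip_iff\<close> the listed partial units are exactly those below
  \<open>ip s t\<close>, and partial units are join dense.\<close>

lemma ip_eq_Sup_partial_units:
  assumes t: "section_of p t"
  shows "ip s t = Sup {v \<in> partial_units G.
    qsupp G v \<le> supp s \<and> qsupp G (qstar G v) \<le> supp t \<and> v \<cdot> t \<le> s}" (is "_ = Sup ?V")
proof (rule order.antisym)
  have "ip s t = Sup {v \<in> partial_units G. v \<le> ip s t}"
    using partial_units_join_dense by (simp add: join_dense_def)
  also have "\<dots> \<le> Sup ?V"
  proof (rule Sup_subset_mono, safe)
    fix v assume v: "v \<le> ip s t"
    show "v \<cdot> t \<le> s" "qsupp G (qstar G v) \<le> supp t"
      using v le_ip_iff[OF t]
      by (auto simp: qsupp_eq qstar_eq direct_image_d_i direct_image_u_le_iff)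
    show "qsupp G v \<le> supp s"
      using order.trans[OF v ip_le_d]
      by (simp add: qsupp_eq direct_image_u_le_iff direct_image_le_iff[OF d_open])
  qed
  finally show "ip s t \<le> Sup ?V" .
  show "Sup ?V \<le> ip s t"
    by (rule Sup_least)
      (auto simp: le_ip_iff[OF t] qsupp_eq qstar_eq direct_image_d_i direct_image_u_le_iff)
qed

text \<open>The description has a unique solution because a map preserving joins in each variable is
  determined by its values on a base.\<close>

lemma sheaf_inner_eq: "sheaf_inner G (\<lambda>a x. a \<cdot> x) (\<lambda>x. supp x) = ip"
  unfolding sheaf_inner_def local_sections_eq
proof (rule the_equality)
  show "sup_bimorphism ip \<and>
     (\<forall>s\<in>Collect (section_of p). \<forall>t\<in>Collect (section_of p).
        ip s t = Sup {v \<in> partial_units G.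
          qsupp G v \<le> supp s \<and> qsupp G (qstar G v) \<le> supp t \<and> v \<cdot> t \<le> s})"
    using sup_bimorphism_ip ip_eq_Sup_partial_units by auto
next
  fix \<phi> assume *: "sup_bimorphism \<phi> \<and>
     (\<forall>s\<in>Collect (section_of p). \<forall>t\<in>Collect (section_of p).
        \<phi> s t = Sup {v \<in> partial_units G.
          qsupp G v \<le> supp s \<and> qsupp G (qstar G v) \<le> supp t \<and> v \<cdot> t \<le> s})"
  show "\<phi> = ip"
  proof (intro ext)
    fix x y
    let ?T = "\<lambda>y. {t \<in> Collect (section_of p). t \<le> y}"
    have T: "Sup (?T y) = y" for y
      using local_homeomorphism_join_dense[OF p_etale] by (simp add: join_dense_def)
    have expand: "\<psi> x y = (SUP s\<in>?T x. SUP t\<in>?T y. \<psi> s t)"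
      if \<psi>: "sup_bimorphism \<psi>" for \<psi> :: "'c \<Rightarrow> 'c \<Rightarrow> 'b"
    proof -
      have 1: "\<psi> (Sup S) z = (SUP s\<in>S. \<psi> s z)" and 2: "\<psi> z (Sup S) = (SUP t\<in>S. \<psi> z t)" for S z
        using \<psi> by (simp_all add: sup_bimorphism_def)
      have "\<psi> x y = \<psi> (Sup (?T x)) (Sup (?T y))" by (simp only: T)
      also have "\<dots> = (SUP s\<in>?T x. \<psi> s (Sup (?T y)))" by (rule 1)
      also have "\<dots> = (SUP s\<in>?T x. SUP t\<in>?T y. \<psi> s t)" by (simp only: 2)
      finally show ?thesis .
    qed
    have "\<phi> s t = ip s t" if "s \<in> ?T x" "t \<in> ?T y" for s t
      using * that ip_eq_Sup_partial_units[of t s] by auto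
    then have "(SUP s\<in>?T x. SUP t\<in>?T y. \<phi> s t) = (SUP s\<in>?T x. SUP t\<in>?T y. ip s t)"
      by (intro SUP_cong refl)
    then show "\<phi> x y = ip x y" using * expand[of \<phi>] expand[OF sup_bimorphism_ip] by simp
  qed
qed

lemma ip_top: "ip top top = r (direct_image p top)"
proof (rule order.antisym)
  have t: "(a, z) \<in> \<pi>2 top" "(a, z) \<in> \<aa> top" for a z by (simp_all add: \<pi>2_iff act_le_iff[symmetric])
  have "inf a (r (direct_image p z)) \<le> r (direct_image p top)" for a z
    by (intro le_infI2 frame_hom_mono[OF r] direct_image_mono[OF p_open]) simp
  then show "ip top top \<le> r (direct_image p top)" unfolding ip_def by (intro Sup_least) auto
  have "inf top (r (direct_image p top)) \<le> ip top top"
    unfolding ip_def by (rule Sup_upper, rule rev_image_eqI[of "(top, top)"]) (use t in auto)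
  then show "r (direct_image p top) \<le> ip top top" by simp
qed

text \<open>Restricting \<open>ip top top\<close> to units gives the image of \<open>p\<close>. Used
  for the left projection it is condition 4, and for the right projection condition 2.\<close>

lemma surjection_iff_ip_top: "surjection p \<longleftrightarrow> e \<le> ip top top"
  by (simp add: ip_top unit_le_iff u_r surjection_iff_direct_image_top[OF p_open])

end

subsection \<open>Right actions as left actions\<close>

locale right_action = localic_gpd G for G :: "('o::frame, 'm::frame) groupoid_data" +
  fixes q :: "'o \<Rightarrow> 'x::frame" and \<bb> :: "'x \<Rightarrow> ('x \<times> 'm) set"
  assumes right_glocale: "right_glocale G q \<bb>"
begin

abbreviation "XG \<equiv> pullback UNIV UNIV q d"
abbreviation "\<kappa>1 \<equiv> proj1 UNIV UNIV q d"
abbreviation "\<kappa>2 \<equiv> proj2 UNIV UNIV q d"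
abbreviation "XGG \<equiv> pullback XG UNIV (r \<odot> \<kappa>2) d"
abbreviation "\<mu>1 \<equiv> proj1 XG UNIV (r \<odot> \<kappa>2) d"
abbreviation "\<mu>2 \<equiv> proj2 XG UNIV (r \<odot> \<kappa>2) d"

lemma q: "locale_map UNIV UNIV q" and \<bb>: "locale_map XG UNIV \<bb>"
  and q_\<bb>: "q \<odot> \<bb> = r \<odot> \<kappa>2"
  and \<bb>_unit: "\<bb> \<odot> pairing UNIV id (u \<odot> q) = id"
  and \<bb>_assoc: "\<bb> \<odot> pairing XGG (\<bb> \<odot> \<mu>1) \<mu>2 =
     \<bb> \<odot> pairing XGG (\<kappa>1 \<odot> \<mu>1) (m \<odot> pairing XGG (\<kappa>2 \<odot> \<mu>1) \<mu>2)"
  using right_glocale unfolding right_glocale_def Let_def by blast+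

lemma XGG_args: "frame_on XG" "frame_on (UNIV :: 'm set)" "locale_map XG UNIV (r \<odot> \<kappa>2)"
  "locale_map UNIV UNIV d"
  using PB_frame[OF q d] frame_on_UNIV locale_map_comp[OF PB_proj2[OF q d] r] d by auto

lemma ract_map:
  assumes "frame_on T" "locale_map T UNIV x" "locale_map T UNIV g" "q \<odot> x = d \<odot> g"
  shows "locale_map T UNIV (\<bb> \<odot> pairing T x g)" "q \<odot> (\<bb> \<odot> pairing T x g) = r \<odot> g"
proof -
  show "locale_map T UNIV (\<bb> \<odot> pairing T x g)"
    by (rule locale_map_comp[OF PB_pairing_map[OF q d assms] \<bb>])
  show "q \<odot> (\<bb> \<odot> pairing T x g) = r \<odot> g"
    by (simp add: loc_comp_eq_left[OF q_\<bb>] loc_comp_assoc PB_pairing_proj2[OF q d assms])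
qed

lemma ract_assoc:
  assumes T: "frame_on T" and x: "locale_map T UNIV x" and g: "locale_map T UNIV g"
    and h: "locale_map T UNIV h" and xg: "q \<odot> x = d \<odot> g" and gh: "r \<odot> g = d \<odot> h"
  shows "\<bb> \<odot> pairing T (\<bb> \<odot> pairing T x g) h = \<bb> \<odot> pairing T x (m \<odot> pairing T g h)"
proof -
  let ?xg = "pairing T x g"
  let ?t = "pairing T ?xg h"
  have xgm: "locale_map T XG ?xg" by (rule PB_pairing_map[OF q d T x g xg])
  have k1: "\<kappa>1 \<odot> ?xg = x" and k2: "\<kappa>2 \<odot> ?xg = g"
    using PB_pairing_proj1[OF q d T x g xg] PB_pairing_proj2[OF q d T x g xg] by auto
  have xgh: "(r \<odot> \<kappa>2) \<odot> ?xg = d \<odot> h" by (simp add: loc_comp_assoc k2 gh)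
  note args = XGG_args T xgm h xgh
  have t: "locale_map T XGG ?t" by (rule pairing_locale_map[OF args])
  have c1: "(f \<odot> \<mu>1) \<odot> ?t = f \<odot> ?xg" if "\<And>z. f z \<in> XG" for f :: "'z \<Rightarrow> _"
    by (rule ext) (simp add: loc_comp_apply pairing_proj1[OF args that])
  have c2: "\<mu>2 \<odot> ?t = h"
    by (rule ext) (simp add: loc_comp_apply pairing_proj2[OF args])
  have mem: "\<bb> z \<in> XG" "\<kappa>1 z \<in> XG" "\<kappa>2 z' \<in> XG" for z z'
    using locale_map_mem[OF \<bb>] PB_proj1_mem[OF q d] PB_proj2_mem[OF q d] by auto
  have XGG_frame: "frame_on XGG" by (rule pullback_frame[OF XGG_args])
  have \<mu>1: "locale_map XGG XG \<mu>1" by (rule proj1_locale_map[OF XGG_args])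
  have \<mu>2: "locale_map XGG UNIV \<mu>2" by (rule proj2_locale_map[OF XGG_args])
  have maps: "locale_map XGG UNIV (\<bb> \<odot> \<mu>1)" "locale_map XGG UNIV (\<kappa>1 \<odot> \<mu>1)"
    "locale_map XGG UNIV (\<kappa>2 \<odot> \<mu>1)"
    by (rule locale_map_comp[OF \<mu>1 \<bb>] locale_map_comp[OF \<mu>1 PB_proj1[OF q d]]
        locale_map_comp[OF \<mu>1 PB_proj2[OF q d]])+
  have "r \<odot> (\<kappa>2 \<odot> \<mu>1) = d \<odot> \<mu>2"
    using pullback_commutes[OF XGG_args] by (simp add: loc_comp_assoc)
  then have mult: "locale_map XGG UNIV (m \<odot> pairing XGG (\<kappa>2 \<odot> \<mu>1) \<mu>2)"
    by (rule mult_map(1)[OF XGG_frame maps(3) \<mu>2])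
  have "(\<bb> \<odot> pairing XGG (\<bb> \<odot> \<mu>1) \<mu>2) \<odot> ?t = \<bb> \<odot> pairing T (\<bb> \<odot> ?xg) h"
    by (simp add: loc_comp_pairing_comp[OF XGG_frame maps(1) \<mu>2 t] c1 c2 mem)
  moreover have "(\<bb> \<odot> pairing XGG (\<kappa>1 \<odot> \<mu>1) (m \<odot> pairing XGG (\<kappa>2 \<odot> \<mu>1) \<mu>2)) \<odot> ?t =
     \<bb> \<odot> pairing T x (m \<odot> pairing T g h)"
    by (simp add: loc_comp_pairing_comp[OF XGG_frame maps(2) mult t]
        loc_comp_pairing_comp[OF XGG_frame maps(3) \<mu>2 t] c1 c2 mem k1 k2)
  ultimately show ?thesis using \<bb>_assoc by simp
qed

text \<open>The left action \<open>(g, x) \<mapsto> x g\<^sup>-\<^sup>1\<close>.\<close>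

definition lact_of_ract :: "'x \<Rightarrow> ('m \<times> 'x) set" where
  "lact_of_ract = \<bb> \<odot> pairing (pullback UNIV UNIV r q) (proj2 UNIV UNIV r q) (i \<odot> proj1 UNIV UNIV r q)"

lemma lact_of_ract_args:
  "frame_on (pullback UNIV UNIV r q)" "locale_map (pullback UNIV UNIV r q) UNIV (proj2 UNIV UNIV r q)"
  "locale_map (pullback UNIV UNIV r q) UNIV (i \<odot> proj1 UNIV UNIV r q)"
  "q \<odot> proj2 UNIV UNIV r q = d \<odot> (i \<odot> proj1 UNIV UNIV r q)"
  using PB_frame[OF r q] PB_proj2[OF r q] locale_map_comp[OF PB_proj1[OF r q] i] PB_commutes[OF r q]
  by (simp_all add: loc_comp_eq_left[OF d_i])

lemma lact_of_ract_map: "locale_map (pullback UNIV UNIV r q) UNIV lact_of_ract"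
  unfolding lact_of_ract_def by (rule ract_map(1)[OF lact_of_ract_args])

lemma lact_of_ract_pairing:
  assumes T: "frame_on T" and g: "locale_map T UNIV g" and x: "locale_map T UNIV x"
    and gx: "r \<odot> g = q \<odot> x"
  shows "lact_of_ract \<odot> pairing T g x = \<bb> \<odot> pairing T x (i \<odot> g)"
proof -
  note t = PB_pairing_map[OF r q assms]
  show ?thesis
    unfolding lact_of_ract_def
    by (simp add: pairing_loc_comp[OF lact_of_ract_args(1-3) t] loc_comp_assoc
        PB_pairing_proj1[OF r q assms] PB_pairing_proj2[OF r q assms])
qed

text \<open>Inversion reverses products, so x (gh)^-1 = (x h^-1) g^-1, which turns right
  associativity into left associativity; the unit law holds because inversion fixes units.\<close>

lemma left_glocale_lact_of_ract: "left_glocale G q lact_of_ract"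
proof -
  let ?G2 = "pullback UNIV UNIV r d"
  let ?\<gamma>1 = "proj1 UNIV UNIV r d" and ?\<gamma>2 = "proj2 UNIV UNIV r d"
  let ?T = "pullback ?G2 UNIV (r \<odot> ?\<gamma>2) q"
  let ?\<rho>1 = "proj1 ?G2 UNIV (r \<odot> ?\<gamma>2) q" and ?\<rho>2 = "proj2 ?G2 UNIV (r \<odot> ?\<gamma>2) q"
  let ?L = lact_of_ract
  have args: "frame_on ?G2" "frame_on (UNIV :: 'x set)" "locale_map ?G2 UNIV (r \<odot> ?\<gamma>2)"
    "locale_map UNIV UNIV q"
    using PB_frame[OF r d] frame_on_UNIV locale_map_comp[OF PB_proj2[OF r d] r] q by auto
  have T: "frame_on ?T" by (rule pullback_frame[OF args])
  have \<rho>1: "locale_map ?T ?G2 ?\<rho>1" by (rule proj1_locale_map[OF args])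
  have \<rho>2: "locale_map ?T UNIV ?\<rho>2" by (rule proj2_locale_map[OF args])
  let ?g = "?\<gamma>1 \<odot> ?\<rho>1" and ?h = "?\<gamma>2 \<odot> ?\<rho>1"
  have g: "locale_map ?T UNIV ?g" by (rule locale_map_comp[OF \<rho>1 PB_proj1[OF r d]])
  have h: "locale_map ?T UNIV ?h" by (rule locale_map_comp[OF \<rho>1 PB_proj2[OF r d]])
  have gh: "r \<odot> ?g = d \<odot> ?h" using PB_commutes[OF r d] by (simp add: loc_comp_assoc[symmetric])
  have hx: "r \<odot> ?h = q \<odot> ?\<rho>2" using pullback_commutes[OF args] by (simp add: loc_comp_assoc)
  have ig: "locale_map ?T UNIV (i \<odot> ?g)" and ih: "locale_map ?T UNIV (i \<odot> ?h)"
    using g h i locale_map_comp by blast+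
  \<comment> \<open>The projections of \<open>?G2\<close> pair to the identity, so \<open>m\<close>
    itself is a product of generalised elements and \<open>inv_mult\<close> applies to it.\<close>
  have "pairing ?G2 ?\<gamma>1 ?\<gamma>2 U = U" if "U \<in> ?G2" for U
    using pairing_unique[OF frame_on_UNIV frame_on_UNIV r d PB_frame[OF r d] PB_proj1[OF r d]
        PB_proj2[OF r d] PB_commutes[OF r d] locale_map_id _ _ that] by simp
  then have "m = m \<odot> pairing ?G2 ?\<gamma>1 ?\<gamma>2"
    using locale_map_mem[OF m] by (auto simp: loc_comp_def)
  then have "m \<odot> ?\<rho>1 = (m \<odot> pairing ?G2 ?\<gamma>1 ?\<gamma>2) \<odot> ?\<rho>1" by simp
  also have "\<dots> = m \<odot> pairing ?T ?g ?h"
    by (rule loc_comp_pairing_comp[OF PB_frame[OF r d] PB_proj1[OF r d] PB_proj2[OF r d] \<rho>1])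
  finally have m\<rho>1: "m \<odot> ?\<rho>1 = m \<odot> pairing ?T ?g ?h" .
  have rm: "r \<odot> (m \<odot> ?\<rho>1) = q \<odot> ?\<rho>2" by (simp only: m\<rho>1 mult_range[OF T g h gh] hx)
  have dih: "q \<odot> ?\<rho>2 = d \<odot> (i \<odot> ?h)" by (simp only: loc_comp_eq_left[OF d_i] hx)
  have ihig: "r \<odot> (i \<odot> ?h) = d \<odot> (i \<odot> ?g)"
    by (simp only: loc_comp_eq_left[OF d_i] loc_comp_eq_left[OF r_i] gh)
  have hx': "?L \<odot> pairing ?T ?h ?\<rho>2 = \<bb> \<odot> pairing ?T ?\<rho>2 (i \<odot> ?h)"
    by (rule lact_of_ract_pairing[OF T h \<rho>2 hx])
  note y = ract_map[OF T \<rho>2 ih dih]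
  have gy: "r \<odot> ?g = q \<odot> (\<bb> \<odot> pairing ?T ?\<rho>2 (i \<odot> ?h))"
    by (simp only: y(2) gh loc_comp_eq_left[OF r_i])
  have assoc: "?L \<odot> pairing ?T (m \<odot> ?\<rho>1) ?\<rho>2 = ?L \<odot> pairing ?T ?g (?L \<odot> pairing ?T ?h ?\<rho>2)"
  proof -
    have "?L \<odot> pairing ?T (m \<odot> ?\<rho>1) ?\<rho>2 = \<bb> \<odot> pairing ?T ?\<rho>2 (i \<odot> (m \<odot> ?\<rho>1))"
      by (rule lact_of_ract_pairing[OF T locale_map_comp[OF \<rho>1 m] \<rho>2 rm])
    also have "\<dots> = \<bb> \<odot> pairing ?T ?\<rho>2 (m \<odot> pairing ?T (i \<odot> ?h) (i \<odot> ?g))"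
      by (simp only: m\<rho>1 inv_mult[OF T g h gh])
    also have "\<dots> = \<bb> \<odot> pairing ?T (\<bb> \<odot> pairing ?T ?\<rho>2 (i \<odot> ?h)) (i \<odot> ?g)"
      by (rule ract_assoc[OF T \<rho>2 ih ig dih ihig, symmetric])
    also have "\<dots> = ?L \<odot> pairing ?T ?g (\<bb> \<odot> pairing ?T ?\<rho>2 (i \<odot> ?h))"
      by (rule lact_of_ract_pairing[OF T g y(1) gy, symmetric])
    finally show ?thesis by (simp only: hx')
  qed
  have unit: "?L \<odot> pairing UNIV (u \<odot> q) id = id"
  proof -
    have "?L \<odot> pairing UNIV (u \<odot> q) id = \<bb> \<odot> pairing UNIV id (i \<odot> (u \<odot> q))"
      by (rule lact_of_ract_pairing[OF frame_on_UNIV locale_map_comp[OF q u] locale_map_id])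
        (simp add: loc_comp_eq_left[OF r_u])
    also have "\<dots> = id" by (simp add: loc_comp_eq_left[OF i_u] \<bb>_unit)
    finally show ?thesis .
  qed
  have "q \<odot> ?L = d \<odot> proj1 UNIV UNIV r q"
    unfolding lact_of_ract_def using ract_map(2)[OF lact_of_ract_args] by (simp add: loc_comp_eq_left[OF r_i])
  then show ?thesis
    unfolding left_glocale_def Let_def using q lact_of_ract_map unit assoc by blast
qed

lemma lact_of_ract_iff: "(b, x) \<in> lact_of_ract y \<longleftrightarrow> (x, i b) \<in> \<bb> y"
proof -
  let ?P = "pullback UNIV UNIV r q"
  have W: "\<bb> y \<in> XG" using locale_map_mem[OF \<bb>] by simp
  have i_bal: "i (r c) = d c" "i (d c) = r c" for c
    using d_i r_i by (metis loc_comp_apply)+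
  let ?V = "{(b, x). (x, i b) \<in> \<bb> y}"
  have V: "?V \<in> ?P"
  proof (rule PB_I[OF r q]; clarsimp)
    show "(x', i b') \<in> \<bb> y" if "(x, i b) \<in> \<bb> y" "b' \<le> b" "x' \<le> x" for b x b' x'
      using PB_down[OF q d W that(1,3)] frame_hom_mono[OF i that(2)] by blast
    show "(x, i (Sup S)) \<in> \<bb> y" if "\<And>b. b \<in> S \<Longrightarrow> (x, i b) \<in> \<bb> y" for S x
      unfolding frame_hom_Sup[OF i] by (rule PB_Sup2[OF q d W]) (use that in auto)
    show "(Sup S, i b) \<in> \<bb> y" if "\<And>x. x \<in> S \<Longrightarrow> (x, i b) \<in> \<bb> y" for S b
      using that by (rule PB_Sup1[OF q d W])
    show "(x, i (inf b (r c))) \<in> \<bb> y \<longleftrightarrow> (inf (q c) x, i b) \<in> \<bb> y" for b x c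
      using PB_bal[OF q d W, of x c "i b"] by (simp add: frame_hom_inf[OF i] i_bal inf.commute)
  qed
  have L: "lact_of_ract y = join_in ?P ((\<lambda>(x, b). inf (proj2 UNIV UNIV r q x) (proj1 UNIV UNIV r q (i b))) ` \<bb> y)"
    by (simp add: lact_of_ract_def loc_comp_def pairing_def)
  show ?thesis
  proof
    have "lact_of_ract y \<subseteq> ?V"
      unfolding L
    proof (rule join_in_least[OF V])
      fix U assume "U \<in> (\<lambda>(x, b). inf (proj2 UNIV UNIV r q x) (proj1 UNIV UNIV r q (i b))) ` \<bb> y"
      then obtain x b where xb: "(x, b) \<in> \<bb> y" and U: "U = tensor UNIV UNIV r q (i b) x"
        by (auto simp: tensor_def inf_commute)
      show "U \<le> ?V" unfolding U tensor_subset_iff[OF r q V] using xb by (simp add: i_i_apply)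
    qed
    then show "(b, x) \<in> lact_of_ract y \<Longrightarrow> (x, i b) \<in> \<bb> y" by auto
  next
    assume "(x, i b) \<in> \<bb> y"
    then have "inf (proj2 UNIV UNIV r q x) (proj1 UNIV UNIV r q (i (i b))) \<subseteq> lact_of_ract y"
      unfolding L by (intro join_in_upper) force
    then show "(b, x) \<in> lact_of_ract y"
      using tensor_gen[OF r q, of b x] by (auto simp: tensor_def i_i_apply)
  qed
qed

lemma direct_image_ract:
  "direct_image \<bb> (tensor UNIV UNIV q d x b) = direct_image lact_of_ract (tensor UNIV UNIV r q (i b) x)"
  unfolding direct_image_def
  by (simp add: tensor_subset_iff[OF q d locale_map_mem[OF \<bb>]] lact_of_ract_iff i_i_apply
      tensor_subset_iff[OF r q locale_map_mem[OF lact_of_ract_map]])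

end

subsection \<open>Principal bisheaves\<close>

lemma locale_isoI:
  assumes A: "frame_on A" and B: "frame_on B" and f: "locale_map A B f"
    and surj: "A \<subseteq> f ` B" and emb: "\<And>x y. x \<in> B \<Longrightarrow> y \<in> B \<Longrightarrow> f x \<le> f y \<Longrightarrow> x \<le> y"
  shows "locale_iso A B f"
proof -
  let ?g = "inv_into B f"
  have inj: "x = y" if "x \<in> B" "y \<in> B" "f x = f y" for x y
    using emb[OF that(1,2)] emb[OF that(2,1)] that(3) by (simp add: order.antisym)
  have g: "?g a \<in> B" and fg: "f (?g a) = a" if "a \<in> A" for a
    using that surj by (auto intro: inv_into_into f_inv_into_f)
  have gf: "?g (f x) = x" if "x \<in> B" for x
    using that inj by (auto intro: inv_into_f_f inj_onI)
  have top: "Sup A \<in> A" "Sup B \<in> B" using A B frame_on_top by auto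
  have "locale_map B A ?g"
    unfolding locale_map_def
  proof (intro conjI ballI allI impI)
    show "?g ` A \<subseteq> B" using g by auto
    show "?g (Sup A) = Sup B" using gf[OF top(2)] locale_map_Sup[OF f] by simp
    show "?g (inf x y) = inf (?g x) (?g y)" if "x \<in> A" "y \<in> A" for x y
      using gf[OF frame_on_inf[OF B g[OF that(1)] g[OF that(2)]]]
      by (simp add: locale_map_inf[OF f] g fg that)
    show "?g (join_in A S) = join_in B (?g ` S)" if S: "S \<subseteq> A" for S
    proof -
      have gS: "?g ` S \<subseteq> B" using S g by auto
      have "f ` ?g ` S = S" unfolding image_image using S fg by force
      then have "f (join_in B (?g ` S)) = join_in A S" using locale_map_join[OF f gS] by simp
      then show ?thesis using gf[OF frame_on_join[OF B gS]] by simp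
    qed
  qed
  then show ?thesis unfolding locale_iso_def using f gf fg by blast
qed

lemma locale_isoD:
  assumes "locale_iso A B f"
  shows locale_iso_surj: "a \<in> A \<Longrightarrow> \<exists>b\<in>B. f b = a"
    and locale_iso_emb: "x \<in> B \<Longrightarrow> y \<in> B \<Longrightarrow> f x \<le> f y \<Longrightarrow> x \<le> y"
proof -
  obtain g where f: "locale_map A B f" and g: "locale_map B A g"
    and gf: "\<forall>y\<in>B. g (f y) = y" and fg: "\<forall>x\<in>A. f (g x) = x"
    using assms unfolding locale_iso_def by blast
  show "a \<in> A \<Longrightarrow> \<exists>b\<in>B. f b = a" using g fg locale_map_mem by metis
  show "x \<in> B \<Longrightarrow> y \<in> B \<Longrightarrow> f x \<le> f y \<Longrightarrow> x \<le> y"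
    using locale_map_mono[OF g] locale_map_mem[OF f] gf by metis
qed

locale invariant_sheaf = gsheaf G p \<aa>
  for G :: "('o::frame, 'm::frame) groupoid_data" and p :: "'o \<Rightarrow> 'x::frame" and \<aa> +
  fixes q :: "'h::frame \<Rightarrow> 'x"
  assumes q_etale: "local_homeomorphism q" and q_\<aa>: "q \<odot> \<aa> = q \<odot> \<pi>2"
begin

abbreviation "XX \<equiv> pullback UNIV UNIV q q"
abbreviation "\<kappa>1 \<equiv> proj1 UNIV UNIV q q"
abbreviation "\<kappa>2 \<equiv> proj2 UNIV UNIV q q"
abbreviation "\<phi> \<equiv> pairing GX \<aa> \<pi>2"

lemma q_open: "open_map q" by (rule local_homeomorphism_open[OF q_etale])
lemma q: "locale_map UNIV UNIV q" by (rule open_map_hom[OF q_open])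

lemma XX_frame: "frame_on XX" by (rule PB_frame[OF q q])

lemma \<phi>: "locale_map GX XX \<phi>"
  and \<phi>_\<kappa>1: "\<phi> (\<kappa>1 x) = \<aa> x" and \<phi>_\<kappa>2: "\<phi> (\<kappa>2 x) = \<pi>2 x"
  using PB_pairing_map[OF q q GX_frame \<aa> \<pi>2 q_\<aa>] PB_pairing_proj1[OF q q GX_frame \<aa> \<pi>2 q_\<aa>]
    PB_pairing_proj2[OF q q GX_frame \<aa> \<pi>2 q_\<aa>]
  by (auto simp: loc_comp_def fun_eq_iff)

lemma \<phi>_upper: "(x, y) \<in> U \<Longrightarrow> \<aa> x \<inter> \<pi>2 y \<subseteq> \<phi> U"
  unfolding pairing_def by (metis (no_types, lifting) case_prod_conv image_eqI inf_set_def join_in_upper le_iff_inf inf_commute)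

lemma \<phi>_least: "V \<in> GX \<Longrightarrow> (\<And>x y. (x, y) \<in> U \<Longrightarrow> \<aa> x \<inter> \<pi>2 y \<subseteq> V) \<Longrightarrow> \<phi> U \<subseteq> V"
  unfolding pairing_def by (rule join_in_least) auto

lemma direct_image_q_act_le: "direct_image q (a \<cdot> x) \<le> direct_image q x"
proof -
  have "a \<cdot> x = a \<cdot> inf x (q (direct_image q x))"
    using direct_image_unit[OF q_open, of x] by (simp add: inf_absorb1)
  then have "a \<cdot> x \<le> q (direct_image q x)"
    unfolding act_inf_invariant[OF q q_\<aa>] by (metis inf_le2)
  then show ?thesis by (simp add: direct_image_le_iff[OF q_open])
qed

text \<open>The part of \<open>s\<close> over the image of \<open>y\<close> is \<open>y\<close>
  itself, and \<open>x\<close> lives over that image, so enlarging \<open>y\<close> to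
  \<open>s\<close> adds nothing to the rectangle.\<close>

lemma XX_section:
  assumes W: "W \<in> XX" and s: "section_of q s" and y: "y \<le> s"
    and x: "direct_image q x \<le> direct_image q y" and xy: "(x, y) \<in> W"
  shows "(x, s) \<in> W"
proof -
  have "x \<le> q (direct_image q y)" using x by (simp add: direct_image_le_iff[OF q_open])
  then have "inf x (q (direct_image q y)) = x" by (rule inf_absorb1)
  moreover have "(x, inf (q (direct_image q y)) s) \<in> W" using xy by (simp only: section_ofD[OF s y])
  ultimately show ?thesis using PB_bal[OF q q W, of x "direct_image q y" s] by simp
qed

lemma bisections_join_dense: "join_dense (Collect (section_of p) \<inter> Collect (section_of q))"
  using join_dense_Int[OF local_homeomorphism_join_dense[OF p_etale] local_homeomorphism_join_dense[OF q_etale]]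
  by (auto intro: section_of_down)

text \<open>This recovers rectangles of \<open>V\<close> from its inverse image. Pointwise, if (gz,
  z) is in \<open>V\<close> and z is in \<open>s\<close>, then z is the only point of
  \<open>s\<close> in its fibre of \<open>q\<close>, so the second factor may be taken to be all of
  \<open>s\<close>.\<close>

lemma \<phi>_section:
  assumes V: "V \<in> XX" and s: "section_of q s" and az: "(a, z) \<in> \<phi> V"
  shows "(a \<cdot> inf z s, s) \<in> V"
proof -
  let ?N = "{(a, z). (a \<cdot> inf z s, s) \<in> V}"
  have down: "(x, s) \<in> V \<Longrightarrow> x' \<le> x \<Longrightarrow> (x', s) \<in> V" for x x' using PB_down[OF q q V] by blast
  have N: "?N \<in> GX"
  proof (rule PB_I[OF r p]; clarsimp)
    show "(a' \<cdot> inf z' s, s) \<in> V" if "(a \<cdot> inf z s, s) \<in> V" "a' \<le> a" "z' \<le> z" for a z a' z'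
      by (rule down[OF that(1)]) (intro act_mono inf_mono that order.refl)
    show "(Sup S \<cdot> inf z s, s) \<in> V" if "\<And>a. a \<in> S \<Longrightarrow> (a \<cdot> inf z s, s) \<in> V" for S z
    proof (rule down)
      show "(Sup ((\<lambda>a. a \<cdot> inf z s) ` S), s) \<in> V" using that by (auto intro: PB_Sup1[OF q q V])
      show "Sup S \<cdot> inf z s \<le> Sup ((\<lambda>a. a \<cdot> inf z s) ` S)"
        by (intro act_Sup_left_le Sup_upper imageI)
    qed
    show "(a \<cdot> inf (Sup S) s, s) \<in> V" if "\<And>z. z \<in> S \<Longrightarrow> (a \<cdot> inf z s, s) \<in> V" for S a
    proof (rule down)
      show "(Sup ((\<lambda>z. a \<cdot> inf z s) ` S), s) \<in> V" using that by (auto intro: PB_Sup1[OF q q V])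
      have "inf (Sup S) s = Sup (inf s ` S)" by (simp only: inf.commute[of "Sup S"] inf_Sup_distrib)
      moreover have "a \<cdot> Sup (inf s ` S) \<le> Sup ((\<lambda>z. a \<cdot> inf z s) ` S)"
        by (rule act_Sup_right_le) (auto simp: inf.commute intro: Sup_upper)
      ultimately show "a \<cdot> inf (Sup S) s \<le> Sup ((\<lambda>z. a \<cdot> inf z s) ` S)" by simp
    qed
    show "(inf a (r c) \<cdot> inf z s, s) \<in> V \<longleftrightarrow> (a \<cdot> inf (inf (p c) z) s, s) \<in> V" for a z c
      by (simp add: act_balance inf.assoc)
  qed
  have "\<phi> V \<subseteq> ?N"
  proof (rule \<phi>_least[OF N], clarify)
    fix x y a z assume xy: "(x, y) \<in> V" and az: "(a, z) \<in> \<aa> x" "(a, z) \<in> \<pi>2 y"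
    let ?z = "inf (p (direct_image r a)) (inf z s)"
    have "a \<cdot> ?z \<le> x"
      using az(1) act_mono[OF order.refl, of ?z z a] by (simp add: act_le_iff[symmetric] inf.coboundedI2)
    moreover have "?z \<le> y"
      using az(2) by (simp add: \<pi>2_iff) (metis inf.assoc inf.commute le_infI1)
    ultimately have "(a \<cdot> ?z, ?z) \<in> V" using PB_down[OF q q V xy] by blast
    then have "(a \<cdot> ?z, s) \<in> V"
      by (rule XX_section[OF V s _ direct_image_q_act_le, rotated]) (simp add: inf.coboundedI2)
    then show "(a \<cdot> inf z s, s) \<in> V" by (simp flip: act_restrict)
  qed
  then show ?thesis using az by blast
qed

text \<open>The open \<open>W\<close> with \<open>\<phi>\<^sup>*W = \<pi>\<^sub>1\<^sup>*e\<close> contains the diagonal of \<open>X\<close>, hence \<open>s \<otimes> s\<close> for every section \<open>s\<close> of \<open>q\<close>.\<close>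

lemma ip_section_le_unit:
  assumes iso: "locale_iso GX XX \<phi>" and s: "section_of q s"
  shows "ip s s \<le> e"
proof -
  obtain W where W: "W \<in> XX" and \<phi>W: "\<phi> W = \<pi>1 e"
    using locale_iso_surj[OF iso \<pi>1_mem] by blast
  let ?\<theta> = "pairing UNIV (u \<odot> p) id"
  have up: "locale_map UNIV UNIV (u \<odot> p)" by (rule locale_map_comp[OF p u])
  have rup: "r \<odot> (u \<odot> p) = p \<odot> id" by (simp add: loc_comp_eq_left[OF r_u])
  note args = frame_on_UNIV up locale_map_id rup
  have \<theta>: "locale_map UNIV GX ?\<theta>" by (rule PB_pairing_map[OF r p args])
  have "(\<pi>1 \<odot> ?\<theta>) e = (u \<odot> p) e" by (simp only: PB_pairing_proj1[OF r p args])
  moreover have "u e = top" using unit_le_iff by blast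
  ultimately have "?\<theta> (\<phi> W) = top" by (simp add: \<phi>W loc_comp_apply frame_hom_top[OF p])
  \<comment> \<open>\<open>?\<theta>\<close> sends a point to the pair of its unit arrow and itself,
    so its composite with \<open>\<phi>\<close> is the diagonal.\<close>
  moreover have "\<phi> \<odot> ?\<theta> = pairing UNIV id id"
    using pairing_loc_comp[OF GX_frame \<aa> \<pi>2 \<theta>] PB_pairing_proj2[OF r p args] by (simp add: \<aa>_unit)
  ultimately have top: "Sup ((\<lambda>(x, y). inf x y) ` W) = top"
    by (metis (no_types, lifting) id_apply join_in_UNIV loc_comp_apply pairing_def split_def image_cong)
  have "s = Sup (inf s ` (\<lambda>(x, y). inf x y) ` W)"
    by (simp only: inf_Sup_distrib[symmetric] top inf_top_right)
  moreover have "(Sup (inf s ` (\<lambda>(x, y). inf x y) ` W), s) \<in> W"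
  proof (rule PB_Sup1[OF q q W], clarify)
    fix x y assume "(x, y) \<in> W"
    then have "(inf s (inf x y), inf s (inf x y)) \<in> W"
      using PB_down[OF q q W, of x y] by (simp add: inf.coboundedI2)
    then show "(inf s (inf x y), s) \<in> W"
      by (rule XX_section[OF W s _ order.refl, rotated]) simp
  qed
  ultimately have "(s, s) \<in> W" by simp
  then show ?thesis unfolding ip_le_iff \<phi>W[symmetric] by (rule \<phi>_upper)
qed

text \<open>Every arrow carries points of \<open>s\<close> into \<open>?y\<close>, so
  \<open>\<pi>2 s \<subseteq> \<aa> ?y\<close>. Since \<open>\<phi>\<close> reflects the order this
  becomes \<open>\<kappa>2 s \<subseteq> \<kappa>1 ?y\<close>, and testing it on
  \<open>(top, s)\<close> gives the claim.\<close>

lemma saturation_le: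
  assumes iso: "locale_iso GX XX \<phi>"
  shows "q (direct_image q s) \<le> top \<cdot> s"
proof -
  let ?y = "top \<cdot> s"
  have "\<pi>2 s \<subseteq> \<aa> ?y"
  proof (rule proj2_least[OF frame_on_UNIV frame_on_UNIV r p \<aa>_mem], clarify)
    show "(a, s) \<in> \<aa> ?y" for a unfolding act_le_iff[symmetric] by (rule act_mono) auto
  qed
  then have "\<phi> (\<kappa>2 s) \<subseteq> \<phi> (\<kappa>1 ?y)" by (simp only: \<phi>_\<kappa>1 \<phi>_\<kappa>2)
  then have "\<kappa>2 s \<subseteq> \<kappa>1 ?y"
    using locale_iso_emb[OF iso PB_proj2_mem[OF q q] PB_proj1_mem[OF q q]] by blast
  moreover have "(top, s) \<in> \<kappa>2 s" by (simp add: proj2_iff[OF q q q_open])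
  ultimately have "(top, s) \<in> \<kappa>1 ?y" by blast
  then show ?thesis by (simp add: proj1_iff[OF q q_open])
qed

lemma locale_iso_\<phi>I:
  assumes free: "\<And>s. section_of p s \<Longrightarrow> section_of q s \<Longrightarrow> ip s s \<le> e"
    and trans: "\<And>s. section_of p s \<Longrightarrow> section_of q s \<Longrightarrow> q (direct_image q s) \<le> top \<cdot> s"
  shows "locale_iso GX XX \<phi>"
proof (rule locale_isoI[OF GX_frame XX_frame \<phi>])
  show "GX \<subseteq> \<phi> ` XX"
  proof
    fix U assume U: "U \<in> GX"
    \<comment> \<open>The arrow part \<open>a\<close> of a rectangle in \<open>U\<close> is replaced
      by its effect on a local bisection \<open>s\<close>; by freeness this loses nothing.\<close>
    let ?S = "{tensor UNIV UNIV q q (a \<cdot> s) s |a s. (a, s) \<in> U \<and> section_of p s \<and> section_of q s}"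
    let ?W = "join_in XX ?S"
    have S: "?S \<subseteq> XX" using tensor_mem[OF q q] by auto
    have \<phi>W: "\<phi> ?W = join_in GX (\<phi> ` ?S)" by (rule locale_map_join[OF \<phi> S])
    have W: "?W \<in> XX" by (rule frame_on_join[OF XX_frame S])
    have \<phi>t: "\<phi> (tensor UNIV UNIV q q x y) = \<aa> x \<inter> \<pi>2 y" for x y
      unfolding tensor_def locale_map_inf[OF \<phi> PB_proj1_mem[OF q q] PB_proj2_mem[OF q q]]
      by (simp add: \<phi>_\<kappa>1 \<phi>_\<kappa>2)
    have "\<phi> ?W \<subseteq> U"
      unfolding \<phi>W
    proof (rule join_in_least[OF U])
      fix V assume "V \<in> \<phi> ` ?S"
      then obtain a s where as: "(a, s) \<in> U" and s: "section_of p s" "section_of q s"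
        and V: "V = \<aa> (a \<cdot> s) \<inter> \<pi>2 s" using \<phi>t by auto
      have "ip (a \<cdot> s) s \<le> qmult G a (ip s s)" by (rule ip_act_le)
      also have "\<dots> \<le> qmult G a e" by (rule qmult_mono[OF order.refl free[OF s]])
      also have "\<dots> \<le> a" by (rule qmult_unit_right_le)
      finally have "\<aa> (a \<cdot> s) \<inter> \<pi>2 s \<subseteq> tensor UNIV UNIV r p a s"
        unfolding ip_le_iff tensor_def by auto
      then show "V \<le> U" using as unfolding V tensor_subset_iff[OF r p U, symmetric] by blast
    qed
    moreover have "U \<subseteq> \<phi> ?W"
    proof clarify
      fix a x assume ax: "(a, x) \<in> U"
      show "(a, x) \<in> \<phi> ?W"
      proof (rule PB_dense2[OF r p locale_map_mem[OF \<phi> W] bisections_join_dense])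
        fix s assume s: "s \<in> Collect (section_of p) \<inter> Collect (section_of q)" "s \<le> x"
        then have "(a, s) \<in> U" using PB_down[OF r p U ax] by simp
        then have "\<phi> (tensor UNIV UNIV q q (a \<cdot> s) s) \<subseteq> \<phi> ?W"
          unfolding \<phi>W using s by (intro join_in_upper) auto
        moreover have "(a, s) \<in> \<aa> (a \<cdot> s) \<inter> \<pi>2 s" by (simp add: act_mem \<pi>2_iff)
        ultimately show "(a, s) \<in> \<phi> ?W" by (auto simp: \<phi>t)
      qed
    qed
    ultimately show "U \<in> \<phi> ` XX" using W by blast
  qed
next
  fix U V assume U: "U \<in> XX" and V: "V \<in> XX" and UV: "\<phi> U \<subseteq> \<phi> V"
  show "U \<le> V"
  proof clarify
    fix x y assume xy: "(x, y) \<in> U"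
    show "(x, y) \<in> V"
    proof (rule PB_dense2[OF q q V bisections_join_dense])
      fix s assume s': "s \<in> Collect (section_of p) \<inter> Collect (section_of q)" "s \<le> y"
      then have s: "section_of p s" "section_of q s" and xs: "(x, s) \<in> U"
        using PB_down[OF q q U xy] by auto
      have *: "(inf x (v \<cdot> s), s) \<in> V" if v: "v \<in> partial_units G" for v
      proof -
        \<comment> \<open>\<open>?z\<close> is the part of \<open>s\<close> that \<open>v\<close>
          carries into \<open>x\<close>; the rest of the block shows that \<open>v\<close> carries
          it onto \<open>?y\<close>.\<close>
        let ?y = "inf x (v \<cdot> s)" and ?z = "i v \<cdot> inf x (v \<cdot> s)"
        have zs: "?z \<le> s"
        proof -
          have "?z \<le> i v \<cdot> v \<cdot> s" by (rule act_mono) auto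
          also have "\<dots> = qmult G (i v) v \<cdot> s" by (simp add: act_qmult)
          also have "\<dots> \<le> e \<cdot> s" using v by (intro act_mono) (auto simp: partial_unit_iff)
          finally show ?thesis by (simp add: unit_act)
        qed
        have "v \<cdot> ?z = qmult G v (i v) \<cdot> ?y" by (simp add: act_qmult)
        also have "\<dots> \<le> e \<cdot> ?y" using v by (intro act_mono) (auto simp: partial_unit_iff)
        finally have "v \<cdot> ?z \<le> x" by (simp add: unit_act)
        then have "(v, ?z) \<in> \<aa> x \<inter> \<pi>2 s" using zs by (simp add: act_le_iff \<pi>2_iff inf.coboundedI1)
        then have "(v, ?z) \<in> \<phi> V" using \<phi>_upper[OF xs] UV by blast
        then have vz: "(v \<cdot> ?z, s) \<in> V" using \<phi>_section[OF V s(2)] zs by (metis inf.absorb1)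
        \<comment> \<open>As \<open>?y\<close> lies over the domain of \<open>v\<close>, its support
          is absorbed by \<open>qmult G v (i v)\<close>, which gives \<open>?y\<close> below
          \<open>v\<close> acting on \<open>?z\<close>.\<close>
        have "direct_image p ?y \<le> direct_image d v"
          using direct_image_mono[OF p_open, of ?y "v \<cdot> s"] direct_image_act_le order.trans by fastforce
        then have "?y \<le> p (direct_image d v)" by (simp only: direct_image_le_iff[OF p_open])
        then have "?y = qsupp G v \<cdot> ?y" by (simp only: qsupp_eq direct_image_u_act inf_absorb2)
        also have "\<dots> \<le> qmult G v (i v) \<cdot> ?y" by (rule act_mono) (auto simp: qsupp_def qstar_eq)
        also have "\<dots> = v \<cdot> ?z" by (simp add: act_qmult)
        finally show ?thesis using PB_down[OF q q V vz] by blast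
      qed
      have "inf x (q (direct_image q s)) \<le> inf x (top \<cdot> s)" by (rule inf_mono[OF order.refl trans[OF s]])
      also have "\<dots> \<le> Sup (inf x ` (\<lambda>v. v \<cdot> s) ` partial_units G)"
      proof -
        have "Sup (partial_units G) = top"
          using partial_units_join_dense[unfolded join_dense_def, rule_format, of top] by simp
        then have "top \<cdot> s = Sup (partial_units G) \<cdot> s" by simp
        also have "\<dots> \<le> Sup ((\<lambda>v. v \<cdot> s) ` partial_units G)"
          by (intro act_Sup_left_le Sup_upper imageI)
        finally show ?thesis unfolding inf_Sup_distrib[symmetric] by (rule inf_mono[OF order.refl])
      qed
      finally have le: "inf x (q (direct_image q s)) \<le> Sup (inf x ` (\<lambda>v. v \<cdot> s) ` partial_units G)" .
      have "(Sup (inf x ` (\<lambda>v. v \<cdot> s) ` partial_units G), s) \<in> V"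
        by (rule PB_Sup1[OF q q V]) (use * in auto)
      then have "(inf x (q (direct_image q s)), s) \<in> V" using PB_down[OF q q V] le by blast
      then show "(x, s) \<in> V" using PB_restrict1[OF q q V q_open] by blast
    qed
  qed
qed

text \<open>The open \<open>W\<close> with \<open>\<phi> W = \<pi>1 c\<close> is a join of
  rectangles, and applying the direct image along \<open>\<pi>1\<close> writes the image of
  \<open>\<pi>1 c\<close> as a join of inner products. That image is \<open>c\<close> because
  \<open>p\<close> is surjective.\<close>

lemma surjective_bimorphism_ip:
  assumes iso: "locale_iso GX XX \<phi>" and p_surj: "surjection p"
  shows "surjective_bimorphism ip"
  unfolding surjective_bimorphism_def
proof (intro conjI allI sup_bimorphism_ip)
  fix c
  obtain W where W: "W \<in> XX" and \<phi>W: "\<phi> W = \<pi>1 c"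
    using locale_iso_surj[OF iso \<pi>1_mem] by blast
  let ?z = "SUP (x, y)\<in>W. ip x y"
  have "\<pi>1 c \<subseteq> \<pi>1 ?z"
    unfolding \<phi>W[symmetric]
  proof (rule \<phi>_least[OF \<pi>1_mem])
    fix x y assume "(x, y) \<in> W"
    then show "\<aa> x \<inter> \<pi>2 y \<subseteq> \<pi>1 ?z" unfolding ip_le_iff[symmetric] by (intro Sup_upper) force
  qed
  moreover have "(c, top) \<in> \<pi>1 c" by (simp add: \<pi>1_iff)
  ultimately have "inf c (r (direct_image p top)) \<le> ?z" using \<pi>1_iff by blast
  then have "c \<le> ?z"
    using p_surj by (simp add: surjection_iff_direct_image_top[OF p_open] frame_hom_top[OF r])
  moreover have "?z \<le> c"
    using \<phi>_upper[of _ _ W] unfolding \<phi>W ip_le_iff[symmetric] by (auto intro!: Sup_least)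
  ultimately show "\<exists>W. c = (SUP (x, y)\<in>W. ip x y)" by (metis order.antisym)
qed

end

theorem theorem5p13:
  fixes G :: "('g0::frame, 'g1::frame) groupoid_data"
    and H :: "('h0::frame, 'h1::frame) groupoid_data"
    and X :: "('g0, 'g1, 'h0, 'h1, 'x::frame) bilocale_data"
  assumes "etale_groupoid G" and "etale_groupoid H" and "bisheaf G H X"
  shows "(principal_bisheaf G H X \<longleftrightarrow>
            (\<forall>s\<in>local_bisections G H X. left_inner G X s s \<le> qunit G) \<and>
            right_inner H X top top \<ge> qunit H \<and>
            (\<forall>s\<in>local_bisections G H X. rmod H X top (rsupp H X s) \<le> lmod G X top s))
       \<and> (surjection (lproj X) \<longleftrightarrow> left_inner G X top top \<ge> qunit G)
       \<and> (principal_bisheaf G H X \<and> surjection (lproj X) \<longrightarrow>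
            surjective_bimorphism (left_inner G X))"
proof -
  have G: "localic_groupoid G" "local_homeomorphism (gdom G)"
    and H: "localic_groupoid H" "local_homeomorphism (gdom H)"
    and p: "local_homeomorphism (lproj X)" and q: "local_homeomorphism (rproj X)"
    and left: "left_glocale G (lproj X) (lact X)" and right: "right_glocale H (rproj X) (ract X)"
    and inv: "rproj X \<odot> lact X = rproj X \<odot> proj2 UNIV UNIV (grng G) (lproj X)"
    using assms by (auto simp: etale_groupoid_def bisheaf_def bilocale_def Let_def)
  interpret L: invariant_sheaf G "lproj X" "lact X" "rproj X"
    by unfold_locales (rule G left p q inv)+
  interpret rightact: right_action H "rproj X" "ract X"
    by unfold_locales (rule H right)+
  interpret R: gsheaf H "rproj X" rightact.lact_of_ract
    by unfold_locales (rule H rightact.left_glocale_lact_of_ract q)+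
  have lmod: "lmod G X = L.act" and lsupp: "lsupp G X = L.supp"
    by (auto simp: lmod_def lsupp_def fun_eq_iff)
  have rsupp: "rsupp H X = R.supp" by (auto simp: rsupp_def fun_eq_iff)
  have rmod: "rmod H X x b = R.act (ginv H b) x" for x b
    unfolding rmod_def by (rule rightact.direct_image_ract)
  have ip: "left_inner G X = L.ip"
    using L.sheaf_inner_eq by (simp add: left_inner_def lmod lsupp)
  have rip: "right_inner H X = R.ip"
    using R.sheaf_inner_eq by (simp add: right_inner_def rmod rsupp R.qstar_eq rightact.i_i_apply)
  \<comment> \<open>Supports consist of units, which inversion fixes, so acting by one is
    restriction over the base. Condition 3 thereby says that the saturation of \<open>s\<close>
    along the right projection lies in its orbit.\<close>
  have rmod_supp: "rmod H X x (rsupp H X s) = inf (rproj X (direct_image (rproj X) s)) x" for x s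
    by (simp add: rmod rsupp R.i_direct_image_u R.direct_image_u_act)
  have "right_sections H X = Collect (section_of (rproj X))"
    by (simp add: right_sections_def local_sections_def section_of_def[abs_def] rmod_supp)
  moreover have "left_sections G X = Collect (section_of (lproj X))"
    using L.local_sections_eq by (simp add: left_sections_def lmod lsupp)
  ultimately have bi: "local_bisections G H X = {s. section_of (lproj X) s \<and> section_of (rproj X) s}"
    by (auto simp: local_bisections_def)
  have principal: "principal_bisheaf G H X \<longleftrightarrow>
      surjection (rproj X) \<and> locale_iso L.GX L.XX L.\<phi>"
    using assms(3) by (simp add: principal_bisheaf_def Let_def)
  have "locale_iso L.GX L.XX L.\<phi> \<longleftrightarrow>
      (\<forall>s\<in>local_bisections G H X. left_inner G X s s \<le> qunit G) \<and>
      (\<forall>s\<in>local_bisections G H X. rmod H X top (rsupp H X s) \<le> lmod G X top s)"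
    using L.locale_iso_\<phi>I L.ip_section_le_unit L.saturation_le
    unfolding ip bi rmod_supp lmod by auto
  then show ?thesis
    using R.surjection_iff_ip_top L.surjection_iff_ip_top L.surjective_bimorphism_ip
    unfolding principal ip rip by blast
qed

end
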